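(* Let $(M,g)$ be a spacetime which is not an Einstein space, i.e. the trace-free Ricci tensor $N = R - \frac14 r\, g$ is not zero. Then $(M,g)$ is (locally) a 2+2 product if and only if $$\tr N^2 > 0, \qquad N^2 = \tfrac14 (\tr N^2)\, g, \qquad \nabla N = \tfrac12\, d\ln[\tr N^2]\otimes N .$$ Moreover, in that case the two metric factors are $\hat v = \frac12(g+\Pi)$ and $\hat h = \frac12(g-\Pi)$, where $$\Pi = \epsilon\,\frac{2}{\sqrt{\tr N^2}}\, N, \qquad \epsilon = \frac{N(x,x)}{|N(x,x)|},$$ with $x$ an arbitrary time-like vector.
   Context: A spacetime is a 4-dimensional oriented Lorentzian manifold $(M,g)$ of signature $(-,+,+,+)$ with Levi-Civita connection $\nabla$; all statements are local. $R$ is the Ricci tensor and $r=\tr R$ the scalar curvature. A spacetime is (locally) a 2+2 product if around each point there are coordinates $(x^1,\dots,x^4)$ with $g = \hat v_{ij}(x^1,x^2)\,dx^i dx^j + \hat h_{AB}(x^3,x^4)\,dx^A dx^B$ ($i,j\in\{1,2\}$, $A,B\in\{3,4\}$), $\hat v$ a 2-dimensional Lorentzian metric and $\hat h$ a 2-dimensional Riemannian metric; these are the two metric factors. For 2-tensors, indices are moved with $g$, $(A\cdot B)^\alpha{}_\beta = A^\alpha{}_\mu B^\mu{}_\beta$, $A^2=A\cdot A$, $\tr A = A^\alpha{}_\alpha$, $A(x,x)=A_{\alpha\beta}x^\alpha x^\beta$; $(\nabla N)_{\lambda\alpha\beta}=\nabla_\lambda N_{\alpha\beta}$.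
   Formalization: The signs of the factors are corrected: the Lorentzian factor is ½(g−Π) and the Riemannian one ½(g+Π), since Π(x,x)>0 for time-like x gives Π=ĥ−v̂ (e.g. on dS₂×ℝ²); "N is not zero" is taken at every point. *)

theory Defs
  imports "HOL-Analysis.Analysis"
begin

text \<open>Local coordinate model of a spacetime: an open set U of real^4 (a coordinate chart)
  with a smooth metric field g, g x $ i $ j = g_ij(x). Coordinate indices range over the
  type 4 = {0,1,2,3}.\<close>

definition partial :: "4 \<Rightarrow> (real^4 \<Rightarrow> real) \<Rightarrow> real^4 \<Rightarrow> real" where
  "partial i f x = frechet_derivative f (at x) (axis i 1)"

fun Ck :: "nat \<Rightarrow> (real^4) set \<Rightarrow> (real^4 \<Rightarrow> real) \<Rightarrow> bool" where
  "Ck 0 U f = continuous_on U f"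
| "Ck (Suc k) U f = ((\<forall>x\<in>U. f differentiable (at x)) \<and> (\<forall>i. Ck k U (partial i f)))"

definition smooth_on :: "(real^4) set \<Rightarrow> (real^4 \<Rightarrow> real) \<Rightarrow> bool" where
  "smooth_on U f = (\<forall>k. Ck k U f)"

definition smooth_map :: "(real^4) set \<Rightarrow> (real^4 \<Rightarrow> real^4) \<Rightarrow> bool" where
  "smooth_map U \<phi> = (\<forall>i. smooth_on U (\<lambda>y. \<phi> y $ i))"

definition eta4 :: "real^4^4" where
  "eta4 = (\<chi> i j. if i = j then (if i = 0 then -1 else 1) else 0)"

definition lorentzian4 :: "real^4^4 \<Rightarrow> bool" where
  "lorentzian4 G = (transpose G = G \<and> (\<exists>P. invertible P \<and> transpose P ** G ** P = eta4))"

definition eta2 :: "real^2^2" where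
  "eta2 = (\<chi> i j. if i = j then (if i = 0 then -1 else 1) else 0)"

definition lorentzian2 :: "real^2^2 \<Rightarrow> bool" where
  "lorentzian2 A = (transpose A = A \<and> (\<exists>P. invertible P \<and> transpose P ** A ** P = eta2))"

definition riemannian2 :: "real^2^2 \<Rightarrow> bool" where
  "riemannian2 A = (transpose A = A \<and> (\<forall>v. v \<noteq> 0 \<longrightarrow> v \<bullet> (A *v v) > 0))"

definition spacetime :: "(real^4) set \<Rightarrow> (real^4 \<Rightarrow> real^4^4) \<Rightarrow> bool" where
  "spacetime U g = (open U \<and> U \<noteq> {} \<and> (\<forall>i j. smooth_on U (\<lambda>x. g x $ i $ j))
                    \<and> (\<forall>x\<in>U. lorentzian4 (g x)))"

definition ginv :: "(real^4 \<Rightarrow> real^4^4) \<Rightarrow> real^4 \<Rightarrow> real^4^4" where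
  "ginv g x = matrix_inv (g x)"

definition Chr :: "(real^4 \<Rightarrow> real^4^4) \<Rightarrow> 4 \<Rightarrow> 4 \<Rightarrow> 4 \<Rightarrow> real^4 \<Rightarrow> real" where
  "Chr g k i j x = (1/2) * (\<Sum>l\<in>UNIV. ginv g x $ k $ l *
      (partial i (\<lambda>y. g y $ j $ l) x + partial j (\<lambda>y. g y $ i $ l) x - partial l (\<lambda>y. g y $ i $ j) x))"

definition Ric :: "(real^4 \<Rightarrow> real^4^4) \<Rightarrow> 4 \<Rightarrow> 4 \<Rightarrow> real^4 \<Rightarrow> real" where
  "Ric g i j x = (\<Sum>k\<in>UNIV. partial k (Chr g k i j) x - partial j (Chr g k i k) x)
     + (\<Sum>k\<in>UNIV. \<Sum>l\<in>UNIV. Chr g k k l x * Chr g l i j x - Chr g k j l x * Chr g l i k x)"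

definition scal :: "(real^4 \<Rightarrow> real^4^4) \<Rightarrow> real^4 \<Rightarrow> real" where
  "scal g x = (\<Sum>i\<in>UNIV. \<Sum>j\<in>UNIV. ginv g x $ i $ j * Ric g i j x)"

definition TFRic :: "(real^4 \<Rightarrow> real^4^4) \<Rightarrow> 4 \<Rightarrow> 4 \<Rightarrow> real^4 \<Rightarrow> real" where
  "TFRic g i j x = Ric g i j x - scal g x / 4 * g x $ i $ j"

definition Nmat :: "(real^4 \<Rightarrow> real^4^4) \<Rightarrow> real^4 \<Rightarrow> real^4^4" where
  "Nmat g x = (\<chi> i j. TFRic g i j x)"

definition Nup :: "(real^4 \<Rightarrow> real^4^4) \<Rightarrow> 4 \<Rightarrow> 4 \<Rightarrow> real^4 \<Rightarrow> real" where
  "Nup g a b x = (\<Sum>m\<in>UNIV. ginv g x $ a $ m * TFRic g m b x)"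

definition Nsq :: "(real^4 \<Rightarrow> real^4^4) \<Rightarrow> 4 \<Rightarrow> 4 \<Rightarrow> real^4 \<Rightarrow> real" where
  "Nsq g a b x = (\<Sum>m\<in>UNIV. Nup g a m x * Nup g m b x)"

definition trNsq :: "(real^4 \<Rightarrow> real^4^4) \<Rightarrow> real^4 \<Rightarrow> real" where
  "trNsq g x = (\<Sum>a\<in>UNIV. Nsq g a a x)"

definition nablaN :: "(real^4 \<Rightarrow> real^4^4) \<Rightarrow> 4 \<Rightarrow> 4 \<Rightarrow> 4 \<Rightarrow> real^4 \<Rightarrow> real" where
  "nablaN g l a b x = partial l (TFRic g a b) x
     - (\<Sum>m\<in>UNIV. Chr g m l a x * TFRic g m b x + Chr g m l b x * TFRic g a m x)"

text \<open>The three conditions of the theorem at a point x (g^a_b = delta^a_b).\<close>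
definition product_conditions :: "(real^4 \<Rightarrow> real^4^4) \<Rightarrow> real^4 \<Rightarrow> bool" where
  "product_conditions g x =
     (trNsq g x > 0
      \<and> (\<forall>a b. Nsq g a b x = (1/4) * trNsq g x * (if a = b then 1 else 0))
      \<and> (\<forall>l a b. nablaN g l a b x = (1/2) * partial l (\<lambda>y. ln (trNsq g y)) x * TFRic g a b x))"

text \<open>Pullback of a bilinear form T (given at the point phi y) under a coordinate map phi.\<close>
definition pullback_at :: "real^4^4 \<Rightarrow> (real^4 \<Rightarrow> real^4) \<Rightarrow> real^4 \<Rightarrow> real^4^4" where
  "pullback_at T \<phi> y = (\<chi> a b. \<Sum>i\<in>UNIV. \<Sum>j\<in>UNIV.
      partial a (\<lambda>z. \<phi> z $ i) y * partial b (\<lambda>z. \<phi> z $ j) y * T $ i $ j)"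

definition lo :: "4 \<Rightarrow> 2" where "lo a = (if a = 0 then 0 else 1)"
definition hi :: "4 \<Rightarrow> 2" where "hi a = (if a = 2 then 0 else 1)"

definition block :: "real^2^2 \<Rightarrow> real^2^2 \<Rightarrow> real^4^4" where
  "block A B = (\<chi> a b.
      if a \<in> {0,1} \<and> b \<in> {0,1} then A $ lo a $ lo b
      else if a \<in> {2,3} \<and> b \<in> {2,3} then B $ hi a $ hi b
      else 0)"

definition product_chart ::
  "(real^4) set \<Rightarrow> (real^4 \<Rightarrow> real^4^4) \<Rightarrow> real^4 \<Rightarrow> (real^4) set \<Rightarrow> (real^4 \<Rightarrow> real^4)
   \<Rightarrow> (real^4) set \<Rightarrow> (real \<Rightarrow> real \<Rightarrow> real^2^2) \<Rightarrow> (real \<Rightarrow> real \<Rightarrow> real^2^2) \<Rightarrow> bool" where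
  "product_chart U g p V \<phi> W vh hh =
     (open V \<and> p \<in> V \<and> V \<subseteq> U \<and> open W \<and> \<phi> ` W = V \<and> smooth_map W \<phi>
      \<and> (\<exists>\<psi>. smooth_map V \<psi> \<and> (\<forall>y\<in>W. \<psi> (\<phi> y) = y) \<and> (\<forall>x\<in>V. \<phi> (\<psi> x) = x))
      \<and> (\<forall>y\<in>W. pullback_at (g (\<phi> y)) \<phi> y = block (vh (y $ 0) (y $ 1)) (hh (y $ 2) (y $ 3))
                 \<and> lorentzian2 (vh (y $ 0) (y $ 1)) \<and> riemannian2 (hh (y $ 2) (y $ 3))))"

definition is_2plus2_product :: "(real^4) set \<Rightarrow> (real^4 \<Rightarrow> real^4^4) \<Rightarrow> bool" where
  "is_2plus2_product U g = (\<forall>p\<in>U. \<exists>V \<phi> W vh hh. product_chart U g p V \<phi> W vh hh)"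

definition timelike :: "(real^4 \<Rightarrow> real^4^4) \<Rightarrow> real^4 \<Rightarrow> real^4 \<Rightarrow> bool" where
  "timelike g x v = ((\<Sum>a\<in>UNIV. \<Sum>b\<in>UNIV. g x $ a $ b * v $ a * v $ b) < 0)"

definition eps :: "(real^4 \<Rightarrow> real^4^4) \<Rightarrow> real^4 \<Rightarrow> real^4 \<Rightarrow> real" where
  "eps g x v = (let q = (\<Sum>a\<in>UNIV. \<Sum>b\<in>UNIV. TFRic g a b x * v $ a * v $ b) in q / \<bar>q\<bar>)"

definition PiT :: "(real^4 \<Rightarrow> real^4^4) \<Rightarrow> real^4 \<Rightarrow> real^4 \<Rightarrow> real^4^4" where
  "PiT g x v = (eps g x v * 2 / sqrt (trNsq g x)) *\<^sub>R Nmat g x"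

end

theory Submission
  imports Defs
begin

text \<open>A product metric carries the parallel involution P that is +1 on the Lorentzian and -1 on the
  Riemannian factor. Conversely, under the three conditions the mixed tensor P = 2 N / sqrt (tr N^2)
  is, up to sign, a parallel trace-free involution.

  A parallel P commutes with the curvature. Together with the Bianchi identity this leaves one
  curvature component in each two-dimensional eigenspace of P, so the Ricci tensor is pointwise a
  combination of the two factors. Hence N = c g P, and the conditions follow from nabla P = 0.

  For the converse, the two eigendistributions of P are integrable. A leaf is swept out by integral
  curves along rays, obtained as the limit of a Picard iteration; the components of its coordinate
  fields transverse to the distribution solve a homogeneous linear ODE along each ray and vanish.
  In the leaf coordinates of both distributions the metric is block diagonal, and the covariant
  derivative of a coordinate field of one block along the other block lies in both distributions,
  hence vanishes, so each block depends on its own coordinates only.\<close>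

section \<open>Partial derivatives and smooth functions\<close>

text \<open>The factor 2 / sqrt (tr N^2) is forced: the second condition makes the square of the
  rescaled N the identity, and the third says exactly that the covariant derivative of the rescaled
  N vanishes. Einstein behaviour is excluded at every point, so in a product tr N^2 = 4 c^2 is
  positive everywhere. The main obstacle is integrability with smooth dependence on parameters.
  Scaling the parameters takes the place of flow time, so a single integral operator along rays
  suffices: differentiating it only raises a weight s^m, and every derivative of a Picard iterate
  obeys a linear recursion of the same form with the same smallness constant. Hence one ball serves
  all orders of differentiation. The fields chosen to span a distribution do not commute in general.
  By construction only the radial combination of the coordinate fields is tangent to the
  distribution; the absence of torsion and the parallelism of P carry tangency over to the separate
  coordinate fields.\<close>

lemma partial_eq:
  "(f has_derivative f') (at x) \<Longrightarrow> partial i f x = f' (axis i 1)"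
  unfolding partial_def by (metis frechet_derivative_at)

lemma linear_axis_expansion:
  fixes f :: "real^'n \<Rightarrow> real"
  assumes "linear f"
  shows "f h = (\<Sum>i\<in>UNIV. h $ i * f (axis i 1))"
proof -
  have "h = (\<Sum>i\<in>UNIV. h $ i *\<^sub>R axis i 1)"
    using basis_expansion[of h] by (simp add: scalar_mult_eq_scaleR)
  then have "f h = f (\<Sum>i\<in>UNIV. h $ i *\<^sub>R axis i 1)" by simp
  also have "\<dots> = (\<Sum>i\<in>UNIV. h $ i * f (axis i 1))"
    using assms by (simp add: linear_sum linear_cmul)
  finally show ?thesis .
qed

lemma has_derivative_partials:
  assumes "f differentiable (at x)"
  shows "(f has_derivative (\<lambda>h. \<Sum>i\<in>UNIV. h $ i * partial i f x)) (at x)"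
proof -
  have d: "(f has_derivative frechet_derivative f (at x)) (at x)"
    using assms frechet_derivative_works by blast
  then have "linear (frechet_derivative f (at x))"
    by (rule has_derivative_linear)
  then have "frechet_derivative f (at x) = (\<lambda>h. \<Sum>i\<in>UNIV. h $ i * partial i f x)"
    unfolding partial_def by (intro ext linear_axis_expansion)
  with d show ?thesis by simp
qed

lemma has_real_derivative_along:
  assumes "f differentiable (at (c t))" "(c has_vector_derivative c') (at t)"
  shows "((\<lambda>s. f (c s)) has_real_derivative (\<Sum>i\<in>UNIV. c' $ i * partial i f (c t))) (at t)"
proof -
  have "(c has_derivative (\<lambda>h. h *\<^sub>R c')) (at t)"
    using assms(2) by (simp add: has_vector_derivative_def)
  from has_derivative_compose[OF this has_derivative_partials[OF assms(1)]]
  show ?thesis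
    unfolding has_field_derivative_def
    by (rule has_derivative_eq_rhs) (auto simp: sum_distrib_left mult_ac intro!: sum.cong)
qed

lemma has_derivative_cong_open:
  assumes "open U" "x \<in> U" "\<And>y. y \<in> U \<Longrightarrow> f y = g y"
  shows "(f has_derivative f') (at x) \<longleftrightarrow> (g has_derivative f') (at x)"
  using has_derivative_transform_within_open[OF _ assms(1,2), of f f' UNIV g]
    has_derivative_transform_within_open[OF _ assms(1,2), of g f' UNIV f] assms(3)
  by auto

text \<open>\<open>frechet_derivative\<close> is a choice that depends only on the local predicate
  \<open>has_derivative\<close>, so the values agree even where the functions are not
  differentiable.\<close>

lemma partial_cong:
  assumes "open U" "x \<in> U" "\<And>y. y \<in> U \<Longrightarrow> f y = g y"
  shows "partial i f x = partial i g x"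
  unfolding partial_def frechet_derivative_def by (simp add: has_derivative_cong_open[OF assms])

lemma differentiable_cong_open:
  assumes "open U" "x \<in> U" "\<And>y. y \<in> U \<Longrightarrow> f y = g y"
  shows "f differentiable (at x) \<longleftrightarrow> g differentiable (at x)"
  unfolding differentiable_def by (simp add: has_derivative_cong_open[OF assms])

lemma partial_add:
  assumes "f differentiable (at x)" "g differentiable (at x)"
  shows "partial i (\<lambda>x. f x + g x) x = partial i f x + partial i g x"
  using partial_eq[OF has_derivative_add[OF has_derivative_partials[OF assms(1)]
      has_derivative_partials[OF assms(2)]], of i]
  by (simp add: axis_def if_distrib[where f="\<lambda>x. x * _"] cong: if_cong)

lemma partial_mult:
  assumes "f differentiable (at x)" "g differentiable (at x)"
  shows "partial i (\<lambda>x. f x * g x) x = partial i f x * g x + f x * partial i g x"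
  using partial_eq[OF has_derivative_mult[OF has_derivative_partials[OF assms(1)]
      has_derivative_partials[OF assms(2)]], of i]
  by (simp add: axis_def if_distrib[where f="\<lambda>x. x * _"] cong: if_cong)

lemma partial_const [simp]: "partial i (\<lambda>x. c) x = 0"
  by (rule partial_eq[OF has_derivative_const, THEN trans]) simp

lemma partial_cmult:
  assumes "f differentiable (at x)"
  shows "partial i (\<lambda>x. c * f x) x = c * partial i f x"
  using partial_mult[of "\<lambda>_. c" x f i] assms by simp

lemma partial_minus:
  assumes "f differentiable (at x)"
  shows "partial i (\<lambda>x. - f x) x = - partial i f x"
  using partial_cmult[of f x i "-1"] assms by simp

lemma partial_diff:
  assumes "f differentiable (at x)" "g differentiable (at x)"
  shows "partial i (\<lambda>x. f x - g x) x = partial i f x - partial i g x"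
  using partial_add[of f x "\<lambda>x. - g x" i] partial_minus[of g x i] assms by simp

lemma partial_proj: "partial i (\<lambda>x. x $ j) x = (if i = j then 1 else 0)"
proof -
  have "((\<lambda>x::real^4. x $ j) has_derivative (\<lambda>h. h $ j)) (at x)"
    by (intro bounded_linear_imp_has_derivative bounded_linear_vec_nth)
  from partial_eq[OF this, of i] show ?thesis by (auto simp: axis_def)
qed

lemma differentiable_proj: "(\<lambda>x::real^4. x $ j) differentiable (at x)"
  by (intro bounded_linear_imp_differentiable bounded_linear_vec_nth)

lemma partial_sum:
  assumes "\<And>j. j \<in> I \<Longrightarrow> f j differentiable (at x)"
  shows "partial i (\<lambda>x. \<Sum>j\<in>I. f j x) x = (\<Sum>j\<in>I. partial i (f j) x)"
proof (cases "finite I")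
  case True
  then show ?thesis using assms
    by (induction I) (auto simp: partial_add differentiable_sum)
qed simp

lemma has_derivative_vec_partials:
  fixes \<phi> :: "real^4 \<Rightarrow> real^4"
  assumes "\<And>i. (\<lambda>y. \<phi> y $ i) differentiable (at x)"
  shows "(\<phi> has_derivative (\<lambda>h. \<chi> i. \<Sum>j\<in>UNIV. h $ j * partial j (\<lambda>y. \<phi> y $ i) x)) (at x)"
  unfolding has_derivative_componentwise_within[of \<phi>]
  using has_derivative_partials[OF assms]
  by (auto simp: Basis_vec_def inner_axis)

lemma
  fixes \<phi> :: "real^4 \<Rightarrow> real^4"
  assumes "f differentiable (at (\<phi> x))" "\<And>i. (\<lambda>y. \<phi> y $ i) differentiable (at x)"
  shows differentiable_compose_vec: "(\<lambda>y. f (\<phi> y)) differentiable (at x)"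
    and partial_compose:
      "partial i (\<lambda>y. f (\<phi> y)) x = (\<Sum>j\<in>UNIV. partial i (\<lambda>y. \<phi> y $ j) x * partial j f (\<phi> x))"
proof -
  note d = has_derivative_compose[OF has_derivative_vec_partials[OF assms(2)]
      has_derivative_partials[OF assms(1)]]
  from d show "(\<lambda>y. f (\<phi> y)) differentiable (at x)" by (rule differentiableI)
  show "partial i (\<lambda>y. f (\<phi> y)) x = (\<Sum>j\<in>UNIV. partial i (\<lambda>y. \<phi> y $ j) x * partial j f (\<phi> x))"
    by (subst partial_eq[OF d])
      (simp add: axis_def if_distrib[where f="\<lambda>x. x * _"] cong: if_cong)
qed

lemma has_real_derivative_line:
  assumes "f differentiable (at (a + s *\<^sub>R axis k 1))"
  shows "((\<lambda>s. f (a + s *\<^sub>R axis k 1)) has_real_derivative partial k f (a + s *\<^sub>R axis k 1)) (at s)"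
proof -
  have "((\<lambda>s. a + s *\<^sub>R axis k (1::real)) has_vector_derivative axis k 1) (at s)"
    by (auto intro!: derivative_eq_intros)
  from has_real_derivative_along[OF assms this]
  show ?thesis by (simp add: axis_def if_distrib[where f="\<lambda>x. x * _"] cong: if_cong)
qed

text \<open>Two applications of the mean value theorem, first in direction \<open>i\<close> and then
  in direction \<open>j\<close>. The second difference is symmetric in \<open>i\<close> and
  \<open>j\<close>, which \<open>partial_commute\<close> exploits.\<close>

lemma mixed_difference:
  assumes "0 < h" and "2 * h < r"
    and f: "\<And>y. dist y x < r \<Longrightarrow> f differentiable (at y)"
    and fi: "\<And>y. dist y x < r \<Longrightarrow> partial i f differentiable (at y)"
  shows "\<exists>y. dist y x \<le> 2 * h \<and>
    f (x + h *\<^sub>R axis i 1 + h *\<^sub>R axis j 1) - f (x + h *\<^sub>R axis i 1) - f (x + h *\<^sub>R axis j 1) + f x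
      = h * h * partial j (partial i f) y"
proof -
  let ?e = "\<lambda>i. axis i (1::real) :: real^4"
  have near: "dist (x + s *\<^sub>R ?e i + t *\<^sub>R ?e j) x \<le> 2 * h"
    if "0 \<le> s" "s \<le> h" "0 \<le> t" "t \<le> h" for s t
  proof -
    have "dist (x + s *\<^sub>R ?e i + t *\<^sub>R ?e j) x = norm (s *\<^sub>R ?e i + t *\<^sub>R ?e j)"
      by (simp add: dist_norm add.assoc)
    also have "\<dots> \<le> norm (s *\<^sub>R ?e i) + norm (t *\<^sub>R ?e j)" by (rule norm_triangle_ineq)
    also have "\<dots> \<le> 2 * h" using that by simp
    finally show ?thesis .
  qed
  \<comment> \<open>The increment of \<open>G\<close> over [0,h] is the second difference.\<close>
  define G where "G s = f (x + h *\<^sub>R ?e j + s *\<^sub>R ?e i) - f (x + s *\<^sub>R ?e i)" for s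
  have dG: "(G has_real_derivative partial i f (x + h *\<^sub>R ?e j + s *\<^sub>R ?e i) - partial i f (x + s *\<^sub>R ?e i)) (at s)"
    if "0 \<le> s" "s \<le> h" for s
    unfolding G_def
    using near[of s h] near[of s 0] that assms(1,2)
    by (intro DERIV_diff has_real_derivative_line f) (auto simp: add_ac)
  obtain s where s: "0 < s" "s < h" and Gs: "G h - G 0 =
      (h - 0) * (partial i f (x + h *\<^sub>R ?e j + s *\<^sub>R ?e i) - partial i f (x + s *\<^sub>R ?e i))"
    using MVT2[OF assms(1) dG] by blast
  have d2: "((\<lambda>t. partial i f (x + s *\<^sub>R ?e i + t *\<^sub>R ?e j)) has_real_derivative
      partial j (partial i f) (x + s *\<^sub>R ?e i + t *\<^sub>R ?e j)) (at t)"
    if "0 \<le> t" "t \<le> h" for t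
    using near[of s t] that s assms(1,2)
    by (intro has_real_derivative_line fi) (auto simp: add_ac)
  obtain t where t: "0 < t" "t < h" and
    "partial i f (x + s *\<^sub>R ?e i + h *\<^sub>R ?e j) - partial i f (x + s *\<^sub>R ?e i + 0 *\<^sub>R ?e j)
      = (h - 0) * partial j (partial i f) (x + s *\<^sub>R ?e i + t *\<^sub>R ?e j)"
    using MVT2[OF assms(1) d2] by blast
  with Gs have "G h - G 0 = h * h * partial j (partial i f) (x + s *\<^sub>R ?e i + t *\<^sub>R ?e j)"
    by (simp add: add_ac)
  moreover have "dist (x + s *\<^sub>R ?e i + t *\<^sub>R ?e j) x \<le> 2 * h"
    using near s t by auto
  ultimately show ?thesis
    by (intro exI[of _ "x + s *\<^sub>R ?e i + t *\<^sub>R ?e j"]) (simp add: G_def add_ac)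
qed

lemma Ck_Suc_imp_Ck: "open U \<Longrightarrow> Ck (Suc k) U f \<Longrightarrow> Ck k U f"
proof (induction k arbitrary: f)
  case 0
  then have "f differentiable_on U"
    by (auto intro: differentiable_at_imp_differentiable_on)
  then show ?case by (simp add: differentiable_imp_continuous_on)
qed auto

lemma Ck_mono: "open U \<Longrightarrow> Ck m U f \<Longrightarrow> k \<le> m \<Longrightarrow> Ck k U f"
  by (induction m) (auto simp: le_Suc_eq simp del: Ck.simps intro: Ck_Suc_imp_Ck)

lemma Ck_cong:
  assumes "open U" "\<And>x. x \<in> U \<Longrightarrow> f x = g x"
  shows "Ck k U f \<longleftrightarrow> Ck k U g"
  using assms(2)
proof (induction k arbitrary: f g)
  case 0
  then show ?case by (simp cong: continuous_on_cong)
next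
  case (Suc k)
  have "Ck k U (partial i f) \<longleftrightarrow> Ck k U (partial i g)" for i
    using Suc assms(1) by (intro Suc.IH partial_cong) auto
  moreover have "f differentiable (at x) \<longleftrightarrow> g differentiable (at x)" if "x \<in> U" for x
    using Suc.prems assms(1) that by (intro differentiable_cong_open) auto
  ultimately show ?case by simp
qed

lemma Ck_subset: "Ck k U f \<Longrightarrow> V \<subseteq> U \<Longrightarrow> Ck k V f"
  by (induction k arbitrary: f) (auto intro: continuous_on_subset)

text \<open>\<open>mixed_difference\<close> in both orders yields nearby points at which the two
  mixed derivatives coincide; continuity at \<open>x\<close> then excludes a gap between
  them.\<close>

lemma partial_commute:
  assumes "open U" "Ck 2 U f" "x \<in> U"
  shows "partial j (partial i f) x = partial i (partial j f) x"
proof (rule ccontr)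
  let ?a = "partial j (partial i f)" and ?b = "partial i (partial j f)"
  assume "?a x \<noteq> ?b x"
  \<comment> \<open>Half the gap: values closer than \<open>e\<close> to \<open>?a x\<close> and to
    \<open>?b x\<close> cannot be equal.\<close>
  define e where "e = \<bar>?a x - ?b x\<bar> / 2"
  have e: "e > 0" using \<open>?a x \<noteq> ?b x\<close> by (simp add: e_def)
  have Ck2: "f differentiable (at y)" "partial k f differentiable (at y)" 
    "continuous_on U (partial l (partial k f))" if "y \<in> U" for y k l
    using assms(2) that unfolding numeral_2_eq_2 Ck.simps by blast+
  obtain r where r: "r > 0" "ball x r \<subseteq> U"
    using assms(1,3) open_contains_ball by blast
  have "continuous (at x) ?a" "continuous (at x) ?b"
    using Ck2(3)[OF assms(3)] assms(3) by (simp_all add: continuous_on_eq_continuous_at[OF assms(1)])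
  then obtain d1 d2 where "d1 > 0" "\<And>y. dist y x < d1 \<Longrightarrow> dist (?a y) (?a x) < e"
    and "d2 > 0" "\<And>y. dist y x < d2 \<Longrightarrow> dist (?b y) (?b x) < e"
    using e unfolding continuous_at_eps_delta by (elim allE[of _ e]) blast
  then obtain d where d: "d > 0" "\<And>y. dist y x < d \<Longrightarrow> dist (?a y) (?a x) < e"
      and d': "\<And>y. dist y x < d \<Longrightarrow> dist (?b y) (?b x) < e"
    by (intro that[of "min d1 d2"]) auto
  define h where "h = min r d / 3"
  have h: "0 < h" "2 * h < r" "2 * h < d" using r(1) d(1) by (auto simp: h_def min_def)
  have sub: "y \<in> U" if "dist y x < r" for y using r(2) that by (auto simp: dist_commute)
  obtain y where y: "dist y x \<le> 2 * h" "f (x + h *\<^sub>R axis i 1 + h *\<^sub>R axis j 1)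
      - f (x + h *\<^sub>R axis i 1) - f (x + h *\<^sub>R axis j 1) + f x = h * h * ?a y"
    using mixed_difference[OF h(1,2), of x f i j] Ck2 sub by blast
  obtain z where z: "dist z x \<le> 2 * h" "f (x + h *\<^sub>R axis j 1 + h *\<^sub>R axis i 1)
      - f (x + h *\<^sub>R axis j 1) - f (x + h *\<^sub>R axis i 1) + f x = h * h * ?b z"
    using mixed_difference[OF h(1,2), of x f j i] Ck2 sub by blast
  have "h * h * ?a y = h * h * ?b z"
    using y(2) z(2) by (simp add: add_ac diff_diff_eq)
  then have "?a y = ?b z" using h by simp
  moreover have "dist (?a y) (?a x) < e" "dist (?b z) (?b x) < e"
    using y(1) z(1) h d d' by auto
  ultimately show False by (simp add: e_def dist_real_def abs_if split: if_splits)
qed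

section \<open>Closure properties of the classes Ck and of smooth functions\<close>

lemma Ck_const: "Ck k U (\<lambda>x. c)"
  by (induction k arbitrary: c) (auto simp: partial_const[abs_def] intro: continuous_intros)

lemma Ck_proj: "Ck k U (\<lambda>x. x $ j)"
proof (cases k)
  case (Suc m)
  then show ?thesis
    using Ck_const by (auto simp: partial_proj[abs_def] differentiable_proj)
qed (auto intro: continuous_intros)

lemma Ck_add:
  assumes "open U" "Ck k U f" "Ck k U g"
  shows "Ck k U (\<lambda>x. f x + g x)"
  using assms(2,3)
proof (induction k arbitrary: f g)
  case (Suc k)
  have "Ck k U (\<lambda>x. partial i f x + partial i g x)" for i
    using Suc by auto
  then have "Ck k U (partial i (\<lambda>x. f x + g x))" for i
    using Suc.prems assms(1) by (subst Ck_cong[OF assms(1) partial_add]) auto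
  then show ?case using Suc.prems by auto
qed (auto intro: continuous_intros)

lemma Ck_mult:
  assumes "open U" "Ck k U f" "Ck k U g"
  shows "Ck k U (\<lambda>x. f x * g x)"
  using assms(2,3)
proof (induction k arbitrary: f g)
  case (Suc k)
  have "Ck k U (\<lambda>x. partial i f x * g x + f x * partial i g x)" for i
    using Suc Ck_Suc_imp_Ck[OF assms(1) Suc.prems(1)] Ck_Suc_imp_Ck[OF assms(1) Suc.prems(2)]
    by (intro Ck_add Suc.IH assms) auto
  then have "Ck k U (partial i (\<lambda>x. f x * g x))" for i
    using Suc.prems assms(1) by (subst Ck_cong[OF assms(1) partial_mult]) auto
  then show ?case using Suc.prems by auto
qed (auto intro: continuous_intros)

lemma Ck_sum:
  assumes "open U" "\<And>j. j \<in> I \<Longrightarrow> Ck k U (f j)"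
  shows "Ck k U (\<lambda>x. \<Sum>j\<in>I. f j x)"
proof (cases "finite I")
  case True
  then show ?thesis using assms by (induction I) (auto intro: Ck_const Ck_add)
qed (simp add: Ck_const)

lemma Ck_prod:
  assumes "open U" "\<And>j. j \<in> I \<Longrightarrow> Ck k U (f j)"
  shows "Ck k U (\<lambda>x. \<Prod>j\<in>I. f j x)"
proof (cases "finite I")
  case True
  then show ?thesis using assms by (induction I) (auto intro: Ck_const Ck_mult)
qed (simp add: Ck_const)

lemma Ck_minus: "open U \<Longrightarrow> Ck k U f \<Longrightarrow> Ck k U (\<lambda>x. - f x)"
  using Ck_mult[OF _ Ck_const, of U k f "-1"] by simp

lemma Ck_diff: "open U \<Longrightarrow> Ck k U f \<Longrightarrow> Ck k U g \<Longrightarrow> Ck k U (\<lambda>x. f x - g x)"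
  using Ck_add[OF _ _ Ck_minus, of U k f g] by simp

lemma Ck_compose:
  assumes "open U" "open V" "\<phi> ` V \<subseteq> U" "Ck k U f" "\<And>i. Ck k V (\<lambda>y. \<phi> y $ i)"
  shows "Ck k V (\<lambda>y. f (\<phi> y))"
  using assms(4,5)
proof (induction k arbitrary: f)
  case 0
  have "continuous_on V \<phi>"
    using 0(2) by (subst continuous_on_componentwise) (auto simp: Basis_vec_def inner_axis)
  then show ?case using 0(1) assms(3) by (auto intro: continuous_on_compose2)
next
  case (Suc k)
  have \<phi>k: "Ck k V (\<lambda>y. \<phi> y $ i)" for i
    by (rule Ck_Suc_imp_Ck[OF assms(2) Suc.prems(2)])
  have "Ck k V (\<lambda>y. partial j f (\<phi> y))" for j
    using Suc.prems(1) \<phi>k by (intro Suc.IH[of "partial j f"]) auto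
  then have "Ck k V (\<lambda>x. \<Sum>j\<in>UNIV. partial i (\<lambda>y. \<phi> y $ j) x * partial j f (\<phi> x))" for i
    using Suc.prems(2) by (intro Ck_sum Ck_mult assms) auto
  then have "Ck k V (partial i (\<lambda>y. f (\<phi> y)))" for i
    using Suc.prems assms(3) by (subst Ck_cong[OF assms(2) partial_compose]) auto
  moreover have "(\<lambda>y. f (\<phi> y)) differentiable (at x)" if "x \<in> V" for x
    using Suc.prems assms(3) that by (intro differentiable_compose_vec[of f \<phi>]) auto
  ultimately show ?case by simp
qed

lemma partial_inverse:
  assumes "f differentiable (at x)" "f x \<noteq> 0"
  shows "partial i (\<lambda>x. inverse (f x)) x = - (partial i f x * (inverse (f x) * inverse (f x)))"
proof -
  have s: "(inverse has_derivative (*) (- (inverse (f x) ^ Suc (Suc 0)))) (at (f x))"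
    using DERIV_inverse[OF assms(2)] by (simp add: has_field_derivative_def)
  show ?thesis
    by (subst partial_eq[OF has_derivative_compose[OF has_derivative_partials[OF assms(1)] s]])
      (simp add: axis_def if_distrib[where f="\<lambda>x. x * _"] cong: if_cong)
qed

text \<open>The derivative of 1/f is, up to sign, a product of \<open>partial i f\<close> and two
  factors 1/f, so class k of 1/f itself gives class k + 1. The square root below is treated in the
  same way.\<close>

lemma Ck_inverse:
  assumes "open U" "\<And>x. x \<in> U \<Longrightarrow> f x \<noteq> 0" "Ck k U f"
  shows "Ck k U (\<lambda>x. inverse (f x))"
  using assms(3)
proof (induction k)
  case (Suc k)
  have "Ck k U (\<lambda>x. - (partial i f x * (inverse (f x) * inverse (f x))))" for i
    using Suc.IH[OF Ck_Suc_imp_Ck[OF assms(1) Suc.prems]] Suc.prems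
    by (intro Ck_minus Ck_mult assms) auto
  then have "Ck k U (partial i (\<lambda>x. inverse (f x)))" for i
    using Suc.prems assms(2) by (subst Ck_cong[OF assms(1) partial_inverse]) auto
  then show ?case using Suc.prems assms(2) by (auto intro!: differentiable_inverse)
next
  case 0
  then show ?case using assms(2) by (auto intro: continuous_on_inverse)
qed

lemma
  assumes "f differentiable (at x)" "f x > 0"
  shows differentiable_sqrt: "(\<lambda>x. sqrt (f x)) differentiable (at x)"
    and partial_sqrt: "partial i (\<lambda>x. sqrt (f x)) x = partial i f x * inverse (2 * sqrt (f x))"
proof -
  have s: "(sqrt has_derivative (*) (inverse (sqrt (f x)) / 2)) (at (f x))"
    using DERIV_real_sqrt[OF assms(2)] by (simp add: has_field_derivative_def)
  note d = has_derivative_compose[OF has_derivative_partials[OF assms(1)] s]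
  from d show "(\<lambda>x. sqrt (f x)) differentiable (at x)" by (rule differentiableI)
  show "partial i (\<lambda>x. sqrt (f x)) x = partial i f x * inverse (2 * sqrt (f x))"
    by (subst partial_eq[OF d])
      (simp add: axis_def if_distrib[where f="\<lambda>x. x * _"] cong: if_cong)
qed

lemma partial_ln:
  assumes "f differentiable (at x)" "f x > 0"
  shows "partial i (\<lambda>x. ln (f x)) x = partial i f x / f x"
proof -
  have s: "(ln has_derivative (*) (inverse (f x))) (at (f x))"
    using DERIV_ln[OF assms(2)] by (simp add: has_field_derivative_def)
  show ?thesis
    by (subst partial_eq[OF has_derivative_compose[OF has_derivative_partials[OF assms(1)] s]])
      (simp add: axis_def if_distrib[where f="\<lambda>x. x * _"] divide_inverse cong: if_cong)
qed

lemma Ck_sqrt: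
  assumes "open U" "\<And>x. x \<in> U \<Longrightarrow> f x > 0" "Ck k U f"
  shows "Ck k U (\<lambda>x. sqrt (f x))"
  using assms(3)
proof (induction k)
  case (Suc k)
  have "sqrt (f x) \<noteq> 0" if "x \<in> U" for x using assms(2)[OF that] by simp
  then have "Ck k U (\<lambda>x. partial i f x * inverse (2 * sqrt (f x)))" for i
    using Suc.IH[OF Ck_Suc_imp_Ck[OF assms(1) Suc.prems]] Suc.prems
    by (intro Ck_mult Ck_inverse Ck_const assms) auto
  then have "Ck k U (partial i (\<lambda>x. sqrt (f x)))" for i
    using Suc.prems assms(2) by (subst Ck_cong[OF assms(1) partial_sqrt]) auto
  then show ?case using Suc.prems assms(2) by (auto intro!: differentiable_sqrt)
qed (auto intro: continuous_intros)

lemma smooth_on_const: "smooth_on U (\<lambda>x. c)"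
  unfolding smooth_on_def by (intro allI Ck_const)

lemma smooth_on_add: "open U \<Longrightarrow> smooth_on U f \<Longrightarrow> smooth_on U g \<Longrightarrow> smooth_on U (\<lambda>x. f x + g x)"
  and smooth_on_mult: "open U \<Longrightarrow> smooth_on U f \<Longrightarrow> smooth_on U g \<Longrightarrow> smooth_on U (\<lambda>x. f x * g x)"
  and smooth_on_diff: "open U \<Longrightarrow> smooth_on U f \<Longrightarrow> smooth_on U g \<Longrightarrow> smooth_on U (\<lambda>x. f x - g x)"
  and smooth_on_minus: "open U \<Longrightarrow> smooth_on U f \<Longrightarrow> smooth_on U (\<lambda>x. - f x)"
  unfolding smooth_on_def by (iprover intro: Ck_add Ck_mult Ck_diff Ck_minus)+

lemma smooth_on_sum:
  "open U \<Longrightarrow> (\<And>j. j \<in> I \<Longrightarrow> smooth_on U (f j)) \<Longrightarrow> smooth_on U (\<lambda>x. \<Sum>j\<in>I. f j x)"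
  unfolding smooth_on_def by (iprover intro: Ck_sum)

lemma smooth_on_inverse:
  "open U \<Longrightarrow> (\<And>x. x \<in> U \<Longrightarrow> f x \<noteq> 0) \<Longrightarrow> smooth_on U f \<Longrightarrow> smooth_on U (\<lambda>x. inverse (f x))"
  and smooth_on_sqrt:
  "open U \<Longrightarrow> (\<And>x. x \<in> U \<Longrightarrow> f x > 0) \<Longrightarrow> smooth_on U f \<Longrightarrow> smooth_on U (\<lambda>x. sqrt (f x))"
  unfolding smooth_on_def by (iprover intro: Ck_inverse Ck_sqrt)+

lemma smooth_on_compose:
  "open U \<Longrightarrow> open V \<Longrightarrow> \<phi> ` V \<subseteq> U \<Longrightarrow> smooth_on U f \<Longrightarrow> smooth_map V \<phi> \<Longrightarrow> smooth_on V (\<lambda>y. f (\<phi> y))"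
  unfolding smooth_on_def smooth_map_def by (iprover intro: Ck_compose)

lemma smooth_on_subset: "smooth_on U f \<Longrightarrow> V \<subseteq> U \<Longrightarrow> smooth_on V f"
  unfolding smooth_on_def by (iprover intro: Ck_subset)

lemma smooth_on_partial: "smooth_on U f \<Longrightarrow> smooth_on U (partial i f)"
  unfolding smooth_on_def using Ck.simps(2) by blast

lemma smooth_on_differentiable: "smooth_on U f \<Longrightarrow> x \<in> U \<Longrightarrow> f differentiable (at x)"
  unfolding smooth_on_def using Ck.simps(2) by blast

lemma smooth_on_continuous: "smooth_on U f \<Longrightarrow> continuous_on U f"
  unfolding smooth_on_def using Ck.simps(1) by blast

lemma smooth_on_partial_commute:
  "open U \<Longrightarrow> smooth_on U f \<Longrightarrow> x \<in> U \<Longrightarrow> partial j (partial i f) x = partial i (partial j f) x"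
  unfolding smooth_on_def by (iprover intro: partial_commute)

section \<open>Smooth matrix fields and the inverse function theorem\<close>

definition smooth_matrix :: "(real^4) set \<Rightarrow> (real^4 \<Rightarrow> real^4^4) \<Rightarrow> bool" where
  "smooth_matrix U A \<longleftrightarrow> (\<forall>i j. smooth_on U (\<lambda>x. A x $ i $ j))"

definition mpartial :: "4 \<Rightarrow> (real^4 \<Rightarrow> real^4^4) \<Rightarrow> real^4 \<Rightarrow> real^4^4" where
  "mpartial l A x = (\<chi> i j. partial l (\<lambda>y. A y $ i $ j) x)"

text \<open>Column \<open>a\<close> is the coordinate field of parameter \<open>a\<close>, so a
  change of frame is a right multiplication and pullback of a form is a congruence.\<close>

definition jac :: "(real^4 \<Rightarrow> real^4) \<Rightarrow> real^4 \<Rightarrow> real^4^4" where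
  "jac \<phi> y = (\<chi> i a. partial a (\<lambda>z. \<phi> z $ i) y)"

lemma matrix_inv_right_left:
  fixes A :: "real^'n^'n"
  assumes "invertible A"
  shows "A ** matrix_inv A = mat 1" "matrix_inv A ** A = mat 1"
proof -
  have "A ** matrix_inv A = mat 1 \<and> matrix_inv A ** A = mat 1"
    using someI_ex[of "\<lambda>A'. A ** A' = mat 1 \<and> A' ** A = mat 1"] assms
    unfolding matrix_inv_def invertible_def by blast
  then show "A ** matrix_inv A = mat 1" "matrix_inv A ** A = mat 1" by auto
qed

lemma matrix_inv_unique:
  fixes A :: "real^'n^'n"
  assumes "A ** B = mat 1"
  shows "B = matrix_inv A"
proof -
  have inv: "invertible A" using assms invertible_right_inverse by blast
  have "B = (matrix_inv A ** A) ** B" by (simp add: matrix_inv_right_left inv)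
  also have "\<dots> = matrix_inv A" by (simp only: matrix_mul_assoc[symmetric] assms matrix_mul_rid)
  finally show ?thesis .
qed

text \<open>Turns the choice-based \<open>matrix_inv\<close> into a quotient of determinants, from
  which smoothness of the entries can be read off.\<close>

lemma matrix_inv_cramer:
  fixes A :: "real^'n^'n"
  assumes "invertible A"
  shows "matrix_inv A $ i $ j
    = det (\<chi> r c. if c = i then (if r = j then 1 else 0) else A $ r $ c) / det A"
proof -
  have "A *v (matrix_inv A *v axis j 1) = axis j 1"
    by (simp add: matrix_vector_mul_assoc matrix_inv_right_left assms)
  moreover have "det A \<noteq> 0" using assms invertible_det_nz by blast
  ultimately have "matrix_inv A *v axis j 1
      = (\<chi> k. det (\<chi> r c. if c = k then axis j 1 $ r else A $ r $ c) / det A)"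
    by (simp add: cramer)
  then have "(matrix_inv A *v axis j 1) $ i
      = det (\<chi> r c. if c = i then axis j 1 $ r else A $ r $ c) / det A"
    by simp
  moreover have "(matrix_inv A *v axis j 1) $ i = matrix_inv A $ i $ j"
    by (simp add: matrix_vector_mult_def axis_def if_distrib[where f="\<lambda>x. _ * x"] cong: if_cong)
  moreover have "(axis j 1 :: real^'n) $ r = (if r = j then 1 else 0)" for r
    by (simp add: axis_def)
  ultimately show ?thesis by (simp cong: if_cong)
qed

lemma Ck_det:
  fixes A :: "real^4 \<Rightarrow> real^'n^'n"
  assumes "open U" "\<And>i j. Ck k U (\<lambda>x. A x $ i $ j)"
  shows "Ck k U (\<lambda>x. det (A x))"
  unfolding det_def
  by (intro Ck_sum Ck_mult Ck_const Ck_prod assms)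

lemma Ck_matrix_inv:
  assumes "open U" "\<And>i j. Ck k U (\<lambda>x. A x $ i $ j)" "\<And>x. x \<in> U \<Longrightarrow> invertible (A x)"
  shows "Ck k U (\<lambda>x. matrix_inv (A x :: real^4^4) $ i $ j)"
proof -
  have "Ck k U (\<lambda>x. det (\<chi> r c. if c = i then (if r = j then 1 else 0) else A x $ r $ c) * inverse (det (A x)))"
  proof (rule Ck_mult[OF assms(1) Ck_det[OF assms(1)] Ck_inverse[OF assms(1) _ Ck_det[OF assms(1)]]])
    show "Ck k U (\<lambda>x. A x $ r $ c)" for r c by (rule assms)
    show "Ck k U (\<lambda>x. (\<chi> r c. if c = i then (if r = j then 1 else 0) else A x $ r $ c) $ r $ c)" for r c
      by (cases "c = i") (auto simp: Ck_const assms)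
    show "det (A x) \<noteq> 0" if "x \<in> U" for x using assms(3)[OF that] invertible_det_nz by blast
  qed
  then show ?thesis
    by (subst Ck_cong[OF assms(1) matrix_inv_cramer[OF assms(3)]]) (auto simp: divide_inverse)
qed

lemma smooth_matrix_inv:
  assumes "open U" "smooth_matrix U A" "\<And>x. x \<in> U \<Longrightarrow> invertible (A x)"
  shows "smooth_matrix U (\<lambda>x. matrix_inv (A x))"
  using assms unfolding smooth_matrix_def smooth_on_def by (intro allI Ck_matrix_inv) auto

lemma smooth_on_det: "open U \<Longrightarrow> smooth_matrix U A \<Longrightarrow> smooth_on U (\<lambda>x. det (A x))"
  unfolding smooth_matrix_def smooth_on_def by (intro allI Ck_det) auto

lemma smooth_matrix_entry: "smooth_matrix U A \<Longrightarrow> smooth_on U (\<lambda>x. A x $ i $ j)"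
  by (simp add: smooth_matrix_def)

lemma smooth_matrix_differentiable:
  "smooth_matrix U A \<Longrightarrow> x \<in> U \<Longrightarrow> (\<lambda>x. A x $ i $ j) differentiable (at x)"
  using smooth_matrix_entry smooth_on_differentiable by blast

lemma smooth_matrix_mul:
  "open U \<Longrightarrow> smooth_matrix U A \<Longrightarrow> smooth_matrix U B \<Longrightarrow> smooth_matrix U (\<lambda>x. A x ** B x)"
  unfolding smooth_matrix_def matrix_matrix_mult_def
  by (auto intro!: smooth_on_sum smooth_on_mult)

lemma smooth_matrix_add:
  "open U \<Longrightarrow> smooth_matrix U A \<Longrightarrow> smooth_matrix U B \<Longrightarrow> smooth_matrix U (\<lambda>x. A x + B x)"
  and smooth_matrix_diff:
  "open U \<Longrightarrow> smooth_matrix U A \<Longrightarrow> smooth_matrix U B \<Longrightarrow> smooth_matrix U (\<lambda>x. A x - B x)"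
  unfolding smooth_matrix_def by (auto intro!: smooth_on_add smooth_on_diff)

lemma smooth_matrix_const: "smooth_matrix U (\<lambda>x. C)"
  and smooth_matrix_transpose: "smooth_matrix U A \<Longrightarrow> smooth_matrix U (\<lambda>x. transpose (A x))"
  by (auto simp: smooth_matrix_def transpose_def smooth_on_const)

lemma smooth_matrix_scaleR:
  "open U \<Longrightarrow> smooth_on U f \<Longrightarrow> smooth_matrix U A \<Longrightarrow> smooth_matrix U (\<lambda>x. f x *\<^sub>R A x)"
  unfolding smooth_matrix_def by (auto intro!: smooth_on_mult)

lemma smooth_matrix_subset: "smooth_matrix U A \<Longrightarrow> V \<subseteq> U \<Longrightarrow> smooth_matrix V A"
  by (auto simp: smooth_matrix_def intro: smooth_on_subset)

lemma smooth_matrix_compose: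
  "open U \<Longrightarrow> open V \<Longrightarrow> \<phi> ` V \<subseteq> U \<Longrightarrow> smooth_matrix U A \<Longrightarrow> smooth_map V \<phi>
    \<Longrightarrow> smooth_matrix V (\<lambda>y. A (\<phi> y))"
  unfolding smooth_matrix_def using smooth_on_compose[of U V \<phi>] by blast

section \<open>Product and chain rules for matrix fields and Jacobians\<close>

lemma mpartial_mul:
  assumes "\<And>i j. (\<lambda>x. A x $ i $ j) differentiable (at x)" "\<And>i j. (\<lambda>x. B x $ i $ j) differentiable (at x)"
  shows "mpartial l (\<lambda>x. A x ** B x) x = mpartial l A x ** B x + A x ** mpartial l B x"
  by (simp add: vec_eq_iff mpartial_def matrix_matrix_mult_def partial_sum partial_mult
      differentiable_mult assms sum.distrib)

lemma mpartial_add: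
  assumes "\<And>i j. (\<lambda>x. A x $ i $ j) differentiable (at x)" "\<And>i j. (\<lambda>x. B x $ i $ j) differentiable (at x)"
  shows "mpartial l (\<lambda>x. A x + B x) x = mpartial l A x + mpartial l B x"
    "mpartial l (\<lambda>x. A x - B x) x = mpartial l A x - mpartial l B x"
  by (simp_all add: vec_eq_iff mpartial_def partial_add partial_diff assms)

lemma mpartial_const [simp]: "mpartial l (\<lambda>x. C) x = 0"
  and mpartial_transpose: "mpartial l (\<lambda>x. transpose (A x)) x = transpose (mpartial l A x)"
  by (simp_all add: vec_eq_iff mpartial_def transpose_def)

lemma mpartial_scaleR:
  assumes "f differentiable (at x)" "\<And>i j. (\<lambda>x. A x $ i $ j) differentiable (at x)"
  shows "mpartial l (\<lambda>x. f x *\<^sub>R A x) x = partial l f x *\<^sub>R A x + f x *\<^sub>R mpartial l A x"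
  by (simp add: vec_eq_iff mpartial_def partial_mult assms)

lemma mpartial_cong:
  assumes "open U" "x \<in> U" "\<And>y. y \<in> U \<Longrightarrow> A y = B y"
  shows "mpartial l A x = mpartial l B x"
  using partial_cong[OF assms(1,2), of "\<lambda>y. A y $ i $ j" "\<lambda>y. B y $ i $ j" for i j] assms(3)
  by (simp add: vec_eq_iff mpartial_def)

lemma mpartial_commute:
  assumes "open U" "smooth_matrix U A" "x \<in> U"
  shows "mpartial j (mpartial i A) x = mpartial i (mpartial j A) x"
  using smooth_on_partial_commute[OF assms(1) smooth_matrix_entry[OF assms(2)] assms(3)]
  by (simp add: vec_eq_iff mpartial_def)

lemma jac_compose:
  assumes "\<And>i. (\<lambda>y. f y $ i) differentiable (at (\<phi> x))" "\<And>i. (\<lambda>y. \<phi> y $ i) differentiable (at x)"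
  shows "jac (\<lambda>y. f (\<phi> y)) x = jac f (\<phi> x) ** jac \<phi> x"
  by (simp add: vec_eq_iff jac_def matrix_matrix_mult_def partial_compose[OF assms(1,2)] mult.commute)

lemma jac_id: "jac (\<lambda>y. y) x = mat 1"
  by (simp add: vec_eq_iff jac_def partial_proj mat_def)

lemma jac_cong:
  assumes "open U" "x \<in> U" "\<And>y. y \<in> U \<Longrightarrow> f y = g y"
  shows "jac f x = jac g x"
  using partial_cong[OF assms(1,2), of "\<lambda>y. f y $ i" "\<lambda>y. g y $ i" for i] assms(3)
  by (simp add: vec_eq_iff jac_def)

lemma smooth_map_differentiable:
  "smooth_map U f \<Longrightarrow> x \<in> U \<Longrightarrow> (\<lambda>y. f y $ i) differentiable (at x)"
  unfolding smooth_map_def using smooth_on_differentiable by blast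

lemma smooth_matrix_jac: "smooth_map U f \<Longrightarrow> smooth_matrix U (jac f)"
  by (auto simp: smooth_map_def smooth_matrix_def jac_def[abs_def] intro: smooth_on_partial)

lemma smooth_map_has_derivative:
  assumes "smooth_map U f" "x \<in> U"
  shows "(f has_derivative (\<lambda>h. jac f x *v h)) (at x)"
  using has_derivative_vec_partials[OF smooth_map_differentiable[OF assms]]
  by (rule has_derivative_eq_rhs) (simp add: jac_def matrix_vector_mult_def mult.commute)

lemma smooth_map_continuous: "smooth_map U f \<Longrightarrow> continuous_on U f"
  by (subst continuous_on_componentwise)
    (auto simp: Basis_vec_def inner_axis smooth_map_def intro: smooth_on_continuous)

text \<open>The classical theorem gives a differentiable inverse g. Its Jacobian is the inverse of
  the Jacobian of f, composed with g, so class k of g implies class k + 1; continuity of g starts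
  the induction.\<close>

theorem smooth_inverse_function:
  assumes "open U" "x0 \<in> U" "smooth_map U f" "invertible (jac f x0)"
  obtains U' V g where "open U'" "U' \<subseteq> U" "x0 \<in> U'" "open V" "f ` U' = V" "smooth_map V g"
    "\<And>x. x \<in> U' \<Longrightarrow> g (f x) = x" "\<And>y. y \<in> V \<Longrightarrow> g y \<in> U'" "\<And>y. y \<in> V \<Longrightarrow> f (g y) = y"
    "\<And>x. x \<in> U' \<Longrightarrow> invertible (jac f x)"
proof -
  define f' where "f' x = Blinfun (\<lambda>h. jac f x *v h)" for x
  have f'_apply: "blinfun_apply (f' x) = (\<lambda>h. jac f x *v h)" for x
    unfolding f'_def by (rule bounded_linear_Blinfun_apply) (rule matrix_vector_mul_bounded_linear)
  have derf: "(f has_derivative blinfun_apply (f' x)) (at x)" if "x \<in> U" for x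
    using smooth_map_has_derivative[OF assms(3) that] by (simp add: f'_apply)
  have "continuous_on U (\<lambda>x. jac f x *v i)" for i
    unfolding matrix_vector_mult_def jac_def using assms(3)
    by (auto simp: smooth_map_def intro!: continuous_intros smooth_on_continuous[OF smooth_on_partial])
  then have contf: "continuous_on U f'"
    by (intro continuous_on_blinfun_componentwise) (simp add: f'_apply)
  have "Blinfun (\<lambda>h. matrix_inv (jac f x0) *v h) o\<^sub>L f' x0 = id_blinfun"
    by (rule blinfun_eqI) (simp add: f'_apply bounded_linear_Blinfun_apply matrix_vector_mul_bounded_linear
        matrix_vector_mul_assoc matrix_inv_right_left assms(4))
  from inverse_function_theorem[OF assms(1) derf contf assms(2) this]
  obtain U' V g g' where U': "open U'" "U' \<subseteq> U" "x0 \<in> U'" and V: "open V" "homeomorphism U' V f g"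
    and g: "\<And>y. y \<in> V \<Longrightarrow> (g has_derivative g' y) (at y)"
      "\<And>y. y \<in> V \<Longrightarrow> bij (blinfun_apply (f' (g y)))"
    by metis
  have gf: "g (f x) = x" if "x \<in> U'" for x using V(2) that by (simp add: homeomorphism_def)
  have fg: "g y \<in> U'" "f (g y) = y" if "y \<in> V" for y
    using V(2) that by (auto simp: homeomorphism_def)
  have im: "f ` U' = V" using V(2) by (simp add: homeomorphism_def)
  have inv: "invertible (jac f x)" if "x \<in> U'" for x
  proof -
    have "bij (\<lambda>h. jac f x *v h)"
      using g(2)[of "f x"] im that gf f'_apply by auto
    then show ?thesis
      using invertible_eq_bij by blast
  qed
  have gd: "(\<lambda>y. g y $ i) differentiable (at y)" if "y \<in> V" for y i
    using g(1)[OF that] bounded_linear_vec_nth[of i]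
    by (auto simp: differentiable_def intro: bounded_linear.has_derivative)
  have jg: "jac g y = matrix_inv (jac f (g y))" if "y \<in> V" for y
  proof (rule matrix_inv_unique)
    have "jac f (g y) ** jac g y = jac (\<lambda>y. f (g y)) y"
      using that fg(1) U'(2) assms(3)
      by (intro jac_compose[symmetric] gd) (auto intro: smooth_map_differentiable)
    also have "\<dots> = jac (\<lambda>y. y) y"
      using V(1) that fg(2) by (intro jac_cong[of V]) auto
    finally show "jac f (g y) ** jac g y = mat 1" by (simp add: jac_id)
  qed
  have "Ck k V (\<lambda>y. g y $ i)" for k i
  proof (induction k arbitrary: i)
    case 0
    have "continuous_on V g" using V(2) by (simp add: homeomorphism_def)
    then show ?case by (auto intro: continuous_intros)
  next
    case (Suc k)
    have "Ck k V (\<lambda>y. matrix_inv (jac f (g y)) $ i $ j)" for j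
    proof (rule Ck_matrix_inv[OF V(1)])
      show "Ck k V (\<lambda>y. jac f (g y) $ r $ c)" for r c
      proof (rule Ck_compose[OF assms(1) V(1), of g k "\<lambda>x. jac f x $ r $ c"])
        show "g ` V \<subseteq> U" using fg(1) U'(2) by auto
        show "Ck k U (\<lambda>x. jac f x $ r $ c)"
          using smooth_matrix_jac[OF assms(3)] unfolding smooth_matrix_def smooth_on_def by blast
      qed (rule Suc.IH)
    qed (use fg inv in auto)
    moreover have "partial j (\<lambda>y. g y $ i) y = matrix_inv (jac f (g y)) $ i $ j" if "y \<in> V" for j y
      using jg[OF that] by (simp add: vec_eq_iff jac_def)
    ultimately have "Ck k V (partial j (\<lambda>y. g y $ i))" for j
      using Ck_cong[OF V(1), of "partial j (\<lambda>y. g y $ i)" "\<lambda>y. matrix_inv (jac f (g y)) $ i $ j" k for j]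
      by blast
    then show ?case using gd by simp
  qed
  then have "smooth_map V g" by (simp add: smooth_map_def smooth_on_def)
  with U' V(1) im gf fg inv show thesis by (intro that[of U' V g]) auto
qed

section \<open>Integral equations along rays\<close>

text \<open>The coordinates in \<open>A\<close> are the parameters along a leaf and shrink to 0 with
  \<open>s\<close>; the others label the leaf and stay fixed.\<close>

definition ray :: "4 set \<Rightarrow> real^4 \<Rightarrow> real \<Rightarrow> real^4" where
  "ray A z s = (\<chi> i. if i \<in> A then s * z $ i else z $ i)"

text \<open>The weight s^m is there because each derivative in a direction of \<open>A\<close>
  produces a factor s by the chain rule.\<close>

definition ray_integral :: "4 set \<Rightarrow> nat \<Rightarrow> (real^4 \<Rightarrow> real) \<Rightarrow> real^4 \<Rightarrow> real" where
  "ray_integral A m f z = integral (cbox 0 1) (\<lambda>s. s ^ m * f (ray A z s))"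

lemma ray_1 [simp]: "ray A z 1 = z"
  by (simp add: ray_def vec_eq_iff)

lemma continuous_on_ray: "continuous_on S (\<lambda>(z, s). ray A z s)"
  unfolding ray_def case_prod_beta
proof (rule continuous_on_vec_lambda)
  show "continuous_on S (\<lambda>x. if i \<in> A then snd x * fst x $ i else fst x $ i)" for i
    by (cases "i \<in> A") (auto intro!: continuous_intros)
qed

lemma norm_ray_le:
  assumes "0 \<le> s" "s \<le> 1"
  shows "norm (ray A z s) \<le> norm z"
  using assms
  by (intro norm_le_componentwise_cart) (auto simp: ray_def abs_mult intro: mult_left_le_one_le)

lemma ray_in_ball: "z \<in> ball 0 \<delta> \<Longrightarrow> 0 \<le> s \<Longrightarrow> s \<le> 1 \<Longrightarrow> ray A z s \<in> ball 0 \<delta>"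
  using norm_ray_le[of s A z] by simp

lemma ray_integrand_continuous:
  assumes "continuous_on (ball 0 \<delta>) f"
  shows "continuous_on (ball 0 \<delta> \<times> cbox 0 1) (\<lambda>(z, s). s ^ m * f (ray A z s))"
proof -
  have "continuous_on (ball 0 \<delta> \<times> cbox 0 1) (\<lambda>x. f (case x of (z, s) \<Rightarrow> ray A z s))"
    by (rule continuous_on_compose2[OF assms continuous_on_ray]) (auto intro: le_less_trans[OF norm_ray_le])
  then show ?thesis
    by (auto simp: case_prod_beta intro!: continuous_intros)
qed

lemma ray_integrand_integrable:
  assumes "continuous_on (ball 0 \<delta>) f" "z \<in> ball 0 \<delta>"
  shows "(\<lambda>s. s ^ m * f (ray A z s)) integrable_on cbox 0 1"
proof (rule integrable_continuous)
  have "continuous_on (cbox 0 1) (\<lambda>s. (\<lambda>(z, s). s ^ m * f (ray A z s)) (z, s))"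
    by (rule continuous_on_compose2[OF ray_integrand_continuous[OF assms(1)]])
      (use assms(2) in \<open>auto intro!: continuous_intros\<close>)
  then show "continuous_on (cbox 0 1) (\<lambda>s. s ^ m * f (ray A z s))" by simp
qed

lemma ray_integral_continuous:
  assumes "continuous_on (ball 0 \<delta>) f"
  shows "continuous_on (ball 0 \<delta>) (ray_integral A m f)"
  unfolding ray_integral_def[abs_def]
  by (rule integral_continuous_on_param[OF ray_integrand_continuous[OF assms]])

lemma ray_integral_bound:
  assumes "continuous_on (ball 0 \<delta>) f" "\<And>z. z \<in> ball 0 \<delta> \<Longrightarrow> \<bar>f z\<bar> \<le> B" "z \<in> ball 0 \<delta>"
  shows "\<bar>ray_integral A m f z\<bar> \<le> B"
proof -
  have "norm (integral (cbox 0 1) (\<lambda>s. s ^ m * f (ray A z s))) \<le> integral (cbox 0 1) (\<lambda>s::real. B)"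
  proof (rule integral_norm_bound_integral[OF ray_integrand_integrable[OF assms(1,3)]])
    fix s :: real assume s: "s \<in> cbox 0 1"
    have "\<bar>s ^ m * f (ray A z s)\<bar> \<le> 1 * \<bar>f (ray A z s)\<bar>"
      unfolding abs_mult using s by (intro mult_right_mono) (auto simp: power_le_one)
    also have "\<dots> \<le> B" using assms(2)[OF ray_in_ball[OF assms(3)]] s by simp
    finally show "norm (s ^ m * f (ray A z s)) \<le> B" by simp
  qed (rule integrable_const)
  then show ?thesis by (simp add: ray_integral_def)
qed

lemma ray_integral_add:
  assumes "continuous_on (ball 0 \<delta>) f" "continuous_on (ball 0 \<delta>) g" "z \<in> ball 0 \<delta>"
  shows "ray_integral A m (\<lambda>z. f z + g z) z = ray_integral A m f z + ray_integral A m g z"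
  unfolding ray_integral_def
  using integral_add[OF ray_integrand_integrable[OF assms(1,3)] ray_integrand_integrable[OF assms(2,3)]]
  by (simp add: distrib_left)

lemma ray_integral_diff:
  assumes "continuous_on (ball 0 \<delta>) f" "continuous_on (ball 0 \<delta>) g" "z \<in> ball 0 \<delta>"
  shows "ray_integral A m (\<lambda>z. f z - g z) z = ray_integral A m f z - ray_integral A m g z"
  unfolding ray_integral_def
  using integral_diff[OF ray_integrand_integrable[OF assms(1,3)] ray_integrand_integrable[OF assms(2,3)]]
  by (simp add: right_diff_distrib)

lemma ray_integral_cong:
  assumes "\<And>z. z \<in> ball 0 \<delta> \<Longrightarrow> f z = g z" "z \<in> ball 0 \<delta>"
  shows "ray_integral A m f z = ray_integral A m g z"
  unfolding ray_integral_def
  by (rule integral_cong) (use assms(1)[OF ray_in_ball[OF assms(2)]] in simp)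

text \<open>Differentiation under the integral sign. A ball about 0 contains the rays of its points,
  so the hypotheses on f reach all arguments that the integral uses.\<close>

lemma
  assumes "\<And>z. z \<in> ball 0 \<delta> \<Longrightarrow> f differentiable (at z)"
    and "\<And>j. continuous_on (ball 0 \<delta>) (partial j f)" and "z \<in> ball 0 \<delta>"
  shows ray_integral_differentiable: "ray_integral A m f differentiable (at z)"
    and partial_ray_integral: "partial j (ray_integral A m f) z
      = ray_integral A (if j \<in> A then Suc m else m) (partial j f) z"
proof -
  \<comment> \<open>The derivative of the integrand as a bounded linear map, the form in which the
    Leibniz rule takes it. Since \<open>ray\<close> is linear in its base point, the direction is
    \<open>ray A h s\<close>.\<close>
  define F where "F z s = Blinfun (\<lambda>h. s ^ m * (\<Sum>j\<in>UNIV. ray A h s $ j * partial j f (ray A z s)))" for z s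
  have ray_lin: "ray A (x + y) s = ray A x s + ray A y s" "ray A (c *\<^sub>R x) s = c *\<^sub>R ray A x s" for x y c s
    by (simp_all add: ray_def vec_eq_iff algebra_simps)
  have "linear (\<lambda>h. s ^ m * (\<Sum>j\<in>UNIV. ray A h s $ j * partial j f (ray A z s)))" for z s
    by (rule linearI) (simp_all add: ray_lin algebra_simps sum.distrib sum_distrib_left)
  then have F_apply: "blinfun_apply (F z s) h = s ^ m * (\<Sum>j\<in>UNIV. ray A h s $ j * partial j f (ray A z s))" for z s h
    unfolding F_def by (subst bounded_linear_Blinfun_apply) (simp_all add: linear_conv_bounded_linear)
  have bl: "bounded_linear (\<lambda>z. ray A z s)" for s
    by (simp add: linear_conv_bounded_linear[symmetric] linearI ray_lin)
  have fcont: "continuous_on (ball 0 \<delta>) f"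
    using assms(1) by (intro differentiable_imp_continuous_on differentiable_at_imp_differentiable_on) auto
  have der: "((\<lambda>z. s ^ m * f (ray A z s)) has_derivative blinfun_apply (F z s)) (at z within ball 0 \<delta>)"
    if "z \<in> ball 0 \<delta>" "s \<in> cbox 0 1" for z s
  proof -
    have "ray A z s \<in> ball 0 \<delta>" using that by (intro ray_in_ball) auto
    from has_derivative_compose[OF bounded_linear_imp_has_derivative[OF bl]
        has_derivative_partials[OF assms(1)[OF this]]]
    have "((\<lambda>z. s ^ m * f (ray A z s)) has_derivative blinfun_apply (F z s)) (at z)"
      unfolding F_apply[abs_def] by (intro has_derivative_mult_right)
    then show ?thesis by (rule has_derivative_at_withinI)
  qed
  have "continuous_on (ball 0 \<delta> \<times> cbox 0 1) (\<lambda>x. F (fst x) (snd x))"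
  proof (rule continuous_on_blinfun_componentwise)
    fix h :: "real^4"
    have c: "continuous_on (ball 0 \<delta> \<times> cbox 0 1) (\<lambda>x. snd x ^ m * partial j f (ray A (fst x) (snd x)))" for j
      using ray_integrand_continuous[OF assms(2)[of j], of m A] by (simp add: case_prod_beta)
    have "continuous_on (ball 0 \<delta> \<times> cbox 0 1) (\<lambda>x. \<Sum>j\<in>UNIV. ray A h (snd x) $ j *
        (snd x ^ m * partial j f (ray A (fst x) (snd x))))"
    proof (rule continuous_on_sum, rule continuous_on_mult)
      show "continuous_on (ball 0 \<delta> \<times> cbox 0 1) (\<lambda>x. ray A h (snd x) $ j)" for j
        by (cases "j \<in> A") (auto simp: ray_def intro!: continuous_intros)
    qed (use c in auto)
    then show "continuous_on (ball 0 \<delta> \<times> cbox 0 1) (\<lambda>x. blinfun_apply (F (fst x) (snd x)) h)"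
      by (simp add: F_apply sum_distrib_left mult_ac)
  qed
  then have Fcont: "continuous_on (ball 0 \<delta> \<times> cbox 0 1) (\<lambda>(z, s). F z s)"
    by (simp add: case_prod_beta)
  have "(ray_integral A m f has_derivative blinfun_apply (integral (cbox 0 1) (F z))) (at z within ball 0 \<delta>)"
    unfolding ray_integral_def[abs_def]
    by (rule leibniz_rule[OF der ray_integrand_integrable[OF fcont] Fcont assms(3)]) auto
  then have d: "(ray_integral A m f has_derivative blinfun_apply (integral (cbox 0 1) (F z))) (at z)"
    using at_within_open[OF assms(3)] by simp
  then show "ray_integral A m f differentiable (at z)" by (rule differentiableI)
  have "continuous_on (cbox 0 1) (\<lambda>s. (\<lambda>(z, s). F z s) (z, s))"
    by (rule continuous_on_compose2[OF Fcont]) (use assms(3) in \<open>auto intro!: continuous_intros\<close>)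
  then have Fint: "F z integrable_on cbox 0 1"
    by (intro integrable_continuous) simp
  have "partial j (ray_integral A m f) z = integral (cbox 0 1) (\<lambda>s. blinfun_apply (F z s) (axis j 1))"
    by (simp only: partial_eq[OF d] blinfun_apply_integral[OF Fint])
  also have "\<dots> = ray_integral A (if j \<in> A then Suc m else m) (partial j f) z"
    unfolding ray_integral_def F_apply
  proof (intro integral_cong)
    fix s :: real
    have "ray A (axis j 1) s $ i = (if i = j then (if j \<in> A then s else 1) else 0)" for i
      by (simp add: ray_def axis_def)
    then show "s ^ m * (\<Sum>i\<in>UNIV. ray A (axis j 1) s $ i * partial i f (ray A z s))
        = s ^ (if j \<in> A then Suc m else m) * partial j f (ray A z s)"
      by (simp add: if_distrib[where f="\<lambda>x. x * _"] cong: if_cong)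
  qed
  finally show "partial j (ray_integral A m f) z
      = ray_integral A (if j \<in> A then Suc m else m) (partial j f) z" .
qed

lemma Ck_ray_integral: "Ck k (ball 0 \<delta>) f \<Longrightarrow> Ck k (ball 0 \<delta>) (ray_integral A m f)"
proof (induction k arbitrary: f m)
  case 0
  then show ?case by (simp add: ray_integral_continuous)
next
  case (Suc k)
  have c: "continuous_on (ball 0 \<delta>) (partial j f)" for j
    using Suc.prems Ck_mono[OF open_ball, of k 0 \<delta> "partial j f" 0] by simp
  have "Ck k (ball 0 \<delta>) (ray_integral A (if j \<in> A then Suc m else m) (partial j f))" for j
    using Suc by simp
  moreover have "partial j (ray_integral A m f) z = ray_integral A (if j \<in> A then Suc m else m) (partial j f) z"
    if "z \<in> ball 0 \<delta>" for j z
    using Suc.prems c that by (intro partial_ray_integral) auto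
  ultimately have "Ck k (ball 0 \<delta>) (partial j (ray_integral A m f))" for j
    using Ck_cong[OF open_ball, of 0 \<delta> "partial j (ray_integral A m f)"
        "ray_integral A (if j \<in> A then Suc m else m) (partial j f)" k] by blast
  then show ?case
    using ray_integral_differentiable[OF _ c] Suc.prems by simp
qed

text \<open>Uniform convergence together with all derivatives up to order k is encoded by summable
  successive differences, a condition that is stable under the operations of a Picard iteration.\<close>

definition C0_summable :: "(real^4) set \<Rightarrow> (nat \<Rightarrow> real^4 \<Rightarrow> real) \<Rightarrow> bool" where
  "C0_summable S f \<longleftrightarrow> (\<forall>n. continuous_on S (f n)) \<and> (\<exists>B\<ge>0. \<forall>n. \<forall>z\<in>S. \<bar>f n z\<bar> \<le> B) \<and>
     (\<exists>e. summable e \<and> (\<forall>n. 0 \<le> e n \<and> (\<forall>z\<in>S. \<bar>f (Suc n) z - f n z\<bar> \<le> e n)))"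

fun Ck_summable :: "nat \<Rightarrow> (real^4) set \<Rightarrow> (nat \<Rightarrow> real^4 \<Rightarrow> real) \<Rightarrow> bool" where
  "Ck_summable 0 S f = C0_summable S f"
| "Ck_summable (Suc k) S f = (C0_summable S f \<and> (\<forall>n. \<forall>z\<in>S. f n differentiable (at z)) \<and>
     (\<forall>j. Ck_summable k S (\<lambda>n. partial j (f n))))"

lemma C0_summableI:
  assumes "\<And>n. continuous_on S (f n)" "\<And>n z. z \<in> S \<Longrightarrow> \<bar>f n z\<bar> \<le> B"
    "summable e" "\<And>n. 0 \<le> e n" "\<And>n z. z \<in> S \<Longrightarrow> \<bar>f (Suc n) z - f n z\<bar> \<le> e n"
  shows "C0_summable S f"
  unfolding C0_summable_def
\<comment> \<open>On an empty \<open>S\<close> the constant \<open>B\<close> may be negative, hence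
  the absolute value.\<close>
proof (intro conjI allI exI[of _ "\<bar>B\<bar>"] exI[of _ e])
  show "\<forall>z\<in>S. \<bar>f n z\<bar> \<le> \<bar>B\<bar>" for n using assms(2) by (meson abs_ge_self order_trans)
qed (use assms in auto)

text \<open>Summing finitely many constants and error sequences gives common ones. Several indices
  are handled by a product type for \<open>'i\<close>.\<close>

lemma C0_summable_family:
  fixes f :: "'i::finite \<Rightarrow> nat \<Rightarrow> real^4 \<Rightarrow> real"
  assumes "\<And>i. C0_summable S (f i)"
  obtains B e where "0 \<le> B" "summable e" "\<And>n. 0 \<le> e n"
    "\<And>i n z. z \<in> S \<Longrightarrow> \<bar>f i n z\<bar> \<le> B" "\<And>i n z. z \<in> S \<Longrightarrow> \<bar>f i (Suc n) z - f i n z\<bar> \<le> e n"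
proof -
  have "\<forall>i. \<exists>B. 0 \<le> B \<and> (\<forall>n. \<forall>z\<in>S. \<bar>f i n z\<bar> \<le> B)"
    using assms by (auto simp: C0_summable_def)
  then obtain B where B: "\<And>i. 0 \<le> B i" "\<And>i n z. z \<in> S \<Longrightarrow> \<bar>f i n z\<bar> \<le> B i" by metis
  have "\<forall>i. \<exists>e. summable e \<and> (\<forall>n. 0 \<le> e n \<and> (\<forall>z\<in>S. \<bar>f i (Suc n) z - f i n z\<bar> \<le> e n))"
    using assms by (auto simp: C0_summable_def)
  then obtain e where e: "\<And>i. summable (e i)" "\<And>i n. 0 \<le> e i n"
    "\<And>i n z. z \<in> S \<Longrightarrow> \<bar>f i (Suc n) z - f i n z\<bar> \<le> e i n" by metis
  show thesis
  proof
    show "0 \<le> (\<Sum>i\<in>UNIV. B i)" by (intro sum_nonneg B)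
    show "summable (\<lambda>n. \<Sum>i\<in>UNIV. e i n)" by (intro summable_sum e)
    show "0 \<le> (\<Sum>i\<in>UNIV. e i n)" for n by (intro sum_nonneg e)
    show "\<bar>f i n z\<bar> \<le> (\<Sum>i\<in>UNIV. B i)" if "z \<in> S" for i n z
      using B(2)[OF that, of i n] member_le_sum[of i UNIV B] B(1) by force
    show "\<bar>f i (Suc n) z - f i n z\<bar> \<le> (\<Sum>i\<in>UNIV. e i n)" if "z \<in> S" for i n z
      using e(3)[OF that, of i n] member_le_sum[of i UNIV "\<lambda>i. e i n"] e(2) by force
  qed
qed

lemma C0_summableD:
  assumes "C0_summable S f"
  shows "\<exists>B e. 0 \<le> B \<and> summable e \<and> (\<forall>n. 0 \<le> e n) \<and> (\<forall>n. \<forall>z\<in>S. \<bar>f n z\<bar> \<le> B)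
    \<and> (\<forall>n. \<forall>z\<in>S. \<bar>f (Suc n) z - f n z\<bar> \<le> e n)"
  using assms unfolding C0_summable_def by blast

lemma C0_summable_continuous: "C0_summable S f \<Longrightarrow> continuous_on S (f n)"
  by (simp add: C0_summable_def)

lemma Ck_summable_C0: "Ck_summable k S f \<Longrightarrow> C0_summable S f"
  by (cases k) auto

lemma Ck_summable_Suc_imp: "Ck_summable (Suc k) S f \<Longrightarrow> Ck_summable k S f"
  by (induction k arbitrary: f) auto

lemma Ck_summable_cong:
  assumes "open S" "\<And>n z. z \<in> S \<Longrightarrow> f n z = g n z"
  shows "Ck_summable k S f \<longleftrightarrow> Ck_summable k S g"
proof -
  have C0: "C0_summable S f \<longleftrightarrow> C0_summable S g" if "\<And>n z. z \<in> S \<Longrightarrow> f n z = g n z" for f g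
  proof -
    have "continuous_on S (f n) \<longleftrightarrow> continuous_on S (g n)" for n
      by (rule continuous_on_cong) (auto simp: that)
    then show ?thesis unfolding C0_summable_def by (simp add: that cong: ball_cong)
  qed
  show ?thesis using assms(2)
  proof (induction k arbitrary: f g)
    case 0
    then show ?case using C0[of f g] by simp
  next
    case (Suc k)
    have "Ck_summable k S (\<lambda>n. partial j (f n)) \<longleftrightarrow> Ck_summable k S (\<lambda>n. partial j (g n))" for j
      using Suc.prems by (intro Suc.IH partial_cong[OF assms(1)])
    moreover have "f n differentiable (at z) \<longleftrightarrow> g n differentiable (at z)" if "z \<in> S" for n z
      using Suc.prems that by (intro differentiable_cong_open[OF assms(1)])
    ultimately show ?case using C0[of f g] Suc.prems by simp
  qed
qed

lemma Ck_summable_imp_Ck: "Ck_summable k S f \<Longrightarrow> Ck k S (f n)"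
proof (induction k arbitrary: f)
  case (Suc k)
  then have "Ck k S (partial i (f n))" for i
    using Suc.IH[of "\<lambda>n. partial i (f n)"] by simp
  then show ?case using Suc.prems by simp
qed (simp add: C0_summable_def)

lemma C0_summable_const: "C0_summable S (\<lambda>n z. c)"
  by (rule C0_summableI[of _ _ "\<bar>c\<bar>" "\<lambda>_. 0"]) auto

lemma Ck_summable_const: "Ck_summable k S (\<lambda>n z. c)"
  by (induction k arbitrary: c) (simp_all add: partial_const[abs_def] C0_summable_const)

lemma Ck_summable_proj: "Ck_summable k (ball 0 \<delta>) (\<lambda>n z. z $ a)"
proof -
  have "C0_summable (ball 0 \<delta>) (\<lambda>n z. z $ a)"
  proof (rule C0_summableI[of _ _ \<delta> "\<lambda>_. 0"])
    show "\<bar>z $ a\<bar> \<le> \<delta>" if "z \<in> ball 0 \<delta>" for z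
      using component_le_norm_cart[of z a] that by simp
  qed (auto intro!: continuous_intros)
  then show ?thesis
    by (cases k) (auto simp: differentiable_proj partial_proj[abs_def] Ck_summable_const)
qed

lemma C0_summable_add:
  assumes "C0_summable S f" "C0_summable S g"
  shows "C0_summable S (\<lambda>n z. f n z + g n z)"
proof -
  obtain B e where f: "0 \<le> B" "summable e" "\<And>n. 0 \<le> e n"
    "\<And>n z. z \<in> S \<Longrightarrow> \<bar>f n z\<bar> \<le> B" "\<And>n z. z \<in> S \<Longrightarrow> \<bar>f (Suc n) z - f n z\<bar> \<le> e n" using C0_summableD[OF assms(1)] by blast
  obtain B' e' where g: "0 \<le> B'" "summable e'" "\<And>n. 0 \<le> e' n"
    "\<And>n z. z \<in> S \<Longrightarrow> \<bar>g n z\<bar> \<le> B'" "\<And>n z. z \<in> S \<Longrightarrow> \<bar>g (Suc n) z - g n z\<bar> \<le> e' n" using C0_summableD[OF assms(2)] by blast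
  show ?thesis
  proof (rule C0_summableI[of _ _ "B + B'" "\<lambda>n. e n + e' n"])
    show "\<bar>f n z + g n z\<bar> \<le> B + B'" if "z \<in> S" for n z
      using f(4)[OF that, of n] g(4)[OF that, of n] by linarith
    show "\<bar>f (Suc n) z + g (Suc n) z - (f n z + g n z)\<bar> \<le> e n + e' n" if "z \<in> S" for n z
      using f(5)[OF that, of n] g(5)[OF that, of n] by linarith
  qed (use assms f g in \<open>auto intro!: continuous_intros summable_add simp: C0_summable_continuous\<close>)
qed

text \<open>Here the uniform bound in \<open>C0_summable\<close> enters: the increment of a product
  is estimated by the increment of one factor times the bound of the other.\<close>

lemma C0_summable_mult:
  assumes "C0_summable S f" "C0_summable S g"
  shows "C0_summable S (\<lambda>n z. f n z * g n z)"
proof -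
  obtain B e where f: "0 \<le> B" "summable e" "\<And>n. 0 \<le> e n"
    "\<And>n z. z \<in> S \<Longrightarrow> \<bar>f n z\<bar> \<le> B" "\<And>n z. z \<in> S \<Longrightarrow> \<bar>f (Suc n) z - f n z\<bar> \<le> e n" using C0_summableD[OF assms(1)] by blast
  obtain B' e' where g: "0 \<le> B'" "summable e'" "\<And>n. 0 \<le> e' n"
    "\<And>n z. z \<in> S \<Longrightarrow> \<bar>g n z\<bar> \<le> B'" "\<And>n z. z \<in> S \<Longrightarrow> \<bar>g (Suc n) z - g n z\<bar> \<le> e' n" using C0_summableD[OF assms(2)] by blast
  show ?thesis
  proof (rule C0_summableI[of _ _ "B * B'" "\<lambda>n. B * e' n + B' * e n"])
    show "\<bar>f n z * g n z\<bar> \<le> B * B'" if "z \<in> S" for n z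
      unfolding abs_mult using f(1,4) g(1,4) that by (intro mult_mono) auto
    show "\<bar>f (Suc n) z * g (Suc n) z - f n z * g n z\<bar> \<le> B * e' n + B' * e n" if "z \<in> S" for n z
    proof -
      have "f (Suc n) z * g (Suc n) z - f n z * g n z
          = f (Suc n) z * (g (Suc n) z - g n z) + g n z * (f (Suc n) z - f n z)"
        by (simp add: algebra_simps)
      also have "\<bar>\<dots>\<bar> \<le> \<bar>f (Suc n) z\<bar> * \<bar>g (Suc n) z - g n z\<bar> + \<bar>g n z\<bar> * \<bar>f (Suc n) z - f n z\<bar>"
        by (metis abs_mult abs_triangle_ineq)
      also have "\<dots> \<le> B * e' n + B' * e n"
        using f g that by (intro add_mono mult_mono) auto
      finally show ?thesis .
    qed
  qed (use assms f g in \<open>auto intro!: continuous_intros summable_add summable_mult simp: C0_summable_continuous\<close>)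
qed

lemma Ck_summable_add:
  assumes "open S" "Ck_summable k S f" "Ck_summable k S g"
  shows "Ck_summable k S (\<lambda>n z. f n z + g n z)"
  using assms(2,3)
proof (induction k arbitrary: f g)
  case (Suc k)
  have "Ck_summable k S (\<lambda>n z. partial j (f n) z + partial j (g n) z)" for j
    using Suc.prems by (intro Suc.IH) auto
  moreover have "partial j (\<lambda>z. f n z + g n z) z = partial j (f n) z + partial j (g n) z"
    if "z \<in> S" for j n z using Suc.prems that by (intro partial_add) auto
  ultimately have "Ck_summable k S (\<lambda>n. partial j (\<lambda>z. f n z + g n z))" for j
    using Ck_summable_cong[OF assms(1), of "\<lambda>n. partial j (\<lambda>z. f n z + g n z)"
        "\<lambda>n z. partial j (f n) z + partial j (g n) z" k] by blast
  then show ?case using Suc.prems by (auto intro: C0_summable_add)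
qed (simp add: C0_summable_add)

lemma Ck_summable_mult:
  assumes "open S" "Ck_summable k S f" "Ck_summable k S g"
  shows "Ck_summable k S (\<lambda>n z. f n z * g n z)"
  using assms(2,3)
proof (induction k arbitrary: f g)
  case (Suc k)
  have "Ck_summable k S (\<lambda>n z. partial j (f n) z * g n z + f n z * partial j (g n) z)" for j
    using Suc.prems Ck_summable_Suc_imp[OF Suc.prems(1)] Ck_summable_Suc_imp[OF Suc.prems(2)]
    by (intro Ck_summable_add Suc.IH assms) auto
  moreover have "partial j (\<lambda>z. f n z * g n z) z = partial j (f n) z * g n z + f n z * partial j (g n) z"
    if "z \<in> S" for j n z using Suc.prems that by (intro partial_mult) auto
  ultimately have "Ck_summable k S (\<lambda>n. partial j (\<lambda>z. f n z * g n z))" for j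
    using Ck_summable_cong[OF assms(1), of "\<lambda>n. partial j (\<lambda>z. f n z * g n z)"
        "\<lambda>n z. partial j (f n) z * g n z + f n z * partial j (g n) z" k] by blast
  then show ?case using Suc.prems by (auto intro: C0_summable_mult)
qed (simp add: C0_summable_mult)

lemma Ck_summable_sum:
  assumes "open S" "\<And>i. i \<in> I \<Longrightarrow> Ck_summable k S (f i)"
  shows "Ck_summable k S (\<lambda>n z. \<Sum>i\<in>I. f i n z)"
proof (cases "finite I")
  case True
  then show ?thesis using assms(2)
  proof (induction I)
    case (insert i I)
    then show ?case using Ck_summable_add[OF assms(1), of k "f i" "\<lambda>n z. \<Sum>i\<in>I. f i n z"] by simp
  qed (simp add: Ck_summable_const)
qed (simp add: Ck_summable_const)

lemma Ck_summable_cmult: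
  "open S \<Longrightarrow> Ck_summable k S f \<Longrightarrow> Ck_summable k S (\<lambda>n z. c * f n z)"
  by (rule Ck_summable_mult[OF _ Ck_summable_const])

text \<open>The operator is linear and does not increase suprema, so bound and increments carry over
  unchanged.\<close>

lemma C0_summable_ray_integral:
  assumes "C0_summable (ball 0 \<delta>) f"
  shows "C0_summable (ball 0 \<delta>) (\<lambda>n. ray_integral A m (f n))"
proof -
  obtain B e where f: "0 \<le> B" "summable e" "\<And>n. 0 \<le> e n"
    "\<And>n z. z \<in> ball 0 \<delta> \<Longrightarrow> \<bar>f n z\<bar> \<le> B" "\<And>n z. z \<in> ball 0 \<delta> \<Longrightarrow> \<bar>f (Suc n) z - f n z\<bar> \<le> e n" using C0_summableD[OF assms] by blast
  note c = C0_summable_continuous[OF assms]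
  show ?thesis
  proof (rule C0_summableI[of _ _ B e])
    show "\<bar>ray_integral A m (f (Suc n)) z - ray_integral A m (f n) z\<bar> \<le> e n"
      if "z \<in> ball 0 \<delta>" for n z
      unfolding ray_integral_diff[OF c c that, symmetric]
      by (rule ray_integral_bound[OF _ f(5) that]) (auto intro!: continuous_intros c)
  qed (use f c in \<open>auto intro!: ray_integral_continuous ray_integral_bound\<close>)
qed

lemma Ck_summable_ray_integral:
  "Ck_summable k (ball 0 \<delta>) f \<Longrightarrow> Ck_summable k (ball 0 \<delta>) (\<lambda>n. ray_integral A m (f n))"
proof (induction k arbitrary: f m)
  case (Suc k)
  have c: "continuous_on (ball 0 \<delta>) (partial j (f n))" for j n
    using Suc.prems Ck_summable_C0 C0_summable_continuous by fastforce
  have d: "f n differentiable (at z)" if "z \<in> ball 0 \<delta>" for n z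
    using Suc.prems that by simp
  have "Ck_summable k (ball 0 \<delta>) (\<lambda>n. ray_integral A (if j \<in> A then Suc m else m) (partial j (f n)))" for j
    using Suc.prems by (intro Suc.IH) simp
  then have "Ck_summable k (ball 0 \<delta>) (\<lambda>n. partial j (ray_integral A m (f n)))" for j
    using Ck_summable_cong[OF open_ball, of 0 \<delta> "\<lambda>n. partial j (ray_integral A m (f n))"
        "\<lambda>n. ray_integral A (if j \<in> A then Suc m else m) (partial j (f n))" k]
      partial_ray_integral[OF d c] by blast
  then show ?case
    using ray_integral_differentiable[OF d c] C0_summable_ray_integral Suc.prems by simp
qed (simp add: C0_summable_ray_integral)

section \<open>Composition with smooth functions and passage to the limit\<close>

lemma bounded_family:
  fixes f :: "'i::finite \<Rightarrow> real^4 \<Rightarrow> real"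
  assumes "compact K" "\<And>i. continuous_on K (f i)"
  obtains B where "0 \<le> B" "\<And>i x. x \<in> K \<Longrightarrow> \<bar>f i x\<bar> \<le> B"
proof -
  have "\<forall>i. \<exists>B. 0 \<le> B \<and> (\<forall>x\<in>K. \<bar>f i x\<bar> \<le> B)"
  proof
    fix i
    have "bounded (f i ` K)" using compact_continuous_image[OF assms(2,1)] compact_imp_bounded by blast
    then obtain B where "B > 0" "\<forall>x\<in>f i ` K. norm x \<le> B" unfolding bounded_pos by blast
    then show "\<exists>B. 0 \<le> B \<and> (\<forall>x\<in>K. \<bar>f i x\<bar> \<le> B)" by (intro exI[of _ B]) auto
  qed
  then obtain B where B: "\<And>i. 0 \<le> B i" "\<And>i x. x \<in> K \<Longrightarrow> \<bar>f i x\<bar> \<le> B i" by metis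
  show thesis
  proof
    show "0 \<le> (\<Sum>i\<in>UNIV. B i)" by (intro sum_nonneg B)
    show "\<bar>f i x\<bar> \<le> (\<Sum>i\<in>UNIV. B i)" if "x \<in> K" for i x
      using B(2)[OF that, of i] member_le_sum[of i UNIV B] B(1) by force
  qed
qed

text \<open>Each of the four terms of the derivative is at most L times the norm, hence the operator
  norm 4 L. The l1 norm on the right suits estimates made component by component.\<close>

lemma lipschitz_from_partials:
  assumes "convex K" "\<And>x. x \<in> K \<Longrightarrow> f differentiable (at x)"
    "\<And>x j. x \<in> K \<Longrightarrow> \<bar>partial j f x\<bar> \<le> L" "u \<in> K" "v \<in> K"
  shows "\<bar>f u - f v\<bar> \<le> 4 * L * (\<Sum>i\<in>UNIV. \<bar>u $ i - v $ i\<bar>)"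
proof -
  have L: "0 \<le> L" using assms(3)[OF assms(4), of 0] by linarith
  have "norm (f u - f v) \<le> (4 * L) * norm (u - v)"
  proof (rule differentiable_bound[OF assms(1) _ _ assms(4,5)])
    fix x assume x: "x \<in> K"
    show "(f has_derivative (\<lambda>h. \<Sum>i\<in>UNIV. h $ i * partial i f x)) (at x within K)"
      by (rule has_derivative_at_withinI[OF has_derivative_partials[OF assms(2)[OF x]]])
    show "onorm (\<lambda>h. \<Sum>i\<in>UNIV. h $ i * partial i f x) \<le> 4 * L"
    proof (rule onorm_le)
      fix h :: "real^4"
      have "norm (\<Sum>i\<in>UNIV. h $ i * partial i f x) \<le> (\<Sum>i\<in>(UNIV::4 set). norm h * L)"
        using component_le_norm_cart[of h] assms(3)[OF x]
        by (intro sum_norm_le) (auto simp: abs_mult intro!: mult_mono)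
      then show "norm (\<Sum>i\<in>UNIV. h $ i * partial i f x) \<le> 4 * L * norm h" by (simp add: mult_ac)
    qed
  qed
  also have "\<dots> \<le> 4 * L * (\<Sum>i\<in>UNIV. \<bar>u $ i - v $ i\<bar>)"
    using norm_le_l1_cart[of "u - v"] L by (intro mult_left_mono) auto
  finally show ?thesis by simp
qed

lemma C0_summable_compose:
  assumes "compact K" "convex K" "\<And>x. x \<in> K \<Longrightarrow> f differentiable (at x)"
    "\<And>j. continuous_on K (partial j f)"
    "\<And>n z. z \<in> S \<Longrightarrow> \<gamma> n z \<in> K" "\<And>i. C0_summable S (\<lambda>n z. \<gamma> n z $ i)"
  shows "C0_summable S (\<lambda>n z. f (\<gamma> n z))"
proof -
  have fc: "continuous_on K f"
    using assms(3) by (intro differentiable_imp_continuous_on differentiable_at_imp_differentiable_on)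
  obtain B where B: "\<And>x. x \<in> K \<Longrightarrow> \<bar>f x\<bar> \<le> B"
    using bounded_family[OF assms(1), of "\<lambda>_::unit. f"] fc by metis
  obtain L where L: "0 \<le> L" "\<And>j x. x \<in> K \<Longrightarrow> \<bar>partial j f x\<bar> \<le> L"
    using bounded_family[OF assms(1), of "\<lambda>j. partial j f"] assms(4) by metis
  obtain B' e where e: "summable e" "\<And>n. 0 \<le> e n"
    "\<And>i n z. z \<in> S \<Longrightarrow> \<bar>\<gamma> (Suc n) z $ i - \<gamma> n z $ i\<bar> \<le> e n"
    using C0_summable_family[of S "\<lambda>i n z. \<gamma> n z $ i", OF assms(6)] by metis
  have c: "continuous_on S (\<gamma> n)" for n
    by (subst continuous_on_componentwise)
      (use C0_summable_continuous[OF assms(6)] in \<open>auto simp: Basis_vec_def inner_axis\<close>)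
  show ?thesis
  \<comment> \<open>16 L is the Lipschitz factor 4 L times four components, each with increment at
    most \<open>e n\<close>.\<close>
  proof (rule C0_summableI[of _ _ B "\<lambda>n. 16 * L * e n"])
    show "continuous_on S (\<lambda>z. f (\<gamma> n z))" for n
      by (rule continuous_on_compose2[OF fc c]) (use assms(5) in auto)
    show "\<bar>f (\<gamma> (Suc n) z) - f (\<gamma> n z)\<bar> \<le> 16 * L * e n" if "z \<in> S" for n z
    proof -
      have "\<bar>f (\<gamma> (Suc n) z) - f (\<gamma> n z)\<bar> \<le> 4 * L * (\<Sum>i\<in>UNIV. \<bar>\<gamma> (Suc n) z $ i - \<gamma> n z $ i\<bar>)"
        by (rule lipschitz_from_partials[OF assms(2,3) L(2)]) (use assms(5)[OF that] in auto)
      also have "\<dots> \<le> 4 * L * (\<Sum>i\<in>(UNIV::4 set). e n)"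
        using L(1) e(3)[OF that] by (intro mult_left_mono sum_mono) auto
      finally show ?thesis by simp
    qed
  qed (use B assms(5) e L in \<open>auto intro!: summable_mult\<close>)
qed

lemma Ck_summable_compose:
  assumes "open U" "open S" "compact K" "convex K" "K \<subseteq> U" "smooth_on U f"
    "\<And>n z. z \<in> S \<Longrightarrow> \<gamma> n z \<in> K" "\<And>i. Ck_summable k S (\<lambda>n z. \<gamma> n z $ i)"
  shows "Ck_summable k S (\<lambda>n z. f (\<gamma> n z))"
proof -
  \<comment> \<open>Proved for all smooth \<open>f\<close> at once, as the induction on
    \<open>k\<close> passes to the partial derivatives of \<open>f\<close>.\<close>
  have 0: "C0_summable S (\<lambda>n z. f (\<gamma> n z))"
    if "smooth_on U f" "\<And>i. C0_summable S (\<lambda>n z. \<gamma> n z $ i)" for f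
  proof (rule C0_summable_compose[where f=f and \<gamma>=\<gamma>, OF assms(3,4)])
    show "f differentiable (at x)" if "x \<in> K" for x
      using smooth_on_differentiable[OF \<open>smooth_on U f\<close>] that assms(5) by blast
    show "continuous_on K (partial j f)" for j
      using smooth_on_continuous[OF smooth_on_partial[OF that(1)]] assms(5) continuous_on_subset by blast
  qed (use assms(7) that(2) in auto)
  show ?thesis using assms(6,8)
  proof (induction k arbitrary: f)
    case (Suc k)
    have d: "(\<lambda>z. \<gamma> n z $ i) differentiable (at z)" if "z \<in> S" for n i z
      using Suc.prems(2) that by simp
    have df: "f differentiable (at (\<gamma> n z))" if "z \<in> S" for n z
      using Suc.prems(1) assms(5,7) that smooth_on_differentiable by blast
    have "Ck_summable k S (\<lambda>n z. \<Sum>i\<in>UNIV. partial j (\<lambda>z. \<gamma> n z $ i) z * partial i f (\<gamma> n z))" for j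
    proof (rule Ck_summable_sum[OF assms(2) Ck_summable_mult[OF assms(2)]])
      show "Ck_summable k S (\<lambda>n z. partial i f (\<gamma> n z))" for i
        using Suc.prems(2) Ck_summable_Suc_imp
        by (intro Suc.IH[of "partial i f"] smooth_on_partial Suc.prems(1)) blast
    qed (use Suc.prems(2) in auto)
    then have "Ck_summable k S (\<lambda>n. partial j (\<lambda>z. f (\<gamma> n z)))" for j
      using Ck_summable_cong[OF assms(2), of "\<lambda>n. partial j (\<lambda>z. f (\<gamma> n z))"
        "\<lambda>n z. \<Sum>i\<in>UNIV. partial j (\<lambda>z. \<gamma> n z $ i) z * partial i f (\<gamma> n z)" k]
        partial_compose[OF df d] by blast
    moreover have "C0_summable S (\<lambda>n z. f (\<gamma> n z))"
      by (rule 0[OF Suc.prems(1) Ck_summable_C0[OF Suc.prems(2)]])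
    ultimately show ?case using differentiable_compose_vec[OF df d] by simp
  qed (simp add: 0)
qed

text \<open>The Weierstrass test applied to the telescoping series of successive differences;
  \<open>t n\<close> is the tail of the dominating series.\<close>

lemma C0_summable_limit:
  assumes "C0_summable S f"
  obtains g t where "t \<longlonglongrightarrow> 0" "\<And>n z. z \<in> S \<Longrightarrow> \<bar>f n z - g z\<bar> \<le> t n" "continuous_on S g"
    "\<And>z. z \<in> S \<Longrightarrow> (\<lambda>n. f n z) \<longlonglongrightarrow> g z"
proof -
  obtain e where e: "summable e" "\<forall>n. 0 \<le> e n" "\<forall>n. \<forall>z\<in>S. \<bar>f (Suc n) z - f n z\<bar> \<le> e n"
    using C0_summableD[OF assms] by blast
  define g where "g z = f 0 z + (\<Sum>i. f (Suc i) z - f i z)" for z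
  define t where "t n = (\<Sum>i. e (i + n))" for n
  have "t = (\<lambda>n. suminf e - (\<Sum>i<n. e i))"
    unfolding t_def using suminf_minus_initial_segment[OF e(1)] by auto
  moreover have "(\<lambda>n. suminf e - (\<Sum>i<n. e i)) \<longlonglongrightarrow> suminf e - suminf e"
    by (intro tendsto_diff tendsto_const summable_LIMSEQ e)
  ultimately have t0: "t \<longlonglongrightarrow> 0" by simp
  have bd: "\<bar>f n z - g z\<bar> \<le> t n" if z: "z \<in> S" for n z
  proof -
    have s: "summable (\<lambda>i. f (Suc i) z - f i z)"
      by (rule summable_comparison_test'[where N=0, OF e(1)]) (use e z in auto)
    have sn: "summable (\<lambda>i. \<bar>f (Suc (i + n)) z - f (i + n) z\<bar>)"
      by (rule summable_comparison_test'[where N=0, OF summable_ignore_initial_segment[OF e(1), of n]])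
        (use e z in auto)
    have "(\<Sum>i<n. f (Suc i) z - f i z) = f n z - f 0 z"
      by (rule sum_lessThan_telescope)
    then have "g z - f n z = (\<Sum>i. f (Suc i) z - f i z) - (\<Sum>i<n. f (Suc i) z - f i z)"
      by (simp add: g_def)
    also have "\<dots> = (\<Sum>i. f (Suc (i + n)) z - f (i + n) z)"
      using suminf_minus_initial_segment[OF s, of n] by simp
    also have "\<bar>\<dots>\<bar> \<le> (\<Sum>i. \<bar>f (Suc (i + n)) z - f (i + n) z\<bar>)"
      by (rule summable_rabs[OF sn])
    also have "\<dots> \<le> t n" unfolding t_def
      by (rule suminf_le[OF _ sn summable_ignore_initial_segment[OF e(1)]]) (use e z in auto)
    finally show ?thesis by (simp add: abs_minus_commute)
  qed
  have lim: "(\<lambda>n. f n z) \<longlonglongrightarrow> g z" if "z \<in> S" for z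
    by (rule LIM_zero_cancel, rule Lim_null_comparison[OF _ t0]) (use bd[OF that] in auto)
  have "uniform_limit S f g sequentially"
  proof (rule uniform_limitI)
    fix r :: real assume "r > 0"
    then have "\<forall>\<^sub>F n in sequentially. t n < r" using t0 by (simp add: order_tendstoD(2))
    then show "\<forall>\<^sub>F n in sequentially. \<forall>z\<in>S. dist (f n z) (g z) < r"
      by (rule eventually_mono) (use bd in \<open>auto simp: dist_real_def intro: le_less_trans\<close>)
  qed
  then have gc: "continuous_on S g"
    by (rule uniform_limit_theorem[rotated]) (use assms in \<open>auto simp: C0_summable_def\<close>)
  show thesis by (rule that[OF t0 bd gc lim])
qed

text \<open>The partial derivatives converge uniformly at the rates \<open>t j\<close>, so on a
  convex open set the limit may be differentiated term by term. The induction is applied to the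
  limits \<open>h j\<close>.\<close>

lemma Ck_summable_limit:
  assumes "open S" "convex S" "S \<noteq> {}" "Ck_summable k S f" "\<And>z. z \<in> S \<Longrightarrow> (\<lambda>n. f n z) \<longlonglongrightarrow> g z"
  shows "Ck k S g"
  using assms(4,5)
proof (induction k arbitrary: f g)
  case 0
  then have "C0_summable S f" by simp
  from C0_summable_limit[OF this]
  obtain g' where g': "continuous_on S g'" "\<And>z. z \<in> S \<Longrightarrow> (\<lambda>n. f n z) \<longlonglongrightarrow> g' z"
    by metis
  have "g z = g' z" if "z \<in> S" for z using LIMSEQ_unique[OF 0(2)[OF that] g'(2)[OF that]] .
  then show ?case using g'(1) by (simp cong: continuous_on_cong)
next
  case (Suc k)
  have C0: "C0_summable S (\<lambda>n. partial j (f n))" for j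
    using Suc.prems(1) Ck_summable_C0[of k S "\<lambda>n. partial j (f n)"] by simp
  have "\<forall>j. \<exists>h t. t \<longlonglongrightarrow> 0 \<and> (\<forall>n. \<forall>z\<in>S. \<bar>partial j (f n) z - h z\<bar> \<le> t n) \<and> (\<forall>z\<in>S. (\<lambda>n. partial j (f n) z) \<longlonglongrightarrow> h z)"
  proof
    fix j
    show "\<exists>h t. t \<longlonglongrightarrow> 0 \<and> (\<forall>n. \<forall>z\<in>S. \<bar>partial j (f n) z - h z\<bar> \<le> t n) \<and> (\<forall>z\<in>S. (\<lambda>n. partial j (f n) z) \<longlonglongrightarrow> h z)"
      by (rule C0_summable_limit[OF C0, of j]) blast
  qed
  then obtain h t where t: "\<And>j. t j \<longlonglongrightarrow> (0::real)" and bd: "\<And>j n z. z \<in> S \<Longrightarrow> \<bar>partial j (f n) z - h j z\<bar> \<le> t j n"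
    and h: "\<And>j z. z \<in> S \<Longrightarrow> (\<lambda>n. partial j (f n) z) \<longlonglongrightarrow> h j z" by metis
  obtain x0 where x0: "x0 \<in> S" using assms(3) by blast
  have "\<exists>g2. \<forall>x\<in>S. (\<lambda>n. f n x) \<longlonglongrightarrow> g2 x \<and>
      (g2 has_derivative (\<lambda>v. \<Sum>i\<in>UNIV. v $ i * h i x)) (at x within S)"
  proof (rule has_derivative_sequence[where f=f
        and f'="\<lambda>n x v. \<Sum>i\<in>UNIV. v $ i * partial i (f n) x" and g'="\<lambda>x v. \<Sum>i\<in>UNIV. v $ i * h i x",
        OF assms(2) _ _ x0 Suc.prems(2)[OF x0]])
    show "(f n has_derivative (\<lambda>v. \<Sum>i\<in>UNIV. v $ i * partial i (f n) x)) (at x within S)" if "x \<in> S" for n x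
      using Suc.prems(1) that by (intro has_derivative_at_withinI[OF has_derivative_partials]) simp
    fix r :: real assume "r > 0"
    have "(\<lambda>n. \<Sum>i\<in>UNIV. t i n) \<longlonglongrightarrow> (\<Sum>i\<in>(UNIV::4 set). 0)" by (intro tendsto_sum t)
    then have "\<forall>\<^sub>F n in sequentially. (\<Sum>i\<in>UNIV. t i n) < r"
      using \<open>r > 0\<close> by (simp add: order_tendstoD(2))
    then show "\<forall>\<^sub>F n in sequentially. \<forall>x\<in>S. \<forall>v. norm ((\<Sum>i\<in>UNIV. v $ i * partial i (f n) x) - (\<Sum>i\<in>UNIV. v $ i * h i x)) \<le> r * norm v"
    proof (rule eventually_mono, intro ballI allI)
      fix n x v assume n: "(\<Sum>i\<in>UNIV. t i n) < r" and x: "x \<in> S"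
      have "norm ((\<Sum>i\<in>UNIV. v $ i * partial i (f n) x) - (\<Sum>i\<in>UNIV. v $ i * h i x))
          = norm (\<Sum>i\<in>UNIV. v $ i * (partial i (f n) x - h i x))"
        by (simp add: sum_subtractf right_diff_distrib)
      also have "\<dots> \<le> (\<Sum>i\<in>UNIV. norm v * t i n)"
        using bd[OF x] component_le_norm_cart[of v] unfolding real_norm_def
        by (intro order_trans[OF sum_abs] sum_mono) (auto simp: abs_mult intro!: mult_mono)
      also have "\<dots> = (\<Sum>i\<in>UNIV. t i n) * norm v" by (simp add: sum_distrib_left mult.commute)
      also have "\<dots> \<le> r * norm v" using n by (intro mult_right_mono) auto
      finally show "norm ((\<Sum>i\<in>UNIV. v $ i * partial i (f n) x) - (\<Sum>i\<in>UNIV. v $ i * h i x)) \<le> r * norm v" .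
    qed
  qed
  then obtain g2 where g2: "\<And>x. x \<in> S \<Longrightarrow> (\<lambda>n. f n x) \<longlonglongrightarrow> g2 x"
    "\<And>x. x \<in> S \<Longrightarrow> (g2 has_derivative (\<lambda>v. \<Sum>i\<in>UNIV. v $ i * h i x)) (at x within S)" by blast
  have g2g: "g2 x = g x" if "x \<in> S" for x using LIMSEQ_unique[OF g2(1)[OF that] Suc.prems(2)[OF that]] .
  have der: "(g has_derivative (\<lambda>v. \<Sum>i\<in>UNIV. v $ i * h i x)) (at x)" if x: "x \<in> S" for x
    using g2(2)[OF x] has_derivative_cong_open[OF assms(1) x g2g] at_within_open[OF x assms(1)] by simp
  have hp: "partial j g x = h j x" if "x \<in> S" for j x
    unfolding partial_eq[OF der[OF that]]
    by (simp add: axis_def if_distrib[where f="\<lambda>x. x * _"] cong: if_cong)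
  have "Ck k S (h j)" for j
    using Suc.prems(1) by (intro Suc.IH[of "\<lambda>n. partial j (f n)"] h) simp
  then have "Ck k S (partial j g)" for j
    using Ck_cong[OF assms(1), of "partial j g" "h j" k] hp by blast
  then show ?case using der differentiableI by (simp, blast)
qed

text \<open>Summing the recursion bounds each partial sum by \<epsilon> 0 + suminf d plus half of
  the preceding partial sum, and 2 (\<epsilon> 0 + suminf d) is the fixed point of this
  bound.\<close>

lemma summable_half_contraction:
  fixes \<epsilon> d :: "nat \<Rightarrow> real"
  assumes "\<And>n. \<epsilon> (Suc n) = \<epsilon> n / 2 + d n" "0 \<le> \<epsilon> 0" "\<And>n. 0 \<le> d n" "summable d"
  shows "summable \<epsilon>" "0 \<le> \<epsilon> n"
proof -
  show pos: "0 \<le> \<epsilon> n" for n by (induction n) (use assms in auto)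
  have "(\<Sum>i<N. \<epsilon> i) \<le> 2 * (\<epsilon> 0 + suminf d)" for N
  proof (induction N)
    case 0
    show ?case using assms(2) suminf_nonneg[OF assms(4,3)] by simp
  next
    case (Suc N)
    have "(\<Sum>i<Suc N. \<epsilon> i) = \<epsilon> 0 + (\<Sum>i<N. \<epsilon> (Suc i))" by (rule sum.lessThan_Suc_shift)
    also have "\<dots> = \<epsilon> 0 + (\<Sum>i<N. \<epsilon> i) / 2 + (\<Sum>i<N. d i)"
      by (simp add: assms(1) sum.distrib sum_divide_distrib)
    also have "\<dots> \<le> \<epsilon> 0 + (2 * (\<epsilon> 0 + suminf d)) / 2 + suminf d"
      using Suc sum_le_suminf[OF assms(4), of "{..<N}"] assms(3) by (intro add_mono) auto
    finally show ?case by (simp add: field_simps)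
  qed
  then show "summable \<epsilon>" by (intro summableI_nonneg_bounded[OF pos])
qed

text \<open>Sixteen counts the pairs (a,l): the sum over \<open>A\<close> is enlarged to all four
  indices, so that the constant does not depend on \<open>A\<close>.\<close>

lemma ray_sum_bound:
  fixes A :: "4 set"
  assumes "z \<in> ball 0 \<delta>" "\<And>a l. \<bar>I a l\<bar> \<le> C"
  shows "\<bar>\<Sum>a\<in>A. \<Sum>l\<in>(UNIV::4 set). z $ a * I a l\<bar> \<le> 16 * \<delta> * C"
proof -
  have \<delta>: "0 \<le> \<delta>" and C: "0 \<le> C" using assms(1) assms(2)[of 0 0] by (auto intro: order_trans[OF norm_ge_zero less_imp_le])
  have z: "\<bar>z $ a\<bar> \<le> \<delta>" for a using component_le_norm_cart[of z a] assms(1) by simp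
  have "\<bar>\<Sum>a\<in>A. \<Sum>l\<in>(UNIV::4 set). z $ a * I a l\<bar> \<le> (\<Sum>a\<in>A. \<Sum>l\<in>(UNIV::4 set). \<delta> * C)"
    using assms(2) \<delta> C z
    by (intro order_trans[OF sum_abs] sum_mono) (auto simp: abs_mult intro!: mult_mono)
  also have "\<dots> \<le> (\<Sum>a\<in>(UNIV::4 set). \<Sum>l\<in>(UNIV::4 set). \<delta> * C)"
    using \<delta> C by (intro sum_mono2 sum_nonneg) auto
  finally show ?thesis by simp
qed

text \<open>The device that gives all derivatives on one ball. Differentiating the recursion leaves
  the coefficients \<open>M\<close> of the highest derivative unchanged, raises the weight
  \<open>m\<close> when the direction is in \<open>A\<close>, and moves every other term into a new
  inhomogeneity. The smallness condition on \<delta> therefore persists, and the induction on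
  \<open>k\<close> generalises over \<open>D\<close>, \<open>B\<close>, \<open>d\<close> and
  \<open>m\<close>.\<close>

lemma Ck_summable_linear_recursion:
  fixes D B :: "nat \<Rightarrow> 4 \<Rightarrow> real^4 \<Rightarrow> real" and M :: "nat \<Rightarrow> 4 \<Rightarrow> 4 \<Rightarrow> 4 \<Rightarrow> real^4 \<Rightarrow> real"
  assumes rec: "\<And>n i z. z \<in> ball 0 \<delta> \<Longrightarrow> D (Suc n) i z
      = B n i z + (\<Sum>a\<in>A. \<Sum>l\<in>UNIV. z $ a * ray_integral A m (\<lambda>y. M n a i l y * D n l y) z)"
    and init: "\<And>i. D 0 i = (\<lambda>_. d i)"
    and B: "\<And>i. Ck_summable k (ball 0 \<delta>) (\<lambda>n. B n i)"
    and M: "\<And>a i l. Ck_summable k (ball 0 \<delta>) (\<lambda>n. M n a i l)"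
    and Mbd: "\<And>n a i l z. z \<in> ball 0 \<delta> \<Longrightarrow> \<bar>M n a i l z\<bar> \<le> L" and small: "16 * \<delta> * L \<le> 1 / 2" and "0 < \<delta>"
  shows "Ck_summable k (ball 0 \<delta>) (\<lambda>n. D n i)"
  using rec init B M
proof (induction k arbitrary: D B d m i)
  case (0 D B d m)
  let ?S = "ball (0::real^4) \<delta>"
  have "0 \<in> ?S" using \<open>0 < \<delta>\<close> by simp
  have "0 \<le> L" using Mbd[OF \<open>0 \<in> ?S\<close>, of 0 0 0 0] by linarith
  have "C0_summable ?S (\<lambda>n. B n i)" for i using 0(3) by simp
  then obtain BB eB where BB: "0 \<le> BB" "summable eB" "\<And>n. 0 \<le> eB n" "\<And>i n z. z \<in> ?S \<Longrightarrow> \<bar>B n i z\<bar> \<le> BB"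
    "\<And>i n z. z \<in> ?S \<Longrightarrow> \<bar>B (Suc n) i z - B n i z\<bar> \<le> eB n"
    using C0_summable_family[of ?S "\<lambda>i n. B n i"] by metis
  \<comment> \<open>The three indices are packed into one \<open>q\<close> to obtain a single error
    sequence.\<close>
  have "C0_summable ?S (\<lambda>n. M n (fst q) (fst (snd q)) (snd (snd q)))" for q using 0(4) by simp
  then obtain eM where eM: "summable eM" "\<And>n. 0 \<le> eM n"
    "\<And>q n z. z \<in> ?S \<Longrightarrow> \<bar>M (Suc n) (fst q) (fst (snd q)) (snd (snd q)) z - M n (fst q) (fst (snd q)) (snd (snd q)) z\<bar> \<le> eM n"
    using C0_summable_family[of ?S "\<lambda>q n. M n (fst q) (fst (snd q)) (snd (snd q))"] by metis
  have eM': "\<bar>M (Suc n) a i l z - M n a i l z\<bar> \<le> eM n" if "z \<in> ?S" for n a i l z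
    using eM(3)[OF that, of n "(a, i, l)"] by simp
  have Mc: "continuous_on ?S (M n a i l)" for n a i l
    using 0(4)[of a i l] by (simp add: C0_summable_def)
  have Dc: "continuous_on ?S (D n i)" for n i
  proof (induction n arbitrary: i)
    case (Suc n)
    have "continuous_on ?S (\<lambda>z. B n i z + (\<Sum>a\<in>A. \<Sum>l\<in>UNIV. z $ a * ray_integral A m (\<lambda>y. M n a i l y * D n l y) z))"
      using 0(3)[of i] Suc Mc
      by (intro continuous_intros ray_integral_continuous) (simp_all add: C0_summable_def)
    then show ?case by (subst continuous_on_cong[OF refl 0(1)]) simp_all
  qed (simp add: 0(2))
  have MDc: "continuous_on ?S (\<lambda>y. M n a i l y * D n' l y)" for n n' a i l
    by (intro continuous_intros Mc Dc)
  \<comment> \<open>\<open>R\<close> dominates the constant start and satisfies BB + R/2 \<le> R, so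
    the bound reproduces itself under the recursion.\<close>
  define R where "R = (\<Sum>i\<in>UNIV. \<bar>d i\<bar>) + 2 * BB"
  have R0: "0 \<le> R" unfolding R_def using BB(1) by (intro add_nonneg_nonneg sum_nonneg) auto
  have DR: "\<bar>D n i z\<bar> \<le> R" if "z \<in> ?S" for n i z
    using that
  proof (induction n arbitrary: i z)
    case 0
    have "\<bar>d i\<bar> \<le> (\<Sum>i\<in>UNIV. \<bar>d i\<bar>)" by (rule member_le_sum) auto
    then show ?case using BB(1) by (simp add: \<open>\<And>i. D 0 i = (\<lambda>_. d i)\<close> R_def)
  next
    case (Suc n)
    have "\<bar>ray_integral A m (\<lambda>y. M n a i l y * D n l y) z\<bar> \<le> L * R" for a l
    proof (rule ray_integral_bound[OF MDc _ Suc.prems])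
      show "\<bar>M n a i l y * D n l y\<bar> \<le> L * R" if "y \<in> ?S" for y
        unfolding abs_mult using Mbd[OF that] Suc.IH[OF that] \<open>0 \<le> L\<close> by (intro mult_mono) auto
    qed
    from ray_sum_bound[OF Suc.prems this, where A=A]
    have "\<bar>\<Sum>a\<in>A. \<Sum>l\<in>UNIV. z $ a * ray_integral A m (\<lambda>y. M n a i l y * D n l y) z\<bar> \<le> 16 * \<delta> * L * R"
      by (simp add: mult_ac)
    also have "\<dots> \<le> 1 / 2 * R" using small R0 by (intro mult_right_mono)
    finally have "\<bar>D (Suc n) i z\<bar> \<le> BB + 1 / 2 * R"
      using BB(4)[OF Suc.prems, of n i] 0(1)[OF Suc.prems, of n i] by linarith
    moreover have "2 * BB \<le> R" by (simp add: R_def sum_nonneg)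
    ultimately show ?case by linarith
  qed
  \<comment> \<open>Bounds for successive differences: 2 R for the first, afterwards half the
    previous one (contraction) plus the errors caused by the changes of \<open>B\<close> and
    \<open>M\<close>.\<close>
  define \<epsilon> where "\<epsilon> = rec_nat (2 * R) (\<lambda>n r. r / 2 + (eB n + 16 * \<delta> * R * eM n))"
  have \<epsilon>: "\<epsilon> (Suc n) = \<epsilon> n / 2 + (eB n + 16 * \<delta> * R * eM n)" "\<epsilon> 0 = 2 * R" for n
    by (simp_all add: \<epsilon>_def)
  have \<epsilon>s: "summable \<epsilon>" "\<And>n. 0 \<le> \<epsilon> n"
    by (rule summable_half_contraction[where \<epsilon>=\<epsilon> and d="\<lambda>n. eB n + 16 * \<delta> * R * eM n", OF \<epsilon>(1)],
        use R0 \<epsilon>(2) BB(2,3) eM(1,2) \<open>0 < \<delta>\<close> in \<open>auto intro!: summable_add summable_mult\<close>)+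
  have diff: "\<bar>D (Suc n) i z - D n i z\<bar> \<le> \<epsilon> n" if "z \<in> ?S" for n i z
    using that
  proof (induction n arbitrary: i z)
    case 0
    then show ?case using DR[OF 0, of "Suc 0" i] DR[OF 0, of 0 i] \<epsilon>(2) by linarith
  next
    case (Suc n)
    let ?I = "\<lambda>n a l. ray_integral A m (\<lambda>y. M n a i l y * D n l y) z"
    have "\<bar>?I (Suc n) a l - ?I n a l\<bar> \<le> L * \<epsilon> n + eM n * R" for a l
      unfolding ray_integral_diff[OF MDc MDc Suc.prems, symmetric]
    proof (rule ray_integral_bound[OF _ _ Suc.prems])
      show "\<bar>M (Suc n) a i l y * D (Suc n) l y - M n a i l y * D n l y\<bar> \<le> L * \<epsilon> n + eM n * R"
        if "y \<in> ?S" for y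
      proof -
        have "M (Suc n) a i l y * D (Suc n) l y - M n a i l y * D n l y
            = M (Suc n) a i l y * (D (Suc n) l y - D n l y) + (M (Suc n) a i l y - M n a i l y) * D n l y"
          by (simp add: algebra_simps)
        also have "\<bar>\<dots>\<bar> \<le> \<bar>M (Suc n) a i l y\<bar> * \<bar>D (Suc n) l y - D n l y\<bar>
            + \<bar>M (Suc n) a i l y - M n a i l y\<bar> * \<bar>D n l y\<bar>"
          by (metis abs_mult abs_triangle_ineq)
        also have "\<dots> \<le> L * \<epsilon> n + eM n * R"
          using Mbd[OF that] Suc.IH[OF that] eM'[OF that] DR[OF that] eM(2) \<open>0 \<le> L\<close>
          by (intro add_mono mult_mono) auto
        finally show ?thesis .
      qed
    qed (intro continuous_intros MDc)
    from ray_sum_bound[OF Suc.prems this, where A=A]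
    have I: "\<bar>\<Sum>a\<in>A. \<Sum>l\<in>UNIV. z $ a * (?I (Suc n) a l - ?I n a l)\<bar> \<le> 16 * \<delta> * L * \<epsilon> n + 16 * \<delta> * R * eM n"
      by (simp add: algebra_simps)
    have "D (Suc (Suc n)) i z - D (Suc n) i z = (B (Suc n) i z - B n i z)
        + (\<Sum>a\<in>A. \<Sum>l\<in>UNIV. z $ a * (?I (Suc n) a l - ?I n a l))"
      unfolding 0(1)[OF Suc.prems] by (simp add: right_diff_distrib sum_subtractf)
    moreover have "16 * \<delta> * L * \<epsilon> n \<le> 1 / 2 * \<epsilon> n" using small \<epsilon>s(2) by (intro mult_right_mono)
    ultimately show ?case using I BB(5)[OF Suc.prems, of n i] \<epsilon>(1)[of n] by linarith
  qed
  show ?case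
    by (simp, rule C0_summableI[OF Dc DR \<epsilon>s diff])
next
  case (Suc k D B d m)
  let ?S = "ball (0::real^4) \<delta>" and ?m = "\<lambda>j. if j \<in> A then Suc m else m"
  note rec = Suc.prems(1)
  have Dk: "Ck_summable k ?S (\<lambda>n. D n i)" for i
    using Suc.prems(3,4) Ck_summable_Suc_imp by (intro Suc.IH[OF rec Suc.prems(2)]) blast+
  have Bk: "Ck (Suc k) ?S (B n i)" for n i
    using Ck_summable_imp_Ck[OF Suc.prems(3)] .
  have Mk: "Ck (Suc k) ?S (M n a i l)" for n a i l
    using Ck_summable_imp_Ck[OF Suc.prems(4)] .
  have Ds: "Ck (Suc k) ?S (D n i)" for n i
  proof (induction n arbitrary: i)
    case 0
    then show ?case by (simp only: Suc.prems(2) Ck_const)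
  next
    case (Suc n)
    have "Ck (Suc k) ?S (\<lambda>z. B n i z + (\<Sum>a\<in>A. \<Sum>l\<in>UNIV. z $ a * ray_integral A m (\<lambda>y. M n a i l y * D n l y) z))"
      by (intro Ck_add Ck_sum Ck_mult Ck_proj Ck_ray_integral open_ball Bk Mk Suc)
    then show ?case by (subst Ck_cong[OF open_ball rec])
  qed
  have MD: "Ck (Suc k) ?S (\<lambda>y. M n a i l y * D n l y)" for n a i l
    by (intro Ck_mult open_ball Mk Ds)
  have dif: "f differentiable (at z)" "continuous_on ?S (partial j f)" "continuous_on ?S f"
    if "z \<in> ?S" "Ck (Suc k) ?S f" for f z j
    using that Ck_mono[OF open_ball, of k 0 \<delta> "partial j f" 0] Ck_mono[OF open_ball that(2), of 0] by auto
  \<comment> \<open>All terms of the differentiated recursion without a derivative of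
    \<open>D n\<close>; they involve \<open>D\<close> only to the order already controlled.\<close>
  define B' where "B' j n i z = partial j (B n i) z + (\<Sum>a\<in>A. \<Sum>l\<in>UNIV.
      (if j = a then 1 else 0) * ray_integral A m (\<lambda>y. M n a i l y * D n l y) z
      + z $ a * ray_integral A (?m j) (\<lambda>y. partial j (M n a i l) y * D n l y) z)" for j n i z
  have rec': "partial j (D (Suc n) i) z = B' j n i z
      + (\<Sum>a\<in>A. \<Sum>l\<in>UNIV. z $ a * ray_integral A (?m j) (\<lambda>y. M n a i l y * partial j (D n l) y) z)"
    if z: "z \<in> ?S" for j n i z
  proof -
    let ?P = "\<lambda>a l y. M n a i l y * D n l y"
    have dP: "?P a l differentiable (at y)" if "y \<in> ?S" for a l y by (rule dif[OF that MD])
    have cP: "continuous_on ?S (partial j (?P a l))" for j a l by (rule dif[OF z MD])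
    have rP: "ray_integral A m (?P a l) differentiable (at z)" for a l
      by (rule ray_integral_differentiable[OF dP cP z])
    have "partial j (ray_integral A m (?P a l)) z
        = ray_integral A (?m j) (\<lambda>y. partial j (M n a i l) y * D n l y) z
          + ray_integral A (?m j) (\<lambda>y. M n a i l y * partial j (D n l) y) z" for a l
    proof -
      have "partial j (ray_integral A m (?P a l)) z = ray_integral A (?m j) (partial j (?P a l)) z"
        by (rule partial_ray_integral[OF dP cP z])
      also have "\<dots> = ray_integral A (?m j) (\<lambda>y. partial j (M n a i l) y * D n l y + M n a i l y * partial j (D n l) y) z"
        using dif(1)[OF _ Mk] dif(1)[OF _ Ds] by (intro ray_integral_cong[OF partial_mult z]) auto
      also have "\<dots> = ray_integral A (?m j) (\<lambda>y. partial j (M n a i l) y * D n l y) z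
          + ray_integral A (?m j) (\<lambda>y. M n a i l y * partial j (D n l) y) z"
        using dif(2,3)[OF z Mk] dif(2,3)[OF z Ds]
        by (intro ray_integral_add[OF _ _ z] continuous_on_mult) auto
      finally show ?thesis .
    qed
    then have "partial j (\<lambda>z. B n i z + (\<Sum>a\<in>A. \<Sum>l\<in>UNIV. z $ a * ray_integral A m (?P a l) z)) z
      = B' j n i z + (\<Sum>a\<in>A. \<Sum>l\<in>UNIV. z $ a * ray_integral A (?m j) (\<lambda>y. M n a i l y * partial j (D n l) y) z)"
      using dif(1)[OF z Bk] rP
      by (simp add: partial_add partial_sum partial_mult partial_proj differentiable_proj
          differentiable_mult differentiable_sum B'_def sum.distrib[symmetric] algebra_simps)
    moreover have "partial j (D (Suc n) i) z
        = partial j (\<lambda>z. B n i z + (\<Sum>a\<in>A. \<Sum>l\<in>UNIV. z $ a * ray_integral A m (?P a l) z)) z"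
      by (rule partial_cong[OF open_ball z rec])
    ultimately show ?thesis by simp
  qed
  have "Ck_summable k ?S (\<lambda>n. B' j n i)" for j i
    unfolding B'_def
    using Suc.prems(3,4) Ck_summable_Suc_imp[OF Suc.prems(4)]
    by (intro Ck_summable_add Ck_summable_sum Ck_summable_cmult Ck_summable_mult[of _ _ "\<lambda>n z. z $ _"]
        Ck_summable_proj Ck_summable_ray_integral Ck_summable_mult open_ball Dk) auto
  \<comment> \<open>The initial iterate is constant, so the differentiated recursion starts at
    0.\<close>
  then have "Ck_summable k ?S (\<lambda>n. partial j (D n i))" for j i
    using Ck_summable_Suc_imp[OF Suc.prems(4)]
    by (intro Suc.IH[of "\<lambda>n l. partial j (D n l)" "B' j" "?m j" "\<lambda>_. 0" i] rec')
      (auto simp: Suc.prems(2) partial_const[abs_def])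
  then show ?case using dif(1)[OF _ Ds] Ck_summable_C0[OF Dk] by simp
qed

text \<open>As a function of \<open>t\<close>, \<open>\<gamma> (ray A z t)\<close> is an integral curve of \<open>\<Sum>a\<in>A. z $ a *\<^sub>R Y a\<close>: rescaling
  the parameters replaces the time variable.\<close>

theorem ray_equation_solution:
  fixes Y :: "4 \<Rightarrow> 4 \<Rightarrow> real^4 \<Rightarrow> real" and b :: "4 \<Rightarrow> real^4"
  assumes "open U" "p \<in> U" and Y: "\<And>a i. smooth_on U (Y a i)"
  obtains \<delta> \<gamma> where "0 < \<delta>" "smooth_map (ball 0 \<delta>) \<gamma>" "\<gamma> ` ball 0 \<delta> \<subseteq> U"
    "\<And>z i. z \<in> ball 0 \<delta> \<Longrightarrow> \<gamma> z $ i = p $ i + (\<Sum>j\<in>-A. z $ j * b j $ i)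
      + (\<Sum>a\<in>A. z $ a * ray_integral A 0 (\<lambda>y. Y a i (\<gamma> y)) z)"
proof -
  obtain r where r: "0 < r" "cball p r \<subseteq> U" using assms(1,2) open_contains_cball by blast
  let ?K = "cball p r"
  have KU: "x \<in> U" if "x \<in> ?K" for x using r(2) that by blast
  have Yc: "continuous_on ?K (Y a i)" "continuous_on ?K (partial l (Y a i))" for a i l
    using smooth_on_continuous[OF Y] smooth_on_continuous[OF smooth_on_partial[OF Y]] r(2)
      continuous_on_subset by blast+
  obtain BY where BY: "0 \<le> BY" "\<And>a i x. x \<in> ?K \<Longrightarrow> \<bar>Y a i x\<bar> \<le> BY"
  proof -
    obtain B where "0 \<le> B" "\<And>q x. x \<in> ?K \<Longrightarrow> \<bar>Y (fst q) (snd q) x\<bar> \<le> B"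
      using bounded_family[OF compact_cball, of p r "\<lambda>q. Y (fst q) (snd q)"] Yc(1) by metis
    from this(1) this(2)[of _ "(_, _)"] show thesis by (intro that[of B]) auto
  qed
  obtain L where L: "0 \<le> L" "\<And>l a i x. x \<in> ?K \<Longrightarrow> \<bar>partial l (Y a i) x\<bar> \<le> L"
  proof -
    obtain B where "0 \<le> B" "\<And>q x. x \<in> ?K \<Longrightarrow> \<bar>partial (fst q) (Y (fst (snd q)) (snd (snd q))) x\<bar> \<le> B"
      using bounded_family[OF compact_cball, of p r "\<lambda>q. partial (fst q) (Y (fst (snd q)) (snd (snd q)))"] Yc(2) by metis
    from this(1) this(2)[of _ "(_, _, _)"] show thesis by (intro that[of B]) auto
  qed
  define Bb where "Bb = (\<Sum>j\<in>UNIV. norm (b j))"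
  have Bb: "0 \<le> Bb" "\<bar>b j $ i\<bar> \<le> Bb" for i j
    using component_le_norm_cart[of "b j" i] member_le_sum[of j UNIV "\<lambda>j. norm (b j)"]
    by (auto simp: Bb_def intro: sum_nonneg)
  \<comment> \<open>The first bound keeps all iterates in \<open>cball p r\<close>. The second makes
    16 \<delta> (4 L) at most 1/2, which contracts the iteration and its differentiated recursions
    alike; 128 is 2 times 16 times 4.\<close>
  define \<delta> where "\<delta> = min (r / (16 * (Bb + BY) + 1)) (1 / (128 * L + 1))"
  have \<delta>0: "0 < \<delta>" using r(1) Bb(1) BY(1) L(1) by (simp add: \<delta>_def)
  have \<delta>r: "16 * \<delta> * (Bb + BY) \<le> r"
  proof -
    have "\<delta> * (16 * (Bb + BY) + 1) \<le> r"
      using Bb(1) BY(1) by (simp add: \<delta>_def min_le_iff_disj pos_le_divide_eq[symmetric])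
    then show ?thesis using \<delta>0 by (simp add: algebra_simps)
  qed
  have \<delta>L: "16 * \<delta> * (4 * L) \<le> 1 / 2"
  proof -
    have "\<delta> * (128 * L + 1) \<le> 1"
      using L(1) by (simp add: \<delta>_def min_le_iff_disj pos_le_divide_eq[symmetric])
    then show ?thesis using \<delta>0 by (simp add: algebra_simps)
  qed
  let ?S = "ball (0::real^4) \<delta>"
  define c where "c z i = p $ i + (\<Sum>j\<in>-A. z $ j * b j $ i)" for z :: "real^4" and i
  \<comment> \<open>Picard iteration, started from the part that is affine in the parameters outside
    \<open>A\<close>.\<close>
  define G where "G = rec_nat (\<lambda>z. \<chi> i. c z i)
    (\<lambda>n H z. \<chi> i. c z i + (\<Sum>a\<in>A. z $ a * ray_integral A 0 (\<lambda>y. Y a i (H y)) z))"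
  have G0: "G 0 z $ i = c z i" for z i by (simp add: G_def)
  have GSuc: "G (Suc n) z $ i = c z i + (\<Sum>a\<in>A. z $ a * ray_integral A 0 (\<lambda>y. Y a i (G n y)) z)" for n z i
    by (simp add: G_def)
  have zle: "\<bar>z $ a\<bar> \<le> \<delta>" if "z \<in> ?S" for z a
    using component_le_norm_cart[of z a] that by simp
  have small_sum: "\<bar>\<Sum>j\<in>J. z $ j * w j\<bar> \<le> 4 * \<delta> * W" if "z \<in> ?S" "\<And>j. \<bar>w j\<bar> \<le> W" for z w W and J :: "4 set"
  proof -
    have W: "0 \<le> W" using that(2)[of 0] by linarith
    have "\<bar>\<Sum>j\<in>J. z $ j * w j\<bar> \<le> (\<Sum>j\<in>J. \<delta> * W)"
      using that zle \<delta>0 by (intro order_trans[OF sum_abs] sum_mono) (auto simp: abs_mult intro!: mult_mono)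
    also have "\<dots> \<le> (\<Sum>j\<in>(UNIV::4 set). \<delta> * W)" using W \<delta>0 by (intro sum_mono2) auto
    finally show ?thesis by simp
  qed
  \<comment> \<open>Four components, each off by at most 4 \<delta> (Bb + BY), give an l1 distance
    of at most \<open>r\<close>.\<close>
  have near: "x \<in> ?K" if "\<And>i. \<bar>x $ i - p $ i\<bar> \<le> 4 * \<delta> * (Bb + BY)" for x
  proof -
    have "norm (x - p) \<le> (\<Sum>i\<in>(UNIV::4 set). 4 * \<delta> * (Bb + BY))"
      using that by (intro order_trans[OF norm_le_l1_cart] sum_mono) simp
    then show ?thesis using \<delta>r by (simp add: dist_norm norm_minus_commute)
  qed
  have cS: "continuous_on S (\<lambda>z. c z i)" for S i unfolding c_def by (intro continuous_intros)
  have GK: "(\<forall>z\<in>?S. G n z \<in> ?K) \<and> (\<forall>i. continuous_on ?S (\<lambda>z. G n z $ i))" for n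
  proof (induction n)
    case 0
    have "G 0 z \<in> ?K" if "z \<in> ?S" for z
    proof (rule near)
      show "\<bar>G 0 z $ i - p $ i\<bar> \<le> 4 * \<delta> * (Bb + BY)" for i
        using small_sum[where w="\<lambda>j. b j $ i" and J="-A", OF that Bb(2)] mult_nonneg_nonneg[OF less_imp_le[OF \<delta>0] BY(1)]
        unfolding G0 c_def distrib_left by linarith
    qed
    then show ?case using cS by (simp add: G0)
  next
    case (Suc n)
    have c: "continuous_on ?S (G n)"
      by (subst continuous_on_componentwise) (use Suc in \<open>auto simp: Basis_vec_def inner_axis\<close>)
    have Yg: "continuous_on ?S (\<lambda>y. Y a i (G n y))" for a i
      by (rule continuous_on_compose2[OF Yc(1) c]) (use Suc in auto)
    have "G (Suc n) z \<in> ?K" if z: "z \<in> ?S" for z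
    proof (rule near)
      fix i
      have "\<bar>ray_integral A 0 (\<lambda>y. Y a i (G n y)) z\<bar> \<le> BY" for a
        by (rule ray_integral_bound[OF Yg _ z]) (use Suc BY(2) in auto)
      from small_sum[where w="\<lambda>a. ray_integral A 0 (\<lambda>y. Y a i (G n y)) z" and J=A, OF z this] small_sum[where w="\<lambda>j. b j $ i" and J="-A", OF z Bb(2)]
      show "\<bar>G (Suc n) z $ i - p $ i\<bar> \<le> 4 * \<delta> * (Bb + BY)"
        by (simp add: GSuc c_def distrib_left)
    qed
    moreover have "continuous_on ?S (\<lambda>z. G (Suc n) z $ i)" for i
      unfolding GSuc by (intro continuous_intros cS ray_integral_continuous Yg)
    ultimately show ?case by blast
  qed
  then have GK: "\<And>n z. z \<in> ?S \<Longrightarrow> G n z \<in> ?K" and Gc: "\<And>n i. continuous_on ?S (\<lambda>z. G n z $ i)" by blast+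
  have Gcv: "continuous_on ?S (G n)" for n
    by (subst continuous_on_componentwise) (use Gc in \<open>auto simp: Basis_vec_def inner_axis\<close>)
  have YGc: "continuous_on ?S (\<lambda>y. Y a i (G n y))" for a i n
    by (rule continuous_on_compose2[OF Yc(1) Gcv]) (use GK in auto)
  have Lip: "\<bar>Y a i u - Y a i v\<bar> \<le> 4 * L * (\<Sum>l\<in>UNIV. \<bar>u $ l - v $ l\<bar>)" if "u \<in> ?K" "v \<in> ?K" for a i u v
    by (rule lipschitz_from_partials[OF convex_cball smooth_on_differentiable[OF Y KU] L(2) that])
  \<comment> \<open>2 r bounds the distance of any two points of \<open>cball p r\<close>; the
    contraction halves the bound at each step.\<close>
  have Gdiff: "\<bar>G (Suc n) z $ i - G n z $ i\<bar> \<le> 2 * r * (1 / 2) ^ n" if "z \<in> ?S" for n z i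
    using that
  proof (induction n arbitrary: z i)
    case 0
    have "norm (G (Suc 0) z - G 0 z) \<le> norm (G (Suc 0) z - p) + norm (p - G 0 z)"
      using norm_triangle_ineq[of "G (Suc 0) z - p" "p - G 0 z"] by simp
    also have "\<dots> \<le> 2 * r" using GK[OF 0, of "Suc 0"] GK[OF 0, of 0] by (simp add: dist_norm norm_minus_commute)
    finally show ?case using component_le_norm_cart[of "G (Suc 0) z - G 0 z" i] by simp
  next
    case (Suc n)
    let ?I = "\<lambda>n a. ray_integral A 0 (\<lambda>y. Y a i (G n y)) z"
    have "\<bar>?I (Suc n) a - ?I n a\<bar> \<le> 16 * L * (2 * r * (1 / 2) ^ n)" for a
      unfolding ray_integral_diff[OF YGc YGc Suc.prems, symmetric]
    proof (rule ray_integral_bound[OF _ _ Suc.prems])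
      show "\<bar>Y a i (G (Suc n) y) - Y a i (G n y)\<bar> \<le> 16 * L * (2 * r * (1 / 2) ^ n)" if "y \<in> ?S" for y
      proof -
        have "\<bar>Y a i (G (Suc n) y) - Y a i (G n y)\<bar> \<le> 4 * L * (\<Sum>l\<in>UNIV. \<bar>G (Suc n) y $ l - G n y $ l\<bar>)"
          by (intro Lip GK that)
        also have "\<dots> \<le> 4 * L * (\<Sum>l\<in>(UNIV::4 set). 2 * r * (1 / 2) ^ n)"
          using L(1) Suc.IH[OF that] by (intro mult_left_mono sum_mono) auto
        finally show ?thesis by simp
      qed
    qed (intro continuous_intros YGc)
    from small_sum[where w="\<lambda>a. ?I (Suc n) a - ?I n a" and J=A, OF Suc.prems this]
    have "\<bar>G (Suc (Suc n)) z $ i - G (Suc n) z $ i\<bar> \<le> (16 * \<delta> * (4 * L)) * (2 * r * (1 / 2) ^ n)"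
      by (simp add: GSuc sum_subtractf right_diff_distrib mult_ac)
    also have "\<dots> \<le> 1 / 2 * (2 * r * (1 / 2) ^ n)"
      using \<delta>L r(1) by (intro mult_right_mono) auto
    finally show ?case by simp
  qed
  have GC0: "C0_summable ?S (\<lambda>n z. G n z $ i)" for i
  proof (rule C0_summableI[where B="norm p + r" and e="\<lambda>n. 2 * r * (1 / 2) ^ n"])
    show "\<bar>G n z $ i\<bar> \<le> norm p + r" if "z \<in> ?S" for n z
      using component_le_norm_cart[of "G n z" i] GK[OF that, of n] norm_triangle_ineq2[of "G n z" p]
      by (simp add: dist_norm norm_minus_commute)
  qed (use r(1) Gc Gdiff in \<open>auto intro!: summable_mult summable_geometric\<close>)
  have GCk: "Ck k ?S (\<lambda>z. G n z $ i)" for k n i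
  proof (induction n arbitrary: i)
    case 0
    show ?case unfolding G0 c_def by (intro Ck_add Ck_sum Ck_mult Ck_proj Ck_const open_ball)
  next
    case (Suc n)
    have "Ck k ?S (\<lambda>y. Y a i (G n y))" for a i
      by (rule Ck_compose[OF assms(1) open_ball _ _ Suc])
        (use GK KU Y in \<open>auto simp: smooth_on_def\<close>)
    then show ?case unfolding GSuc c_def
      by (intro Ck_add Ck_sum Ck_mult Ck_proj Ck_const Ck_ray_integral open_ball)
  qed
  have Gd: "(\<lambda>z. G n z $ i) differentiable (at z)" if "z \<in> ?S" for n z i
    using GCk[of "Suc 0" n i] that by simp
  define M where "M n a i l y = partial l (Y a i) (G n y)" for n a i l y
  \<comment> \<open>Control of order k of the iterates gives the same for the coefficients
    \<open>M\<close>; the linear recursion then yields it for the first derivatives, i.e. order k +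
    1 for the iterates.\<close>
  have Gk: "Ck_summable k ?S (\<lambda>n z. G n z $ i)" for k i
  proof (induction k arbitrary: i)
    case (Suc k)
    define dG where "dG j n i = partial j (\<lambda>z. G n z $ i)" for j n i
    have MCk: "Ck_summable k ?S (\<lambda>n. M n a i l)" for a i l
      unfolding M_def
      by (rule Ck_summable_compose[OF assms(1) open_ball compact_cball convex_cball r(2) smooth_on_partial[OF Y] GK Suc])
    have YCk: "Ck_summable k ?S (\<lambda>n z. Y a i (G n z))" for a i
      by (rule Ck_summable_compose[OF assms(1) open_ball compact_cball convex_cball r(2) Y GK Suc])
    have dc: "partial j (\<lambda>z. c z i) z = (if j \<in> A then 0 else b j $ i)" for j i z
      unfolding c_def
      by (auto simp: partial_add partial_sum partial_mult partial_proj differentiable_proj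
          differentiable_mult differentiable_sum if_distrib[where f="\<lambda>x. x * _"] cong: if_cong)
    \<comment> \<open>The chain rule under the integral. The inhomogeneity is the component of
      \<open>b j\<close> for a parameter outside \<open>A\<close> and the integral itself for a
      parameter in \<open>A\<close>.\<close>
    have rec: "dG j (Suc n) i z = ((if j \<in> A then 0 else b j $ i)
        + (\<Sum>a\<in>A. (if j = a then 1 else 0) * ray_integral A 0 (\<lambda>y. Y a i (G n y)) z))
        + (\<Sum>a\<in>A. \<Sum>l\<in>UNIV. z $ a * ray_integral A (if j \<in> A then Suc 0 else 0) (\<lambda>y. M n a i l y * dG j n l y) z)"
      (is "_ = ?B + ?T") if z: "z \<in> ?S" for j n i z
    proof -
      have YGk: "Ck (Suc 0) ?S (\<lambda>y. Y a i (G n y))" for a i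
        by (rule Ck_compose[OF assms(1) open_ball _ _ GCk]) (use GK KU Y in \<open>auto simp: smooth_on_def simp del: Ck.simps\<close>)
      have YGd: "(\<lambda>y. Y a i (G n y)) differentiable (at y)" "continuous_on ?S (partial j (\<lambda>y. Y a i (G n y)))"
        if "y \<in> ?S" for a i y j using YGk[of a i] that by auto
      have dGc: "continuous_on ?S (dG j n l)" for l using GCk[of "Suc 0" n l] by (simp add: dG_def)
      have Mc: "continuous_on ?S (M n a i l)" for a l
        using C0_summable_continuous[OF Ck_summable_C0[OF MCk]] .
      have r: "partial j (ray_integral A 0 (\<lambda>y. Y a i (G n y))) z
          = (\<Sum>l\<in>UNIV. ray_integral A (if j \<in> A then Suc 0 else 0) (\<lambda>y. M n a i l y * dG j n l y) z)" for a
      proof -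
        have "partial j (ray_integral A 0 (\<lambda>y. Y a i (G n y))) z
            = ray_integral A (if j \<in> A then Suc 0 else 0) (partial j (\<lambda>y. Y a i (G n y))) z"
          by (rule partial_ray_integral[OF YGd(1) YGd(2)[OF z] z])
        also have "\<dots> = ray_integral A (if j \<in> A then Suc 0 else 0) (\<lambda>y. \<Sum>l\<in>UNIV. M n a i l y * dG j n l y) z"
        proof (rule ray_integral_cong[OF _ z])
          fix y assume y: "y \<in> ?S"
          have "partial j (\<lambda>y. Y a i (G n y)) y = (\<Sum>l\<in>UNIV. partial j (\<lambda>y. G n y $ l) y * partial l (Y a i) (G n y))"
            by (rule partial_compose[OF smooth_on_differentiable[OF Y KU[OF GK[OF y]]] Gd[OF y]])
          then show "partial j (\<lambda>y. Y a i (G n y)) y = (\<Sum>l\<in>UNIV. M n a i l y * dG j n l y)"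
            by (simp add: M_def dG_def mult.commute)
        qed
        also have "\<dots> = (\<Sum>l\<in>UNIV. ray_integral A (if j \<in> A then Suc 0 else 0) (\<lambda>y. M n a i l y * dG j n l y) z)"
          by (simp add: sum_4 ray_integral_add[OF _ _ z] continuous_on_add continuous_on_mult Mc dGc)
        finally show ?thesis .
      qed
      have "(\<lambda>z. c z i) differentiable (at z)"
        unfolding c_def by (auto intro!: differentiable_add differentiable_sum differentiable_mult differentiable_proj)
      moreover have "ray_integral A 0 (\<lambda>y. Y a i (G n y)) differentiable (at z)" for a
        by (rule ray_integral_differentiable[OF YGd(1) YGd(2)[OF z] z])
      ultimately show ?thesis
        unfolding dG_def GSuc
        by (simp add: partial_add partial_sum partial_mult partial_proj differentiable_proj dc
          differentiable_mult differentiable_sum r sum.distrib sum_distrib_left)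
          (simp add: dG_def)
    qed
    have "Ck_summable k ?S (\<lambda>n. dG j n i)" for j i
    proof (rule Ck_summable_linear_recursion[OF rec _ _ MCk _ \<delta>L \<delta>0])
      show "dG j 0 i = (\<lambda>_. if j \<in> A then 0 else b j $ i)" for i
        by (simp add: dG_def G0 dc fun_eq_iff)
      show "Ck_summable k ?S (\<lambda>n z. (if j \<in> A then 0 else b j $ i)
        + (\<Sum>a\<in>A. (if j = a then 1 else 0) * ray_integral A 0 (\<lambda>y. Y a i (G n y)) z))" for i
        by (intro Ck_summable_add Ck_summable_const Ck_summable_sum Ck_summable_cmult
            Ck_summable_ray_integral YCk open_ball)
      \<comment> \<open>The coarse bound 4 L matches the smallness condition already fixed for the
        iteration.\<close>
      show "\<bar>M n a i l z\<bar> \<le> 4 * L" if "z \<in> ?S" for n a i l z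
        using L(2)[OF GK[OF that], of l a i] L(1) by (simp add: M_def order_trans[of _ L])
    qed
    then show ?case using GC0 Gd by (simp add: dG_def)
  qed (simp add: GC0)
  have "\<forall>i. \<exists>t g. t \<longlonglongrightarrow> 0 \<and> (\<forall>n. \<forall>z\<in>?S. \<bar>G n z $ i - g z\<bar> \<le> t n) \<and> (\<forall>z\<in>?S. (\<lambda>n. G n z $ i) \<longlonglongrightarrow> g z)"
  proof
    fix i
    show "\<exists>t g. t \<longlonglongrightarrow> 0 \<and> (\<forall>n. \<forall>z\<in>?S. \<bar>G n z $ i - g z\<bar> \<le> t n) \<and> (\<forall>z\<in>?S. (\<lambda>n. G n z $ i) \<longlonglongrightarrow> g z)"
      by (rule C0_summable_limit[OF GC0, of i]) blast
  qed
  then obtain t g where t: "\<And>i. t i \<longlonglongrightarrow> (0::real)" and tb: "\<And>i n z. z \<in> ?S \<Longrightarrow> \<bar>G n z $ i - g i z\<bar> \<le> t i n"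
    and lim: "\<And>i z. z \<in> ?S \<Longrightarrow> (\<lambda>n. G n z $ i) \<longlonglongrightarrow> g i z" by metis
  define \<gamma> where "\<gamma> z = (\<chi> i. g i z)" for z
  have "Ck k ?S (g i)" for k i
    by (rule Ck_summable_limit[OF open_ball convex_ball _ Gk lim]) (use \<delta>0 in auto)
  then have sm: "smooth_map ?S \<gamma>" by (simp add: smooth_map_def smooth_on_def \<gamma>_def)
  have lim\<gamma>: "(\<lambda>n. G n z) \<longlonglongrightarrow> \<gamma> z" if "z \<in> ?S" for z
    using lim[OF that] by (intro vec_tendstoI) (simp add: \<gamma>_def)
  have \<gamma>K: "\<gamma> z \<in> ?K" if "z \<in> ?S" for z
    by (rule closed_sequentially[OF closed_cball _ lim\<gamma>[OF that]]) (rule GK[OF that])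
  have Y\<gamma>c: "continuous_on ?S (\<lambda>y. Y a i (\<gamma> y))" for a i
    by (rule continuous_on_compose2[OF Yc(1) smooth_map_continuous[OF sm]]) (use \<gamma>K in auto)
  \<comment> \<open>The Lipschitz bound lets the limit pass through \<open>Y\<close> and through the
    integral.\<close>
  have eq: "\<gamma> z $ i = c z i + (\<Sum>a\<in>A. z $ a * ray_integral A 0 (\<lambda>y. Y a i (\<gamma> y)) z)" if z: "z \<in> ?S" for z i
  proof -
    have "(\<lambda>n. ray_integral A 0 (\<lambda>y. Y a i (G n y)) z) \<longlonglongrightarrow> ray_integral A 0 (\<lambda>y. Y a i (\<gamma> y)) z" for a
    proof (rule LIM_zero_cancel, rule Lim_null_comparison)
      have "\<bar>ray_integral A 0 (\<lambda>y. Y a i (G n y)) z - ray_integral A 0 (\<lambda>y. Y a i (\<gamma> y)) z\<bar>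
          \<le> 4 * L * (\<Sum>l\<in>UNIV. t l n)" for n
        unfolding ray_integral_diff[OF YGc Y\<gamma>c z, symmetric]
      proof (rule ray_integral_bound[OF _ _ z])
        show "\<bar>Y a i (G n y) - Y a i (\<gamma> y)\<bar> \<le> 4 * L * (\<Sum>l\<in>UNIV. t l n)" if "y \<in> ?S" for y
          using L(1) tb[OF that]
          by (intro order_trans[OF Lip[OF GK[OF that] \<gamma>K[OF that]]] mult_left_mono sum_mono) (auto simp: \<gamma>_def)
      qed (intro continuous_intros YGc Y\<gamma>c)
      then show "\<forall>\<^sub>F n in sequentially. norm (ray_integral A 0 (\<lambda>y. Y a i (G n y)) z - ray_integral A 0 (\<lambda>y. Y a i (\<gamma> y)) z)
          \<le> 4 * L * (\<Sum>l\<in>UNIV. t l n)" by simp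
      have "(\<lambda>n. 4 * L * (\<Sum>l\<in>UNIV. t l n)) \<longlonglongrightarrow> 4 * L * (\<Sum>l\<in>(UNIV::4 set). 0)"
        by (intro tendsto_intros t)
      then show "(\<lambda>n. 4 * L * (\<Sum>l\<in>UNIV. t l n)) \<longlonglongrightarrow> 0" by simp
    qed
    then have "(\<lambda>n. G (Suc n) z $ i) \<longlonglongrightarrow> c z i + (\<Sum>a\<in>A. z $ a * ray_integral A 0 (\<lambda>y. Y a i (\<gamma> y)) z)"
      unfolding GSuc by (intro tendsto_intros)
    moreover have "(\<lambda>n. G (Suc n) z $ i) \<longlonglongrightarrow> \<gamma> z $ i"
      using LIMSEQ_Suc[OF lim[OF z]] by (simp add: \<gamma>_def)
    ultimately show ?thesis using LIMSEQ_unique by blast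
  qed
  show thesis
    by (rule that[OF \<delta>0 sm]) (use \<gamma>K KU eq in \<open>auto simp: c_def\<close>)
qed

section \<open>Sums over the index types and matrix algebra\<close>

lemma UNIV4: "(UNIV :: 4 set) = {0, 1, 2, 3}"
  using UNIV_4 by auto

lemma UNIV2: "(UNIV :: 2 set) = {0, 1}"
  using UNIV_2 by auto

lemma sum4: "sum f (UNIV :: 4 set) = f 0 + f 1 + f 2 + f 3"
  unfolding UNIV4 by (simp add: add.assoc)

lemma sum2: "sum f (UNIV :: 2 set) = f 0 + f 1"
  unfolding UNIV2 by simp

lemma all4: "(\<forall>i :: 4. P i) \<longleftrightarrow> P 0 \<and> P 1 \<and> P 2 \<and> P 3"
  using UNIV4 by (metis UNIV_I insertE singletonD)

lemma all2: "(\<forall>i :: 2. P i) \<longleftrightarrow> P 0 \<and> P 1"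
  using UNIV2 by (metis UNIV_I insertE singletonD)

lemma matrix_mul_distrib:
  fixes A B C :: "real^'n^'n"
  shows "A ** (B + C) = A ** B + A ** C" "(A + B) ** C = A ** C + B ** C"
    "A ** (B - C) = A ** B - A ** C" "(A - B) ** C = A ** C - B ** C"
    "A ** (- B) = - (A ** B)" "(- A) ** B = - (A ** B)"
    "(r *\<^sub>R A) ** B = r *\<^sub>R (A ** B)" "A ** (r *\<^sub>R B) = r *\<^sub>R (A ** B)"
  by (simp_all add: matrix_matrix_mult_def vec_eq_iff algebra_simps sum.distrib sum_subtractf
      sum_negf sum_distrib_left)

lemma transpose_simps:
  fixes A B :: "real^'n^'n"
  shows "transpose (A + B) = transpose A + transpose B" "transpose (A - B) = transpose A - transpose B"
    "transpose (- A) = - transpose A" "transpose (r *\<^sub>R A) = r *\<^sub>R transpose A"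
    "transpose (A ** B) = transpose B ** transpose A"
  by (simp_all add: transpose_def vec_eq_iff matrix_matrix_mult_def mult.commute)

lemmas matrix_algebra = matrix_mul_distrib transpose_simps matrix_mul_assoc

lemma matrix_cancel_left:
  fixes A B C :: "real^'n^'n"
  assumes "invertible A" "A ** B = A ** C"
  shows "B = C"
  using assms by (metis matrix_inv_right_left(2) matrix_mul_assoc matrix_mul_lid)

lemma matrix_cancel_right:
  fixes A B C :: "real^'n^'n"
  assumes "invertible A" "B ** A = C ** A"
  shows "B = C"
  using assms by (metis matrix_inv_right_left(1) matrix_mul_assoc matrix_mul_rid)

section \<open>Connection and curvature\<close>

text \<open>Connection matrix in direction \<open>l\<close>: on a column of vector components the
  covariant derivative is the partial derivative plus multiplication by
  \<open>Gam g l\<close>.\<close>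

definition Gam :: "(real^4 \<Rightarrow> real^4^4) \<Rightarrow> 4 \<Rightarrow> real^4 \<Rightarrow> real^4^4" where
  "Gam g l x = (\<chi> k j. Chr g k l j x)"

text \<open>The curvature endomorphism of the coordinate directions \<open>l\<close> and
  \<open>j\<close>, computed from the connection matrices.\<close>

definition Curv :: "(real^4 \<Rightarrow> real^4^4) \<Rightarrow> 4 \<Rightarrow> 4 \<Rightarrow> real^4 \<Rightarrow> real^4^4" where
  "Curv g l j x = mpartial l (Gam g j) x - mpartial j (Gam g l) x
     + Gam g l x ** Gam g j x - Gam g j x ** Gam g l x"

definition Ricm :: "(real^4 \<Rightarrow> real^4^4) \<Rightarrow> real^4 \<Rightarrow> real^4^4" where
  "Ricm g x = (\<chi> i j. Ric g i j x)"

text \<open>Vanishing covariant derivative of a tensor of type (1,1): its upper and its lower index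
  contribute products with opposite signs.\<close>

definition parallel_on :: "(real^4) set \<Rightarrow> (real^4 \<Rightarrow> real^4^4) \<Rightarrow> (real^4 \<Rightarrow> real^4^4) \<Rightarrow> bool" where
  "parallel_on V g P \<longleftrightarrow> (\<forall>x\<in>V. \<forall>l. mpartial l P x = P x ** Gam g l x - Gam g l x ** P x)"

lemma lorentzian4_invertible: "lorentzian4 G \<Longrightarrow> invertible G"
proof -
  assume "lorentzian4 G"
  then obtain P where P: "invertible P" "transpose P ** G ** P = eta4" by (auto simp: lorentzian4_def)
  have "eta4 ** eta4 = mat 1"
    by (auto simp: eta4_def matrix_matrix_mult_def mat_def vec_eq_iff sum4 all4)
  then have "invertible eta4" using invertible_right_inverse by blast
  then have "det (transpose P ** G ** P) \<noteq> 0" using P(2) by (simp add: invertible_det_nz)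
  then show "invertible G" by (simp add: det_mul invertible_det_nz)
qed

context
  fixes U g
  assumes st: "spacetime U g"
begin

lemma openU: "open U" and g_smooth: "smooth_matrix U g"
  using st by (auto simp: spacetime_def smooth_matrix_def)

lemma g_sym: "x \<in> U \<Longrightarrow> transpose (g x) = g x" and g_inv: "x \<in> U \<Longrightarrow> invertible (g x)"
  using st lorentzian4_invertible by (auto simp: spacetime_def lorentzian4_def)

lemma g_sym_entry: "x \<in> U \<Longrightarrow> g x $ i $ j = g x $ j $ i"
  using g_sym[of x] by (simp add: vec_eq_iff transpose_def)

lemma partial_g_sym: "x \<in> U \<Longrightarrow> partial l (\<lambda>y. g y $ i $ j) x = partial l (\<lambda>y. g y $ j $ i) x"
  by (rule partial_cong[OF openU _ g_sym_entry])

lemma ginv_smooth: "smooth_matrix U (ginv g)"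
  unfolding ginv_def[abs_def] by (rule smooth_matrix_inv[OF openU g_smooth g_inv])

lemma g_ginv: "x \<in> U \<Longrightarrow> g x ** ginv g x = mat 1" "x \<in> U \<Longrightarrow> ginv g x ** g x = mat 1"
  unfolding ginv_def by (auto simp: matrix_inv_right_left g_inv)

lemma Chr_sym: "x \<in> U \<Longrightarrow> Chr g k i j x = Chr g k j i x"
  unfolding Chr_def
  by (simp add: partial_g_sym[of x _ i j] add.commute)

lemma Chr_smooth: "smooth_on U (Chr g k i j)"
  unfolding Chr_def[abs_def]
  using g_smooth ginv_smooth openU unfolding smooth_matrix_def
  by (intro smooth_on_mult smooth_on_sum smooth_on_const smooth_on_diff smooth_on_add smooth_on_partial) auto

lemma Gam_smooth: "smooth_matrix U (Gam g l)"
  using Chr_smooth by (simp add: smooth_matrix_def Gam_def)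

lemma g_Gam: 
  assumes "x \<in> U"
  shows "(g x ** Gam g l x) $ a $ j = (partial l (\<lambda>y. g y $ j $ a) x + partial j (\<lambda>y. g y $ l $ a) x
    - partial a (\<lambda>y. g y $ l $ j) x) / 2"
proof -
  define w where "w = (\<chi> a. (partial l (\<lambda>y. g y $ j $ a) x + partial j (\<lambda>y. g y $ l $ a) x
    - partial a (\<lambda>y. g y $ l $ j) x) / 2)"
  have "(\<chi> k. Gam g l x $ k $ j) = ginv g x *v w"
    by (simp add: vec_eq_iff Gam_def Chr_def matrix_vector_mult_def w_def sum_distrib_left)
  moreover have "(g x ** Gam g l x) $ a $ j = (g x *v (\<chi> k. Gam g l x $ k $ j)) $ a"
    by (simp add: matrix_matrix_mult_def matrix_vector_mult_def)
  ultimately show ?thesis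
    by (simp add: matrix_vector_mul_assoc g_ginv assms) (simp add: w_def)
qed

text \<open>In \<open>g_Gam\<close> the last two terms form a part antisymmetric in the two free
  indices, which adding the transpose cancels.\<close>

lemma metric_compatible:
  assumes "x \<in> U"
  shows "mpartial l g x = transpose (Gam g l x) ** g x + g x ** Gam g l x"
proof -
  have "transpose (Gam g l x) ** g x = transpose (g x ** Gam g l x)"
    by (simp add: transpose_simps g_sym assms)
  then have "(transpose (Gam g l x) ** g x + g x ** Gam g l x) $ a $ b = mpartial l g x $ a $ b" for a b
    using partial_g_sym[OF assms, of l b a]
    by (simp add: transpose_def g_Gam assms mpartial_def add_divide_distrib diff_divide_distrib)
  then show ?thesis by (simp add: vec_eq_iff)
qed

lemma Curv_antisym: "Curv g j l x = - Curv g l j x"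
  by (simp add: Curv_def)

text \<open>No torsion: the symmetry of \<open>Chr\<close> and of its partial derivatives in the
  lower indices pairs off all terms of the cyclic sum.\<close>

lemma Curv_bianchi:
  assumes "x \<in> U"
  shows "Curv g l j x $ k $ i + Curv g j i x $ k $ l + Curv g i l x $ k $ j = 0"
proof -
  have p: "partial a (Chr g k b c) x = partial a (Chr g k c b) x" for a b c
    by (rule partial_cong[OF openU assms Chr_sym])
  have s: "(\<Sum>m\<in>UNIV. Chr g k a m x * Chr g m b c x) = (\<Sum>m\<in>UNIV. Chr g k a m x * Chr g m c b x)" for a b c
    by (simp add: Chr_sym[OF assms, of _ b c])
  show ?thesis
    using p[of l j i] p[of j i l] p[of i l j] s[of l j i] s[of j i l] s[of i l j]
    by (simp add: Curv_def mpartial_def Gam_def matrix_matrix_mult_def)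
qed

text \<open>Ricci identity for a parallel form \<open>T\<close>: differentiating its equation once
  more and using the symmetry of second derivatives leaves only the curvature.\<close>

lemma Curv_covariant:
  assumes "open V" "V \<subseteq> U" "smooth_matrix V T"
    and "\<And>x l. x \<in> V \<Longrightarrow> mpartial l T x = transpose (Gam g l x) ** T x + T x ** Gam g l x" and "x \<in> V"
  shows "transpose (Curv g l j x) ** T x + T x ** Curv g l j x = 0"
proof -
  note G = smooth_matrix_subset[OF Gam_smooth assms(2)]
  have Gd: "(\<lambda>y. Gam g l y $ a $ b) differentiable (at x)" for l a b
    by (rule smooth_matrix_differentiable[OF G assms(5)])
  have Td: "(\<lambda>y. T y $ a $ b) differentiable (at x)" for a b
    by (rule smooth_matrix_differentiable[OF assms(3,5)])
  have Gtd: "(\<lambda>y. transpose (Gam g l y) $ a $ b) differentiable (at x)" for l a b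
    using Gd by (simp add: transpose_def)
  have dd: "mpartial j (mpartial l T) x = transpose (mpartial j (Gam g l) x) ** T x
      + transpose (Gam g l x) ** mpartial j T x + (mpartial j T x ** Gam g l x + T x ** mpartial j (Gam g l) x)" for j l
  proof -
    have "mpartial j (mpartial l T) x = mpartial j (\<lambda>y. transpose (Gam g l y) ** T y + T y ** Gam g l y) x"
      by (rule mpartial_cong[OF assms(1,5,4)])
    also have "\<dots> = mpartial j (\<lambda>y. transpose (Gam g l y) ** T y) x + mpartial j (\<lambda>y. T y ** Gam g l y) x"
      by (rule mpartial_add) (auto simp: matrix_matrix_mult_def intro!: differentiable_sum differentiable_mult Gtd Td Gd)
    finally show ?thesis by (simp add: mpartial_mul Gtd Td Gd mpartial_transpose)
  qed
  have "mpartial j (mpartial l T) x = mpartial l (mpartial j T) x"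
    by (rule mpartial_commute[OF assms(1,3,5)])
  then show ?thesis
    unfolding dd assms(4)[OF assms(5)] Curv_def
    by (simp add: matrix_algebra algebra_simps)
qed

lemma Curv_metric: "x \<in> U \<Longrightarrow> transpose (Curv g l j x) ** g x + g x ** Curv g l j x = 0"
  by (rule Curv_covariant[OF openU subset_refl g_smooth metric_compatible])

text \<open>The Ricci identity for a parallel tensor of type (1,1), on which the curvature acts by a
  commutator.\<close>

lemma Curv_commute:
  assumes "open V" "V \<subseteq> U" "smooth_matrix V P" "parallel_on V g P" "x \<in> V"
  shows "Curv g l j x ** P x = P x ** Curv g l j x"
proof -
  note G = smooth_matrix_subset[OF Gam_smooth assms(2)]
  have Gd: "(\<lambda>y. Gam g l y $ a $ b) differentiable (at x)" for l a b
    by (rule smooth_matrix_differentiable[OF G assms(5)])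
  have Pd: "(\<lambda>y. P y $ a $ b) differentiable (at x)" for a b
    by (rule smooth_matrix_differentiable[OF assms(3,5)])
  have P': "mpartial l P x = P x ** Gam g l x - Gam g l x ** P x" if "x \<in> V" for x l
    using assms(4) that by (simp add: parallel_on_def)
  have dd: "mpartial j (mpartial l P) x = mpartial j P x ** Gam g l x + P x ** mpartial j (Gam g l) x
      - (mpartial j (Gam g l) x ** P x + Gam g l x ** mpartial j P x)" for j l
  proof -
    have "mpartial j (mpartial l P) x = mpartial j (\<lambda>y. P y ** Gam g l y - Gam g l y ** P y) x"
      by (rule mpartial_cong[OF assms(1,5) P'])
    also have "\<dots> = mpartial j (\<lambda>y. P y ** Gam g l y) x - mpartial j (\<lambda>y. Gam g l y ** P y) x"
      by (rule mpartial_add) (auto simp: matrix_matrix_mult_def intro!: differentiable_sum differentiable_mult Pd Gd)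
    finally show ?thesis by (simp add: mpartial_mul Pd Gd)
  qed
  have "mpartial j (mpartial l P) x = mpartial l (mpartial j P) x"
    by (rule mpartial_commute[OF assms(1,3,5)])
  then show ?thesis
    unfolding dd P'[OF assms(5)] Curv_def
    by (simp add: matrix_algebra algebra_simps)
qed

lemma Ric_Curv:
  assumes "x \<in> U"
  shows "Ric g i j x = (\<Sum>k\<in>UNIV. Curv g k j x $ k $ i)"
proof -
  have p: "partial a (Chr g k b c) x = partial a (Chr g k c b) x" for a b c k
    by (rule partial_cong[OF openU assms Chr_sym])
  show ?thesis
    unfolding Ric_def Curv_def
    by (simp add: mpartial_def Gam_def matrix_matrix_mult_def sum.distrib sum_subtractf
        p[of _ _ i] Chr_sym[OF assms, of _ i])
qed

text \<open>Contracting the Bianchi identity leaves the antisymmetric part of Ricci and a trace of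
  the curvature. The latter vanishes because the curvature is skew with respect to
  \<open>g\<close>.\<close>

lemma Ric_sym:
  assumes "x \<in> U"
  shows "Ric g i j x = Ric g j i x"
proof -
  have "trace (Curv g i j x) = 0" for i j
  proof -
    let ?F = "Curv g i j x"
    have "transpose ?F ** g x = - (g x ** ?F)"
      using Curv_metric[OF assms, of i j] by (simp add: eq_neg_iff_add_eq_0)
    then have "transpose ?F ** (g x ** ginv g x) = - (g x ** ?F ** ginv g x)"
      by (simp add: matrix_mul_assoc matrix_mul_distrib)
    then have "trace (transpose ?F) = - trace (g x ** ?F ** ginv g x)"
      by (simp add: g_ginv assms trace_def sum_negf)
    also have "trace (g x ** ?F ** ginv g x) = trace (ginv g x ** (g x ** ?F))"
      by (rule trace_mul_sym)
    also have "\<dots> = trace ?F" by (simp add: matrix_mul_assoc g_ginv assms)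
    finally show ?thesis by (simp add: trace_def transpose_def)
  qed
  moreover have "(\<Sum>k\<in>UNIV. Curv g k j x $ k $ i + Curv g j i x $ k $ k + Curv g i k x $ k $ j) = 0"
    by (rule sum.neutral) (use Curv_bianchi[OF assms] in blast)
  ultimately show ?thesis
    by (simp add: Ric_Curv[OF assms] sum.distrib sum_subtractf trace_def Curv_antisym[of i] sum_negf)
qed

lemma Ric_smooth: "smooth_on U (Ric g i j)"
  unfolding Ric_def[abs_def]
  by (intro smooth_on_add smooth_on_sum smooth_on_diff smooth_on_mult smooth_on_partial Chr_smooth openU)

lemma TFRic_smooth: "smooth_on U (TFRic g i j)"
  unfolding TFRic_def[abs_def] scal_def
  using g_smooth ginv_smooth openU unfolding smooth_matrix_def divide_inverse
  by (intro smooth_on_diff smooth_on_mult smooth_on_sum smooth_on_const Ric_smooth) auto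

lemma Nmat_smooth: "smooth_matrix U (Nmat g)"
  using TFRic_smooth by (simp add: smooth_matrix_def Nmat_def)

lemma Nmat_sym: "x \<in> U \<Longrightarrow> transpose (Nmat g x) = Nmat g x"
  by (simp add: vec_eq_iff transpose_def Nmat_def TFRic_def Ric_sym[of x] g_sym_entry[of x])

end

section \<open>Curvature of a parallel splitting\<close>

text \<open>Matrix of the involution in an adapted frame; the indices 0 and 1 belong to the
  eigenvalue 1.\<close>

definition sig :: "real^4^4" where
  "sig = (\<chi> i j. if i = j then (if i \<in> {0, 1} then 1 else - 1) else 0)"

text \<open>The adjugate: in the type 2 the term \<open>1 - i\<close> is the other index.\<close>

definition adj2 :: "real^2^2 \<Rightarrow> real^2^2" where
  "adj2 A = (\<chi> i j. if i = j then A $ (1 - i) $ (1 - i) else - A $ i $ j)"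

lemma block_entry:
  "block A B $ a $ b = (if a \<in> {0,1} \<and> b \<in> {0,1} then A $ lo a $ lo b
     else if a \<in> {2,3} \<and> b \<in> {2,3} then B $ hi a $ hi b else 0)"
  by (simp add: block_def)

lemma lo_hi: "lo 0 = 0" "lo 1 = 1" "hi 2 = 0" "hi 3 = 1"
  by (simp_all add: lo_def hi_def)

lemma block_mul: "block A B ** block A' B' = block (A ** A') (B ** B')"
  by (simp add: vec_eq_iff all4 matrix_matrix_mult_def sum4 sum2 block_entry lo_hi)

lemma block_one: "block (mat 1) (mat 1) = mat 1"
  by (simp add: vec_eq_iff all4 block_entry lo_hi mat_def)

lemma block_arith:
  "block A B + block A' B' = block (A + A') (B + B')"
  "block A B - block A' B' = block (A - A') (B - B')"
  "c *\<^sub>R block A B = block (c *\<^sub>R A) (c *\<^sub>R B)"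
  "transpose (block A B) = block (transpose A) (transpose B)"
  by (simp_all add: vec_eq_iff all4 block_entry lo_hi transpose_def)

lemma sig_block: "sig = block (mat 1) (- mat 1)"
  by (simp add: vec_eq_iff all4 block_entry lo_hi sig_def mat_def)

lemma sig_sig: "sig ** sig = mat 1"
  by (simp add: sig_block block_mul block_one matrix_mul_distrib)

lemma trace_block: "trace (block A B) = trace A + trace B"
  by (simp add: trace_def sum4 sum2 block_entry lo_hi)

lemma det2: "det (A :: real^2^2) = A $ 0 $ 0 * A $ 1 $ 1 - A $ 0 $ 1 * A $ 1 $ 0"
proof -
  \<comment> \<open>\<open>det_2\<close> uses the indices 1 and 2; renaming 2 to 0 permutes rows and
    columns alike and so preserves the determinant.\<close>
  have two: "(2 :: 2) = 0" using exhaust_2[of 0] by auto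
  show ?thesis using det_2[of A, unfolded two] by (simp add: mult.commute)
qed

lemma adj2_mul: "A ** adj2 A = det A *\<^sub>R mat 1"
  by (simp add: vec_eq_iff all2 matrix_matrix_mult_def sum2 adj2_def mat_def det2 mult.commute)

lemma block_inverse:
  assumes "det A \<noteq> 0" "det B \<noteq> 0"
  shows "block A B ** block ((1 / det A) *\<^sub>R adj2 A) ((1 / det B) *\<^sub>R adj2 B) = mat 1"
  using assms by (simp add: block_mul matrix_mul_distrib adj2_mul block_one)

lemma mul_sig_entry:
  "(M ** sig) $ d $ c = M $ d $ c * (if c \<in> {0, 1} then 1 else - 1)"
  "(sig ** M) $ d $ c = (if d \<in> {0, 1} then 1 else - 1) * M $ d $ c"
proof -
  have s: "sig $ k $ c = (if k = c then (if c \<in> {0, 1} then 1 else - 1) else 0)"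
    "sig $ d $ k = (if k = d then (if d \<in> {0, 1} then 1 else - 1) else 0)" for k c d
    by (auto simp: sig_def)
  show "(M ** sig) $ d $ c = M $ d $ c * (if c \<in> {0, 1} then 1 else - 1)"
    by (simp only: matrix_matrix_mult_def vec_lambda_beta s(1) if_distrib[where f="\<lambda>x. _ * x"]
        mult_zero_right sum.delta finite UNIV_I if_True)
  show "(sig ** M) $ d $ c = (if d \<in> {0, 1} then 1 else - 1) * M $ d $ c"
    by (simp only: matrix_matrix_mult_def vec_lambda_beta s(2) if_distrib[where f="\<lambda>x. x * _"]
        mult_zero_left sum.delta finite UNIV_I if_True)
qed

text \<open>A block-diagonal frame metric makes \<open>P\<close> self-adjoint for \<open>G\<close>;
  in this form the involution moves across the metric and becomes a sign on the left.\<close>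

lemma frame_sig:
  fixes J G P :: "real^4^4"
  assumes "invertible J" "P ** J = J ** sig" "transpose J ** G ** J = block A B"
  shows "transpose J ** G ** P = sig ** transpose J ** G"
proof (rule matrix_cancel_right[OF assms(1)])
  have "transpose J ** G ** P ** J = transpose J ** G ** J ** sig"
    by (metis assms(2) matrix_mul_assoc)
  also have "\<dots> = sig ** (transpose J ** G ** J)"
    by (simp add: assms(3) sig_block block_mul matrix_mul_distrib)
  finally show "transpose J ** G ** P ** J = sig ** transpose J ** G ** J" by (simp add: matrix_mul_assoc)
qed

text \<open>Pure algebra at one point: \<open>F l j\<close> stands for the curvature endomorphisms,
  \<open>commute\<close> is what a parallel \<open>P\<close> contributes, and the columns of
  \<open>J\<close> are an adapted frame.\<close>

locale product_frame =
  fixes F :: "4 \<Rightarrow> 4 \<Rightarrow> real^4^4" and G P J :: "real^4^4" and A B :: "real^2^2"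
  assumes antisym: "\<And>l j. F j l = - F l j"
    and bianchi: "\<And>l j k i. F l j $ k $ i + F j i $ k $ l + F i l $ k $ j = 0"
    and metric: "\<And>l j. transpose (F l j) ** G + G ** F l j = 0"
    and commute: "\<And>l j. F l j ** P = P ** F l j"
    and J: "invertible J" and PJ: "P ** J = J ** sig"
    and GJ: "transpose J ** G ** J = block A B"
    and G: "transpose G = G"
    and det: "det A \<noteq> 0" "det B \<noteq> 0"
begin

definition FX :: "4 \<Rightarrow> 4 \<Rightarrow> real^4^4" where
  "FX a b = (\<Sum>l\<in>UNIV. \<Sum>j\<in>UNIV. (J $ l $ a * J $ j $ b) *\<^sub>R F l j)"

text \<open>This is g(R(e_a,e_b) e_c, e_d), where the frame vectors e are the columns of
  \<open>J\<close>.\<close>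

definition Rm :: "4 \<Rightarrow> 4 \<Rightarrow> 4 \<Rightarrow> 4 \<Rightarrow> real" where
  "Rm a b c d = (transpose J ** G ** FX a b ** J) $ d $ c"

lemma FX_mul: "FX a b ** M = (\<Sum>l\<in>UNIV. \<Sum>j\<in>UNIV. (J $ l $ a * J $ j $ b) *\<^sub>R (F l j ** M))"
  "M ** FX a b = (\<Sum>l\<in>UNIV. \<Sum>j\<in>UNIV. (J $ l $ a * J $ j $ b) *\<^sub>R (M ** F l j))"
  "transpose (FX a b) = (\<Sum>l\<in>UNIV. \<Sum>j\<in>UNIV. (J $ l $ a * J $ j $ b) *\<^sub>R transpose (F l j))"
  by (simp_all only: FX_def sum4 matrix_mul_distrib transpose_simps)

lemma FX_antisym: "FX b a = - FX a b"
proof -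
  have "FX b a = (\<Sum>j\<in>UNIV. \<Sum>l\<in>UNIV. (J $ l $ b * J $ j $ a) *\<^sub>R F l j)"
    unfolding FX_def by (rule sum.swap)
  also have "\<dots> = - FX a b"
    unfolding FX_def sum_negf[symmetric] by (intro sum.cong refl, subst antisym) simp
  finally show ?thesis .
qed

lemma FX_commute: "FX a b ** P = P ** FX a b"
  by (simp add: FX_mul commute)

lemma FX_metric: "transpose (FX a b) ** G + G ** FX a b = 0"
proof -
  have "transpose (FX a b) ** G = (\<Sum>l\<in>UNIV. \<Sum>j\<in>UNIV. (J $ l $ a * J $ j $ b) *\<^sub>R (transpose (F l j) ** G))"
    by (simp only: FX_mul(3) sum4 matrix_mul_distrib)
  then have "transpose (FX a b) ** G + G ** FX a b
      = (\<Sum>l\<in>UNIV. \<Sum>j\<in>UNIV. (J $ l $ a * J $ j $ b) *\<^sub>R (transpose (F l j) ** G + G ** F l j))"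
    by (simp add: FX_mul(2) sum.distrib scaleR_add_right)
  then show ?thesis by (simp add: metric)
qed

lemma Rm_antisym: "Rm b a c d = - Rm a b c d" "Rm a b d c = - Rm a b c d"
proof -
  show "Rm b a c d = - Rm a b c d"
    by (simp only: Rm_def FX_antisym[of b a] matrix_mul_distrib vector_uminus_component)
  have "transpose (transpose J ** G ** FX a b ** J) = transpose J ** (transpose (FX a b) ** G) ** J"
    by (simp add: matrix_algebra G)
  also have "\<dots> = - (transpose J ** G ** FX a b ** J)"
    using FX_metric[of a b] by (simp add: eq_neg_iff_add_eq_0[symmetric] matrix_algebra)
  finally have "transpose (transpose J ** G ** FX a b ** J) $ d $ c
      = (- (transpose J ** G ** FX a b ** J)) $ d $ c" by (rule arg_cong)
  then show "Rm a b d c = - Rm a b c d"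
    unfolding Rm_def transpose_def[of "transpose J ** G ** FX a b ** J"] by simp
qed

lemma FX_J: "(FX a b ** J) $ k $ c = (\<Sum>l\<in>UNIV. \<Sum>j\<in>UNIV. \<Sum>i\<in>UNIV. J $ l $ a * J $ j $ b * J $ i $ c * F l j $ k $ i)"
proof -
  have "(FX a b ** J) $ k $ c = (\<Sum>l\<in>UNIV. \<Sum>j\<in>UNIV. J $ l $ a * J $ j $ b * (F l j ** J) $ k $ c)"
    unfolding FX_mul(1) by simp
  then show ?thesis by (simp add: matrix_matrix_mult_def sum_distrib_left mult_ac)
qed

lemma FX_bianchi: "(FX a b ** J) $ k $ c + (FX b c ** J) $ k $ a + (FX c a ** J) $ k $ b = 0"
proof -
  let ?S = "\<lambda>f. \<Sum>l\<in>UNIV. \<Sum>j\<in>UNIV. \<Sum>i\<in>UNIV. J $ l $ a * J $ j $ b * J $ i $ c * f l j i"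
  have "(FX b c ** J) $ k $ a = (\<Sum>j\<in>UNIV. \<Sum>i\<in>UNIV. \<Sum>l\<in>UNIV. J $ l $ a * J $ j $ b * J $ i $ c * F j i $ k $ l)"
    unfolding FX_J by (simp add: mult_ac)
  also have "\<dots> = (\<Sum>j\<in>UNIV. \<Sum>l\<in>UNIV. \<Sum>i\<in>UNIV. J $ l $ a * J $ j $ b * J $ i $ c * F j i $ k $ l)"
    by (intro sum.cong refl sum.swap)
  also have "\<dots> = ?S (\<lambda>l j i. F j i $ k $ l)" by (rule sum.swap)
  finally have 1: "(FX b c ** J) $ k $ a = ?S (\<lambda>l j i. F j i $ k $ l)" .
  have "(FX c a ** J) $ k $ b = (\<Sum>i\<in>UNIV. \<Sum>l\<in>UNIV. \<Sum>j\<in>UNIV. J $ l $ a * J $ j $ b * J $ i $ c * F i l $ k $ j)"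
    unfolding FX_J by (simp add: mult_ac)
  also have "\<dots> = (\<Sum>l\<in>UNIV. \<Sum>i\<in>UNIV. \<Sum>j\<in>UNIV. J $ l $ a * J $ j $ b * J $ i $ c * F i l $ k $ j)"
    by (rule sum.swap)
  also have "\<dots> = ?S (\<lambda>l j i. F i l $ k $ j)" by (intro sum.cong refl sum.swap)
  finally have 2: "(FX c a ** J) $ k $ b = ?S (\<lambda>l j i. F i l $ k $ j)" .
  have "(FX a b ** J) $ k $ c + (FX b c ** J) $ k $ a + (FX c a ** J) $ k $ b
      = ?S (\<lambda>l j i. F l j $ k $ i + F j i $ k $ l + F i l $ k $ j)"
    by (simp only: 1 2 FX_J[of a b k c] sum.distrib distrib_left)
  then show ?thesis by (simp add: bianchi)
qed

lemma Rm_bianchi: "Rm a b c d + Rm b c a d + Rm c a b d = 0"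
proof -
  have r: "Rm a b c d = (\<Sum>k\<in>UNIV. (transpose J ** G) $ d $ k * (FX a b ** J) $ k $ c)" for a b c
    unfolding Rm_def matrix_mul_assoc[symmetric, of _ "FX a b"] by (simp add: matrix_matrix_mult_def[of "transpose J ** G"])
  have "Rm a b c d + Rm b c a d + Rm c a b d = (\<Sum>k\<in>UNIV. (transpose J ** G) $ d $ k *
      ((FX a b ** J) $ k $ c + (FX b c ** J) $ k $ a + (FX c a ** J) $ k $ b))"
    unfolding r by (simp only: sum.distrib distrib_left)
  then show ?thesis by (simp only: FX_bianchi mult_zero_right sum.neutral_const)
qed

text \<open>The classical linear combination of four cyclic identities and the two
  antisymmetries.\<close>

lemma Rm_pair: "Rm a b c d = Rm c d a b"
  using Rm_bianchi[of a b c d] Rm_bianchi[of b c d a] Rm_bianchi[of c d a b] Rm_bianchi[of d a b c]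
    Rm_antisym(1)[of a b c d] Rm_antisym(2)[of a b c d]
    Rm_antisym(2)[of b c a d] Rm_antisym(2)[of c a b d] Rm_antisym(2)[of c d a b]
    Rm_antisym(2)[of d b c a] Rm_antisym(2)[of d a b c] Rm_antisym(2)[of b d c a] Rm_antisym(2)[of a c d b]
    Rm_antisym(1)[of a c d b] Rm_antisym(1)[of b d c a] Rm_antisym(1)[of d b c a]  Rm_antisym(1)[of a c b d]
    Rm_antisym(1)[of c d a b]  Rm_antisym(1)[of b c d a] Rm_antisym(1)[of d a b c] Rm_antisym(2)[of b d a c]
    Rm_antisym(1)[of b d a c]
  by linarith

lemma J_sig: "transpose J ** G ** P = sig ** transpose J ** G"
  by (rule frame_sig[OF J PJ GJ])

text \<open>The curvature commutes with \<open>P\<close> and so preserves the eigenspaces, which are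
  orthogonal. Pair symmetry transfers the vanishing from the last two to the first two
  arguments.\<close>

lemma Rm_mixed:
  assumes "c \<in> {0, 1} \<longleftrightarrow> d \<notin> {0, 1}"
  shows "Rm a b c d = 0" "Rm c d a b = 0"
proof -
  let ?H = "transpose J ** G ** FX a b ** J"
  have "?H ** sig = transpose J ** G ** (FX a b ** P) ** J"
    by (simp add: PJ matrix_mul_assoc[symmetric])
  also have "\<dots> = sig ** ?H"
    unfolding FX_commute by (simp add: matrix_mul_assoc J_sig)
  finally have "(?H ** sig) $ d $ c = (sig ** ?H) $ d $ c" by simp
  then have "?H $ d $ c = 0"
    unfolding mul_sig_entry using assms by (auto split: if_splits)
  then show "Rm a b c d = 0" by (simp only: Rm_def)
  then show "Rm c d a b = 0" using Rm_pair[of a b c d] by simp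
qed

definition Ri :: "real^4^4" where
  "Ri = (\<chi> i j. \<Sum>k\<in>UNIV. F k j $ k $ i)"

text \<open>A trace can be taken in any basis; \<open>Gi\<close> is the inverse frame metric and
  raises the contracted index.\<close>

lemma Ri_frame:
  assumes "transpose J ** G ** J ** Gi = mat 1"
  shows "(transpose J ** Ri ** J) $ c $ b = (\<Sum>a\<in>UNIV. \<Sum>d\<in>UNIV. Gi $ a $ d * Rm a b c d)"
proof -
  \<comment> \<open>\<open>K\<close> is the inverse of \<open>J\<close>, written through the metric
    so that the contraction meets \<open>Rm\<close>.\<close>
  define K where "K = Gi ** transpose J ** G"
  have "K ** J = mat 1"
    using assms matrix_left_right_inverse[of "transpose J ** G ** J" Gi] by (simp add: K_def matrix_mul_assoc)
  then have JK: "J ** K = mat 1" using matrix_left_right_inverse by blast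
  have JK': "(\<Sum>a\<in>UNIV. J $ l $ a * K $ a $ k) = (if l = k then 1 else 0)" for l k
    using JK by (simp add: matrix_matrix_mult_def vec_eq_iff mat_def)
  define w where "w l k = (\<Sum>j\<in>UNIV. \<Sum>i\<in>UNIV. J $ j $ b * J $ i $ c * F l j $ k $ i)" for l k
  have "(\<Sum>a\<in>UNIV. \<Sum>d\<in>UNIV. Gi $ a $ d * Rm a b c d) = (\<Sum>a\<in>UNIV. (Gi ** (transpose J ** G ** FX a b ** J)) $ a $ c)"
    by (simp add: Rm_def matrix_matrix_mult_def[of Gi])
  also have "\<dots> = (\<Sum>a\<in>UNIV. (K ** (FX a b ** J)) $ a $ c)"
    by (simp add: K_def matrix_mul_assoc)
  also have "\<dots> = (\<Sum>a\<in>UNIV. \<Sum>k\<in>UNIV. K $ a $ k * (FX a b ** J) $ k $ c)"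
    by (simp add: matrix_matrix_mult_def[of K])
  also have "\<dots> = (\<Sum>a\<in>UNIV. \<Sum>k\<in>UNIV. \<Sum>l\<in>UNIV. J $ l $ a * K $ a $ k * w l k)"
    unfolding FX_J w_def by (simp add: sum_distrib_left mult_ac)
  also have "\<dots> = (\<Sum>k\<in>UNIV. \<Sum>a\<in>UNIV. \<Sum>l\<in>UNIV. J $ l $ a * K $ a $ k * w l k)"
    by (rule sum.swap)
  also have "\<dots> = (\<Sum>k\<in>UNIV. \<Sum>l\<in>UNIV. \<Sum>a\<in>UNIV. J $ l $ a * K $ a $ k * w l k)"
    by (intro sum.cong refl sum.swap)
  also have "\<dots> = (\<Sum>k\<in>UNIV. w k k)"
    by (simp add: sum_distrib_right[symmetric] JK' if_distrib[where f="\<lambda>x. x * _"] cong: if_cong)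
  also have "\<dots> = (\<Sum>j\<in>UNIV. \<Sum>k\<in>UNIV. \<Sum>i\<in>UNIV. J $ j $ b * J $ i $ c * F k j $ k $ i)"
    unfolding w_def by (rule sum.swap)
  also have "\<dots> = (\<Sum>j\<in>UNIV. \<Sum>i\<in>UNIV. \<Sum>k\<in>UNIV. J $ j $ b * J $ i $ c * F k j $ k $ i)"
    by (intro sum.cong refl sum.swap)
  also have "\<dots> = (transpose J ** Ri ** J) $ c $ b"
    by (simp add: matrix_matrix_mult_def transpose_def Ri_def sum_distrib_left sum_distrib_right mult_ac)
  finally show ?thesis ..
qed

text \<open>Each plane keeps a single curvature component, and its contraction with the inverse 2x2
  metric is a multiple of that metric, as in dimension two. The factors \<open>K1\<close> and
  \<open>K2\<close> are the sectional curvatures of the two planes.\<close>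

theorem Ri_block: "\<exists>K1 K2. transpose J ** Ri ** J = block (K1 *\<^sub>R A) (K2 *\<^sub>R B)"
proof -
  let ?Gi = "block ((1 / det A) *\<^sub>R adj2 A) ((1 / det B) *\<^sub>R adj2 B)"
  have "transpose J ** G ** J ** ?Gi = mat 1" by (simp add: GJ block_inverse det)
  note R = Ri_frame[OF this]
  have z: "Rm a a c d = 0" "Rm a b c c = 0" for a b c d
    using Rm_antisym(1)[of a a c d] Rm_antisym(2)[of a b c c] by auto
  have A: "A $ 0 $ 1 = A $ 1 $ 0" "B $ 0 $ 1 = B $ 1 $ 0"
  proof -
    have "transpose (block A B) = block A B"
      unfolding GJ[symmetric] by (simp add: transpose_simps G matrix_mul_assoc)
    then have "block (transpose A) (transpose B) $ i $ j = block A B $ i $ j" for i j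
      by (simp add: block_arith)
    from this[of 0 1] this[of 2 3] show "A $ 0 $ 1 = A $ 1 $ 0" "B $ 0 $ 1 = B $ 1 $ 0"
      by (simp_all add: block_entry lo_hi transpose_def)
  qed
  have m: "Rm a b c d = 0" if "c \<in> {0, 1} \<and> d \<in> {2, 3} \<or> c \<in> {2, 3} \<and> d \<in> {0, 1}
      \<or> a \<in> {0, 1} \<and> b \<in> {2, 3} \<or> a \<in> {2, 3} \<and> b \<in> {0, 1}" for a b c d
    using that Rm_mixed(1)[of c d a b] Rm_mixed(2)[of a b c d] by auto
  have swap: "Rm 0 1 c d = - Rm 1 0 c d" "Rm 2 3 c d = - Rm 3 2 c d"
    "Rm a b 1 0 = - Rm a b 0 1" "Rm a b 3 2 = - Rm a b 2 3" for a b c d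
    by (rule Rm_antisym)+
  have "\<forall>c b. (transpose J ** Ri ** J) $ c $ b
      = block ((Rm 1 0 0 1 / det A) *\<^sub>R A) ((Rm 3 2 2 3 / det B) *\<^sub>R B) $ c $ b"
    by (simp add: all4 R sum4 block_entry lo_hi adj2_def m z A swap)
  then have "transpose J ** Ri ** J = block ((Rm 1 0 0 1 / det A) *\<^sub>R A) ((Rm 3 2 2 3 / det B) *\<^sub>R B)"
    by (simp add: vec_eq_iff)
  then show ?thesis by blast
qed

end

section \<open>The trace-free Ricci tensor of a parallel splitting\<close>

lemma adj2_mul_left: "adj2 A ** A = det A *\<^sub>R mat 1"
  by (simp add: vec_eq_iff all2 matrix_matrix_mult_def sum2 adj2_def mat_def det2 mult.commute)

lemma Nup_matrix: "Nup g a b x = (ginv g x ** Nmat g x) $ a $ b"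
  by (simp add: Nup_def matrix_matrix_mult_def Nmat_def)

lemma Nsq_matrix: "Nsq g a b x = (ginv g x ** Nmat g x ** (ginv g x ** Nmat g x)) $ a $ b"
  by (simp add: Nsq_def Nup_matrix matrix_matrix_mult_def[of "ginv g x ** Nmat g x"])

lemma nablaN_matrix:
  "nablaN g l a b x = (mpartial l (Nmat g) x - transpose (Gam g l x) ** Nmat g x - Nmat g x ** Gam g l x) $ a $ b"
  by (simp add: nablaN_def mpartial_def Nmat_def Gam_def matrix_matrix_mult_def transpose_def
      sum.distrib mult.commute)

lemma Nmat_matrix: "Nmat g x = Ricm g x - (scal g x / 4) *\<^sub>R g x"
  by (simp add: vec_eq_iff Nmat_def TFRic_def Ricm_def)

lemma pullback_jac: "pullback_at T \<phi> y = transpose (jac \<phi> y) ** T ** jac \<phi> y"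
proof -
  have "(\<Sum>i\<in>UNIV. \<Sum>j\<in>UNIV. partial a (\<lambda>z. \<phi> z $ i) y * partial b (\<lambda>z. \<phi> z $ j) y * T $ i $ j)
    = (\<Sum>j\<in>UNIV. \<Sum>i\<in>UNIV. partial a (\<lambda>z. \<phi> z $ i) y * T $ i $ j * partial b (\<lambda>z. \<phi> z $ j) y)" for a b
    by (subst sum.swap) (simp add: mult_ac)
  then show ?thesis
    by (simp add: vec_eq_iff pullback_at_def jac_def matrix_matrix_mult_def transpose_def sum_distrib_right)
qed

lemma partial_zero_if_independent:
  assumes "open W" "y \<in> W" "f differentiable (at y)"
    and "\<And>y'. y' \<in> W \<Longrightarrow> (\<And>i. i \<noteq> c \<Longrightarrow> y' $ i = y $ i) \<Longrightarrow> f y' = f y"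
  shows "partial c f y = 0"
proof -
  let ?l = "\<lambda>s. y + s *\<^sub>R axis c (1::real)"
  have op: "open (?l -` W)"
    by (intro open_vimage assms continuous_intros)
  have "((\<lambda>s. f (?l s)) has_real_derivative partial c f (?l 0)) (at 0)"
    by (rule has_real_derivative_line) (use assms(3) in simp)
  moreover have "((\<lambda>s. f (?l s)) has_real_derivative 0) (at 0)"
  proof (rule has_field_derivative_transform_within_open[OF DERIV_const op])
    show "f y = f (?l s)" if "s \<in> ?l -` W" for s
      using that by (intro assms(4)[symmetric]) (auto simp: axis_def)
  qed (use assms in simp)
  ultimately show ?thesis using DERIV_unique by force
qed

context
  fixes U g
  assumes st: "spacetime U g"
begin

lemma scal_trace:
  assumes "x \<in> U"
  shows "scal g x = trace (ginv g x ** Ricm g x)"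
  unfolding scal_def trace_def matrix_matrix_mult_def Ricm_def vec_lambda_beta
  by (intro sum.cong refl arg_cong2[where f="(*)"] Ric_sym[OF st assms])

text \<open>Ricci is K1 times the metric on one block and K2 times it on the other, with trace 2 K1
  + 2 K2. Subtracting a quarter of the trace leaves (K1 - K2) / 2 times the metric on the first
  block and the negative of that multiple on the second.\<close>

lemma Nmat_in_frame:
  assumes "open V" "V \<subseteq> U" "smooth_matrix V P" "parallel_on V g P" "x \<in> V"
    and Jf: "invertible J" "P x ** J = J ** sig" "transpose J ** g x ** J = block A B"
    and det: "det A \<noteq> 0" "det B \<noteq> 0"
  shows "\<exists>c. Nmat g x = c *\<^sub>R (g x ** P x)"
proof -
  have x: "x \<in> U" using assms by blast
  interpret product_frame "\<lambda>l j. Curv g l j x" "g x" "P x" J A B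
    by (unfold_locales, rule Curv_antisym[OF st], rule Curv_bianchi[OF st x], rule Curv_metric[OF st x],
      rule Curv_commute[OF st assms(1-5)], fact Jf(1), fact Jf(2), fact Jf(3), rule g_sym[OF st x], fact det(1), fact det(2))
  have Ri: "Ri = Ricm g x" by (simp add: Ri_def Ricm_def Ric_Curv[OF st x])
  obtain K1 K2 where K: "transpose J ** Ricm g x ** J = block (K1 *\<^sub>R A) (K2 *\<^sub>R B)"
    using Ri_block unfolding Ri by blast
  let ?Gi = "block ((1 / det A) *\<^sub>R adj2 A) ((1 / det B) *\<^sub>R adj2 B)"
  \<comment> \<open>This reads the inverse metric off the frame: it is the inverse frame metric
    transported by \<open>J\<close>.\<close>
  have "transpose J ** (g x ** J ** ?Gi) = mat 1"
    using block_inverse[OF det] by (simp add: Jf(3)[symmetric] matrix_mul_assoc)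
  then have "g x ** J ** ?Gi ** transpose J = mat 1" using matrix_left_right_inverse by blast
  then have gi: "ginv g x = J ** ?Gi ** transpose J"
    unfolding ginv_def by (intro matrix_inv_unique[symmetric]) (simp add: matrix_mul_assoc)
  have "scal g x = trace (ginv g x ** Ricm g x)" by (rule scal_trace[OF x])
  also have "\<dots> = trace (J ** (?Gi ** transpose J ** Ricm g x))" by (simp add: gi matrix_mul_assoc)
  also have "\<dots> = trace (?Gi ** (transpose J ** Ricm g x ** J))"
    by (subst trace_mul_sym) (simp add: matrix_mul_assoc)
  also have "\<dots> = 2 * K1 + 2 * K2"
    using det by (simp add: K block_mul trace_block matrix_mul_distrib adj2_mul_left)
      (simp add: trace_def sum2 mat_def)
  finally have s: "scal g x = 2 * K1 + 2 * K2" .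
  have "transpose J ** Nmat g x ** J = transpose J ** (((K1 - K2) / 2) *\<^sub>R (g x ** P x)) ** J"
  proof -
    have "transpose J ** Nmat g x ** J = block (K1 *\<^sub>R A) (K2 *\<^sub>R B) - (scal g x / 4) *\<^sub>R block A B"
      by (simp add: Nmat_matrix matrix_mul_distrib K Jf(3))
    also have "\<dots> = ((K1 - K2) / 2) *\<^sub>R (block A B ** sig)"
      by (simp add: s sig_block block_mul block_arith matrix_mul_distrib)
        (simp add: vec_eq_iff field_simps block_entry)
    also have "\<dots> = transpose J ** (((K1 - K2) / 2) *\<^sub>R (g x ** P x)) ** J"
      unfolding Jf(3)[symmetric] by (simp add: matrix_mul_distrib) (metis Jf(2) matrix_mul_assoc)
    finally show ?thesis .
  qed
  then show ?thesis
    using matrix_cancel_left[OF transpose_invertible[OF Jf(1)]] matrix_cancel_right[OF Jf(1)] by blast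
qed

lemma
  assumes x: "x \<in> U" and PP: "P ** P = mat 1" and N: "Nmat g x = c *\<^sub>R (g x ** P)"
  shows Nsq_projector: "Nsq g a b x = c\<^sup>2 * (if a = b then 1 else 0)"
    and trNsq_projector: "trNsq g x = 4 * c\<^sup>2"
proof -
  have up: "ginv g x ** Nmat g x = c *\<^sub>R P"
    using g_ginv(2)[OF st x] by (simp add: N matrix_mul_distrib matrix_mul_assoc)
  show sq: "Nsq g a b x = c\<^sup>2 * (if a = b then 1 else 0)" for a b
    by (simp add: Nsq_matrix up matrix_mul_distrib PP mat_def power2_eq_square)
  show "trNsq g x = 4 * c\<^sup>2"
    by (simp add: trNsq_def sq)
qed

text \<open>If N = c g P with P parallel, then nabla N is dc times g P, i.e. (dc / c) times N, and
  dc / c is half of d ln (4 c^2), where 4 c^2 = tr N^2.\<close>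

lemma product_conditions_from_parallel:
  assumes "open V" "V \<subseteq> U" "smooth_matrix V P" "parallel_on V g P"
    and PP: "\<And>x. x \<in> V \<Longrightarrow> P x ** P x = mat 1"
    and N: "\<And>x. x \<in> V \<Longrightarrow> \<exists>c. Nmat g x = c *\<^sub>R (g x ** P x)"
    and N0: "\<And>x. x \<in> V \<Longrightarrow> Nmat g x \<noteq> 0" and x: "x \<in> V"
  shows "product_conditions g x"
proof -
  \<comment> \<open>The hypothesis \<open>N\<close> gives the factor only point by point; written as
    a trace it is visibly smooth and can be differentiated.\<close>
  define c where "c x = trace (ginv g x ** Nmat g x ** P x) / 4" for x
  have xU: "x \<in> U" if "x \<in> V" for x using that assms(2) by blast
  have Nc: "Nmat g x = c x *\<^sub>R (g x ** P x)" if "x \<in> V" for x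
  proof -
    obtain k where k: "Nmat g x = k *\<^sub>R (g x ** P x)" using N[OF \<open>x \<in> V\<close>] by blast
    have "ginv g x ** Nmat g x ** P x = k *\<^sub>R mat 1"
      using g_ginv(2)[OF st xU[OF that]] PP[OF that]
      by (simp add: k matrix_mul_distrib matrix_mul_assoc)
    then have "c x = k" by (simp add: c_def trace_def sum4 mat_def)
    with k show ?thesis by simp
  qed
  have c0: "c x \<noteq> 0" if "x \<in> V" for x using Nc[OF that] N0[OF that] by auto
  have sq: "Nsq g a b x = (c x)\<^sup>2 * (if a = b then 1 else 0)" if "x \<in> V" for a b x
    by (rule Nsq_projector[OF xU[OF that] PP[OF that] Nc[OF that]])
  have tr: "trNsq g x = 4 * (c x)\<^sup>2" if "x \<in> V" for x
    by (rule trNsq_projector[OF xU[OF that] PP[OF that] Nc[OF that]])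
  note gV = smooth_matrix_subset[OF g_smooth[OF st] assms(2)]
  have "smooth_matrix V (\<lambda>x. ginv g x ** Nmat g x ** P x)"
    by (intro smooth_matrix_mul assms(1,3) smooth_matrix_subset[OF ginv_smooth[OF st] assms(2)]
        smooth_matrix_subset[OF Nmat_smooth[OF st] assms(2)])
  then have cs: "smooth_on V c"
    unfolding c_def[abs_def] trace_def divide_inverse smooth_matrix_def
    by (intro smooth_on_mult smooth_on_sum smooth_on_const assms(1)) auto
  have cd: "c differentiable (at x)" by (rule smooth_on_differentiable[OF cs x])
  have gd: "(\<lambda>y. g y $ i $ j) differentiable (at x)" for i j by (rule smooth_matrix_differentiable[OF gV x])
  have Pd: "(\<lambda>y. P y $ i $ j) differentiable (at x)" for i j by (rule smooth_matrix_differentiable[OF assms(3) x])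
  have gPd: "(\<lambda>y. (g y ** P y) $ i $ j) differentiable (at x)" for i j
    by (rule smooth_matrix_differentiable[OF smooth_matrix_mul[OF assms(1) gV assms(3)] x])
  have P': "mpartial l P x = P x ** Gam g l x - Gam g l x ** P x" for l
    using assms(4) x by (simp add: parallel_on_def)
  have nab: "nablaN g l a b x = partial l c x * (g x ** P x) $ a $ b" for l a b
  proof -
    have "mpartial l (Nmat g) x = mpartial l (\<lambda>y. c y *\<^sub>R (g y ** P y)) x"
      by (rule mpartial_cong[OF assms(1) x Nc])
    also have "\<dots> = partial l c x *\<^sub>R (g x ** P x) + c x *\<^sub>R (mpartial l g x ** P x + g x ** mpartial l P x)"
      by (simp add: mpartial_scaleR[OF cd gPd] mpartial_mul[OF gd Pd])
    finally show ?thesis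
      unfolding nablaN_matrix Nc[OF x] metric_compatible[OF st xU[OF x]] P'
      by (simp add: matrix_algebra algebra_simps)
  qed
  have ln: "partial l (\<lambda>y. ln (trNsq g y)) x = 2 * partial l c x / c x" for l
  proof -
    have "partial l (\<lambda>y. ln (trNsq g y)) x = partial l (\<lambda>y. ln (4 * (c y * c y))) x"
      by (rule partial_cong[OF assms(1) x]) (simp add: tr power2_eq_square)
    also have "\<dots> = partial l (\<lambda>y. 4 * (c y * c y)) x / (4 * (c x * c x))"
      using c0[OF x] cd by (intro partial_ln) (auto intro!: differentiable_mult simp: zero_less_mult_iff)
    also have "\<dots> = 2 * partial l c x / c x"
      using c0[OF x] cd by (simp add: partial_mult differentiable_mult field_simps)
    finally show ?thesis .
  qed
  have "TFRic g a b x = c x * (g x ** P x) $ a $ b" for a b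
    using Nc[OF x] by (simp add: vec_eq_iff Nmat_def)
  then show ?thesis
    using c0[OF x] by (auto simp: product_conditions_def tr[OF x] sq[OF x] nab ln)
qed

end

text \<open>Covariant derivatives of the coordinate frame of a map into the spacetime: column \<^term>\<open>a\<close> of
  the matrix \<open>cov_frame g \<phi> c y\<close> is the derivative of the \<^term>\<open>a\<close>-th coordinate field along the
  \<^term>\<open>c\<close>-th one.\<close>

definition Gam_along :: "(real^4 \<Rightarrow> real^4^4) \<Rightarrow> (real^4 \<Rightarrow> real^4) \<Rightarrow> 4 \<Rightarrow> real^4 \<Rightarrow> real^4^4" where
  "Gam_along g \<phi> c y = (\<Sum>l\<in>UNIV. jac \<phi> y $ l $ c *\<^sub>R Gam g l (\<phi> y))"

definition cov_frame :: "(real^4 \<Rightarrow> real^4^4) \<Rightarrow> (real^4 \<Rightarrow> real^4) \<Rightarrow> 4 \<Rightarrow> real^4 \<Rightarrow> real^4^4" where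
  "cov_frame g \<phi> c y = mpartial c (jac \<phi>) y + Gam_along g \<phi> c y ** jac \<phi> y"

lemma mpartial_compose:
  assumes "\<And>i j. (\<lambda>x. T x $ i $ j) differentiable (at (\<phi> y))" "\<And>i. (\<lambda>y. \<phi> y $ i) differentiable (at y)"
  shows "mpartial c (\<lambda>y. T (\<phi> y)) y = (\<Sum>l\<in>UNIV. jac \<phi> y $ l $ c *\<^sub>R mpartial l T (\<phi> y))"
  by (simp add: vec_eq_iff mpartial_def jac_def partial_compose[OF assms(1,2)])

text \<open>Invertibility of \<open>\<phi>\<close> is left open, so that charts and the leaf map,
  whose Jacobian may be singular, are covered alike.\<close>

locale chart_map =
  fixes U g W \<phi>
  assumes st: "spacetime U g" and W: "open W" and \<phi>W: "\<phi> ` W \<subseteq> U" and \<phi>: "smooth_map W \<phi>"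
begin

lemma jac_d: "y \<in> W \<Longrightarrow> (\<lambda>y. jac \<phi> y $ i $ j) differentiable (at y)"
  by (rule smooth_matrix_differentiable[OF smooth_matrix_jac[OF \<phi>]])

lemma \<phi>_d: "y \<in> W \<Longrightarrow> (\<lambda>y. \<phi> y $ i) differentiable (at y)"
  by (rule smooth_map_differentiable[OF \<phi>])

lemma \<phi>U: "y \<in> W \<Longrightarrow> \<phi> y \<in> U" using \<phi>W by blast

text \<open>Coordinate fields commute and the connection has no torsion.\<close>

lemma cov_frame_sym:
  assumes "y \<in> W"
  shows "cov_frame g \<phi> c y $ k $ a = cov_frame g \<phi> a y $ k $ c"
proof -
  have "mpartial c (jac \<phi>) y $ k $ a = mpartial a (jac \<phi>) y $ k $ c"
    unfolding mpartial_def jac_def vec_lambda_beta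
    by (rule smooth_on_partial_commute[OF W _ assms]) (use \<phi> in \<open>simp add: smooth_map_def\<close>)
  moreover have "(Gam_along g \<phi> c y ** jac \<phi> y) $ k $ a = (Gam_along g \<phi> a y ** jac \<phi> y) $ k $ c"
  proof -
    have e: "(Gam_along g \<phi> c y ** jac \<phi> y) $ k $ a
        = (\<Sum>i\<in>UNIV. \<Sum>l\<in>UNIV. jac \<phi> y $ l $ c * jac \<phi> y $ i $ a * Chr g k l i (\<phi> y))" for a c
      by (simp add: Gam_along_def matrix_matrix_mult_def Gam_def sum_distrib_left sum_distrib_right mult_ac)
    show ?thesis
      unfolding e by (subst sum.swap, intro sum.cong refl) (simp add: Chr_sym[OF st \<phi>U[OF assms], of k])
  qed
  ultimately show ?thesis by (simp add: cov_frame_def)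
qed

lemma frame_metric_derivative:
  assumes "y \<in> W"
  shows "mpartial c (\<lambda>y. transpose (jac \<phi> y) ** g (\<phi> y) ** jac \<phi> y) y
    = transpose (transpose (jac \<phi> y) ** g (\<phi> y) ** cov_frame g \<phi> c y)
      + transpose (jac \<phi> y) ** g (\<phi> y) ** cov_frame g \<phi> c y"
proof -
  note gd = smooth_matrix_differentiable[OF g_smooth[OF st] \<phi>U[OF assms]]
  have gd': "(\<lambda>y. g (\<phi> y) $ i $ j) differentiable (at y)" for i j
    by (rule differentiable_compose_vec[OF gd \<phi>_d[OF assms]])
  have Jt: "(\<lambda>y. transpose (jac \<phi> y) $ i $ j) differentiable (at y)" for i j
    using jac_d[OF assms] by (simp add: transpose_def)
  have Jg: "(\<lambda>y. (transpose (jac \<phi> y) ** g (\<phi> y)) $ i $ j) differentiable (at y)" for i j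
    unfolding matrix_matrix_mult_def using Jt gd'
    by (auto intro!: differentiable_sum differentiable_mult)
  have "mpartial c (\<lambda>y. g (\<phi> y)) y = (\<Sum>l\<in>UNIV. jac \<phi> y $ l $ c *\<^sub>R mpartial l g (\<phi> y))"
    by (rule mpartial_compose[OF gd \<phi>_d[OF assms]])
  also have "\<dots> = transpose (Gam_along g \<phi> c y) ** g (\<phi> y) + g (\<phi> y) ** Gam_along g \<phi> c y"
    by (simp add: metric_compatible[OF st \<phi>U[OF assms]] Gam_along_def sum4 matrix_mul_distrib
        transpose_simps algebra_simps)
  finally have dg: "mpartial c (\<lambda>y. g (\<phi> y)) y
      = transpose (Gam_along g \<phi> c y) ** g (\<phi> y) + g (\<phi> y) ** Gam_along g \<phi> c y" .
  show ?thesis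
    unfolding mpartial_mul[OF Jg jac_d[OF assms]] mpartial_mul[OF Jt gd'] mpartial_transpose dg cov_frame_def
    by (simp add: matrix_algebra g_sym[OF st \<phi>U[OF assms]] algebra_simps)
qed

text \<open>\<open>L c\<close> collects the inner products of the coordinate fields with their
  derivatives along the field \<open>c\<close>; the third equation is the Koszul formula for
  commuting fields.\<close>

lemma koszul:
  assumes "y \<in> W"
  defines "L \<equiv> \<lambda>c. transpose (jac \<phi> y) ** g (\<phi> y) ** cov_frame g \<phi> c y"
    and "dG \<equiv> \<lambda>c. mpartial c (\<lambda>y. transpose (jac \<phi> y) ** g (\<phi> y) ** jac \<phi> y) y"
  shows "dG c $ a $ b = L c $ b $ a + L c $ a $ b" "L c $ b $ a = L a $ b $ c"
    "L c $ b $ a = (dG c $ a $ b + dG a $ c $ b - dG b $ c $ a) / 2"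
proof -
  show 1: "dG c $ a $ b = L c $ b $ a + L c $ a $ b" for a b c
    unfolding dG_def L_def frame_metric_derivative[OF assms(1)]
    by (simp add: transpose_def[of "_ ** _"])
  show 2: "L c $ b $ a = L a $ b $ c" for a b c
    unfolding L_def matrix_matrix_mult_def[of "transpose (jac \<phi> y) ** g (\<phi> y)"]
    by (simp add: cov_frame_sym[OF assms(1), of c _ a])
  show "L c $ b $ a = (dG c $ a $ b + dG a $ c $ b - dG b $ c $ a) / 2"
    unfolding 1 using 2[of c a b] 2[of a c b] 2[of b c a] 2[of c b a] 2[of a b c] by simp
qed

text \<open>Obtained by differentiating \<open>PJ\<close>. The left side is the covariant derivative
  of \<open>P\<close> on the frame, so for an invertible Jacobian \<open>P\<close> is parallel
  exactly when derivatives of coordinate fields stay in their eigenspace. Both directions of the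
  theorem use this.\<close>

lemma frame_projector_derivative:
  assumes "y \<in> W" "open V" "\<phi> ` W \<subseteq> V" "smooth_matrix V P"
    and PJ: "\<And>y. y \<in> W \<Longrightarrow> P (\<phi> y) ** jac \<phi> y = jac \<phi> y ** sig"
  shows "(\<Sum>l\<in>UNIV. jac \<phi> y $ l $ c *\<^sub>R (mpartial l P (\<phi> y) + Gam g l (\<phi> y) ** P (\<phi> y) - P (\<phi> y) ** Gam g l (\<phi> y)))
      ** jac \<phi> y = cov_frame g \<phi> c y ** sig - P (\<phi> y) ** cov_frame g \<phi> c y"
proof -
  have yV: "\<phi> y \<in> V" using assms(1,3) by blast
  note Pd = smooth_matrix_differentiable[OF assms(4) yV]
  have Pd': "(\<lambda>y. P (\<phi> y) $ i $ j) differentiable (at y)" for i j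
    by (rule differentiable_compose_vec[OF Pd \<phi>_d[OF assms(1)]])
  have "mpartial c (\<lambda>y. P (\<phi> y) ** jac \<phi> y) y = mpartial c (\<lambda>y. jac \<phi> y ** sig) y"
    by (rule mpartial_cong[OF W assms(1) PJ])
  then have *: "(\<Sum>l\<in>UNIV. jac \<phi> y $ l $ c *\<^sub>R mpartial l P (\<phi> y)) ** jac \<phi> y + P (\<phi> y) ** mpartial c (jac \<phi>) y
      = mpartial c (jac \<phi>) y ** sig"
    by (simp add: mpartial_mul[OF Pd' jac_d[OF assms(1)]] mpartial_compose[OF Pd \<phi>_d[OF assms(1)]]
        mpartial_mul[OF jac_d[OF assms(1)], of "\<lambda>_. sig"])
  have s: "(\<Sum>l\<in>UNIV. jac \<phi> y $ l $ c *\<^sub>R (mpartial l P (\<phi> y) + Gam g l (\<phi> y) ** P (\<phi> y) - P (\<phi> y) ** Gam g l (\<phi> y)))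
      = (\<Sum>l\<in>UNIV. jac \<phi> y $ l $ c *\<^sub>R mpartial l P (\<phi> y)) + Gam_along g \<phi> c y ** P (\<phi> y) - P (\<phi> y) ** Gam_along g \<phi> c y"
    by (simp add: Gam_along_def sum4 matrix_mul_distrib algebra_simps)
  have "Gam_along g \<phi> c y ** P (\<phi> y) ** jac \<phi> y = Gam_along g \<phi> c y ** jac \<phi> y ** sig"
    by (metis PJ[OF assms(1)] matrix_mul_assoc)
  then show ?thesis
    unfolding s using * by (simp add: cov_frame_def matrix_algebra algebra_simps)
qed

end

section \<open>Product charts\<close>

lemma quad_form_entry: "(\<Sum>a\<in>UNIV. \<Sum>b\<in>UNIV. T $ a $ b * v $ a * v $ b) = v \<bullet> (T *v v)"
  for T :: "real^4^4"
  by (simp add: inner_vec_def matrix_vector_mult_def sum_distrib_left mult_ac)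

lemma quad_form_congruence: "(J *v u) \<bullet> (T *v (J *v u)) = u \<bullet> ((transpose J ** T ** J) *v u)"
  for T J :: "real^4^4"
proof -
  have "(u v* transpose J) \<bullet> (T *v (J *v u)) = u \<bullet> (transpose J *v (T *v (J *v u)))"
    by (rule dot_lmul_matrix)
  then show ?thesis
    by (simp only: vector_transpose_matrix matrix_vector_mul_assoc matrix_mul_assoc)
qed

definition vlo :: "real^4 \<Rightarrow> real^2" where "vlo u = (\<chi> i. if i = 0 then u $ 0 else u $ 1)"
definition vhi :: "real^4 \<Rightarrow> real^2" where "vhi u = (\<chi> i. if i = 0 then u $ 2 else u $ 3)"

lemma quad_form_block:
  "u \<bullet> (block A B *v u) = vlo u \<bullet> (A *v vlo u) + vhi u \<bullet> (B *v vhi u)"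
  by (simp add: inner_vec_def matrix_vector_mult_def sum4 sum2 block_entry lo_hi vlo_def vhi_def
      algebra_simps)

lemma det_eta2: "det eta2 = - 1"
  by (simp add: det2 eta2_def)

lemma lorentzian2_det: "lorentzian2 A \<Longrightarrow> det A < 0"
proof -
  assume "lorentzian2 A"
  then obtain P where P: "transpose P ** A ** P = eta2" by (auto simp: lorentzian2_def)
  have "det (transpose P ** A ** P) = (det P)\<^sup>2 * det A"
    by (simp add: det_mul power2_eq_square)
  then have "(det P)\<^sup>2 * det A < 0" using P det_eta2 by simp
  then show "det A < 0" by (simp add: mult_less_0_iff not_less)
qed

lemma sym2_quad:
  fixes A :: "real^2^2"
  assumes "transpose A = A"
  shows "v \<bullet> (A *v v) = A $ 0 $ 0 * (v $ 0)\<^sup>2 + 2 * A $ 0 $ 1 * v $ 0 * v $ 1 + A $ 1 $ 1 * (v $ 1)\<^sup>2"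
proof -
  have "A $ 1 $ 0 = A $ 0 $ 1"
    using arg_cong[OF assms, of "\<lambda>M. M $ 0 $ 1"] by (simp add: transpose_def)
  then show ?thesis
    by (simp add: inner_vec_def matrix_vector_mult_def sum2 power2_eq_square algebra_simps)
qed

lemma riemannian2_det:
  assumes "riemannian2 A"
  shows "0 < A $ 0 $ 0" "0 < det A"
proof -
  have sym: "transpose A = A" and pos: "\<And>v. v \<noteq> 0 \<Longrightarrow> 0 < v \<bullet> (A *v v)"
    using assms by (auto simp: riemannian2_def)
  have A10: "A $ 1 $ 0 = A $ 0 $ 1" using arg_cong[OF sym, of "\<lambda>M. M $ 0 $ 1"] by (simp add: transpose_def)
  define e :: "real^2" where "e = (\<chi> i. if i = 0 then 1 else 0)"
  have "e \<noteq> 0" by (auto simp: e_def vec_eq_iff)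
  from pos[OF this] show A00: "0 < A $ 0 $ 0" by (simp add: sym2_quad[OF sym] e_def)
  \<comment> \<open>Orthogonal to \<open>e\<close> for the form, so that its square is
    \<open>A $ 0 $ 0 * det A\<close>.\<close>
  define v :: "real^2" where "v = (\<chi> i. if i = 0 then - A $ 0 $ 1 else A $ 0 $ 0)"
  have "v \<noteq> 0" using A00 by (auto simp: v_def vec_eq_iff all2)
  from pos[OF this] have "0 < A $ 0 $ 0 * det A"
    by (simp add: sym2_quad[OF sym] v_def det2 A10 power2_eq_square algebra_simps)
  then show "0 < det A" using A00 by (simp add: zero_less_mult_iff)
qed

context
  fixes U g p V \<phi> W vh hh
  assumes st: "spacetime U g" and chart: "product_chart U g p V \<phi> W vh hh"
begin

lemma chart_facts: "open V" "p \<in> V" "V \<subseteq> U" "open W" "\<phi> ` W = V" "smooth_map W \<phi>"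
  and chart_block: "\<And>y. y \<in> W \<Longrightarrow> transpose (jac \<phi> y) ** g (\<phi> y) ** jac \<phi> y = block (vh (y $ 0) (y $ 1)) (hh (y $ 2) (y $ 3))"
  and chart_lor: "\<And>y. y \<in> W \<Longrightarrow> lorentzian2 (vh (y $ 0) (y $ 1))"
  and chart_riem: "\<And>y. y \<in> W \<Longrightarrow> riemannian2 (hh (y $ 2) (y $ 3))"
  using chart unfolding product_chart_def pullback_jac by auto

interpretation chart_map U g W \<phi>
  using chart_facts st by unfold_locales auto

text \<open>\<open>P\<close> is \<open>sig\<close> transported by the chart. When the two blocks are
  mixed, every metric derivative in the Koszul formula vanishes for a product metric, so derivatives
  of coordinate fields stay in their own block.\<close>

lemma product_chart_parallel:
  obtains P where "smooth_matrix V P" "parallel_on V g P" "\<And>x. x \<in> V \<Longrightarrow> P x ** P x = mat 1"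
    "\<And>y. y \<in> W \<Longrightarrow> P (\<phi> y) ** jac \<phi> y = jac \<phi> y ** sig" "\<And>y. y \<in> W \<Longrightarrow> invertible (jac \<phi> y)"
proof -
  obtain \<psi> where \<psi>: "smooth_map V \<psi>" "\<And>y. y \<in> W \<Longrightarrow> \<psi> (\<phi> y) = y" "\<And>x. x \<in> V \<Longrightarrow> \<phi> (\<psi> x) = x"
    using chart unfolding product_chart_def by blast
  have \<psi>W: "\<psi> x \<in> W" if "x \<in> V" for x using that chart_facts(5) \<psi>(2) by force
  have \<phi>V: "\<phi> y \<in> V" if "y \<in> W" for y using that chart_facts(5) by blast
  have JJ: "jac \<psi> (\<phi> y) ** jac \<phi> y = mat 1" if y: "y \<in> W" for y
  proof -
    have "jac \<psi> (\<phi> y) ** jac \<phi> y = jac (\<lambda>y. \<psi> (\<phi> y)) y"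
      by (intro jac_compose[symmetric] smooth_map_differentiable[OF \<psi>(1) \<phi>V[OF y]] \<phi>_d y)
    also have "\<dots> = jac (\<lambda>y. y) y" by (rule jac_cong[OF W y \<psi>(2)])
    finally show ?thesis by (simp add: jac_id)
  qed
  then have JJ': "jac \<phi> y ** jac \<psi> (\<phi> y) = mat 1" if "y \<in> W" for y
    using that matrix_left_right_inverse by blast
  have inv: "invertible (jac \<phi> y)" if "y \<in> W" for y
    using JJ[OF that] invertible_left_inverse by blast
  define P where "P x = jac \<phi> (\<psi> x) ** sig ** jac \<psi> x" for x
  have Ps: "smooth_matrix V P"
    unfolding P_def[abs_def]
    by (intro smooth_matrix_mul chart_facts(1) smooth_matrix_const smooth_matrix_jac[OF \<psi>(1)]
        smooth_matrix_compose[OF W chart_facts(1) _ smooth_matrix_jac[OF \<phi>] \<psi>(1)]) (use \<psi>W in auto)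
  have PJ: "P (\<phi> y) ** jac \<phi> y = jac \<phi> y ** sig" if "y \<in> W" for y
    using that by (simp add: P_def \<psi>(2) matrix_mul_assoc[symmetric] JJ)
  have PP: "P x ** P x = mat 1" if "x \<in> V" for x
  proof -
    obtain y where y: "y \<in> W" "x = \<phi> y" using \<open>x \<in> V\<close> chart_facts(5) by blast
    have "P x ** P x ** jac \<phi> y = P x ** jac \<phi> y ** sig"
      unfolding y(2) by (metis PJ[OF y(1)] matrix_mul_assoc)
    also have "\<dots> = jac \<phi> y ** (sig ** sig)"
      unfolding y(2) by (simp add: PJ[OF y(1)] matrix_mul_assoc)
    finally have "P x ** P x ** jac \<phi> y = mat 1 ** jac \<phi> y" by (simp add: sig_sig)
    then show ?thesis by (rule matrix_cancel_right[OF inv[OF y(1)]])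
  qed
  have "mpartial l P x + Gam g l x ** P x - P x ** Gam g l x = 0" if "x \<in> V" for x l
  proof -
    obtain y where y: "y \<in> W" "x = \<phi> y" using \<open>x \<in> V\<close> chart_facts(5) by blast
    define L where "L c = transpose (jac \<phi> y) ** g (\<phi> y) ** cov_frame g \<phi> c y" for c
    define dG where "dG c = mpartial c (\<lambda>y. transpose (jac \<phi> y) ** g (\<phi> y) ** jac \<phi> y) y" for c
    let ?B = "\<lambda>y. block (vh (y $ 0) (y $ 1)) (hh (y $ 2) (y $ 3))"
    have sm: "smooth_matrix W (\<lambda>y. transpose (jac \<phi> y) ** g (\<phi> y) ** jac \<phi> y)"
      by (intro smooth_matrix_mul W smooth_matrix_transpose smooth_matrix_jac[OF \<phi>]
          smooth_matrix_compose[OF openU[OF st] W \<phi>W g_smooth[OF st] \<phi>])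
    \<comment> \<open>\<open>vh\<close> and \<open>hh\<close> carry no smoothness assumption;
      differentiability comes from the pulled-back metric, which agrees with the block matrix on
      \<open>W\<close>.\<close>
    have Bd: "(\<lambda>y. ?B y $ a $ b) differentiable (at y)" for a b
      using smooth_matrix_differentiable[OF sm y(1), of a b]
        differentiable_cong_open[OF W y(1), of "\<lambda>y. ?B y $ a $ b" "\<lambda>y. (transpose (jac \<phi> y) ** g (\<phi> y) ** jac \<phi> y) $ a $ b"]
        chart_block by simp
    have dB: "dG c $ a $ b = partial c (\<lambda>y. ?B y $ a $ b) y" for a b c
      unfolding dG_def mpartial_def vec_lambda_beta
      by (rule partial_cong[OF W y(1)]) (simp add: chart_block)
    \<comment> \<open>Either the component joins the two blocks and is zero, or \<open>c\<close> is
      a coordinate of the other factor.\<close>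
    have dG0: "dG c $ a $ b = 0" if "\<not> ((c \<in> {0,1} \<longleftrightarrow> a \<in> {0,1}) \<and> (c \<in> {0,1} \<longleftrightarrow> b \<in> {0,1}))" for a b c
    proof -
      have indep: "?B y' $ a $ b = ?B y $ a $ b" if "\<And>i. i \<noteq> c \<Longrightarrow> y' $ i = y $ i" for y'
        using that[of 0] that[of 1] that[of 2] that[of 3] \<open>\<not> _\<close> all4[of "\<lambda>c. c \<in> {0,1} \<or> c \<in> {2,3}"]
        by (auto simp: block_entry)
      show ?thesis unfolding dB
        by (rule partial_zero_if_independent[OF W y(1) Bd]) (rule indep)
    qed
    have "L c $ b $ a = 0" if "b \<in> {0,1} \<longleftrightarrow> a \<notin> {0,1}" for a b c
    proof -
      have "dG c $ a $ b = 0" "dG a $ c $ b = 0" "dG b $ c $ a = 0"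
        using that by (intro dG0; blast)+
      then show ?thesis
        using koszul(3)[OF y(1), of c b a, folded L_def dG_def] by simp
    qed
    then have Ls: "L c ** sig = sig ** L c" for c
      by (auto simp: vec_eq_iff mul_sig_entry)
    have P0: "cov_frame g \<phi> c y ** sig - P (\<phi> y) ** cov_frame g \<phi> c y = 0" for c
    proof -
      have "transpose (jac \<phi> y) ** g (\<phi> y) ** (cov_frame g \<phi> c y ** sig) = sig ** L c"
        by (simp add: matrix_mul_assoc flip: Ls) (simp add: L_def)
      also have "\<dots> = transpose (jac \<phi> y) ** g (\<phi> y) ** (P (\<phi> y) ** cov_frame g \<phi> c y)"
        by (simp add: L_def matrix_mul_assoc frame_sig[OF inv[OF y(1)] PJ[OF y(1)] chart_block[OF y(1)]])
      finally have "cov_frame g \<phi> c y ** sig = P (\<phi> y) ** cov_frame g \<phi> c y"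
        by (rule matrix_cancel_left[OF invertible_mult[OF transpose_invertible[OF inv[OF y(1)]] g_inv[OF st \<phi>U[OF y(1)]]]])
      then show ?thesis by simp
    qed
    define E where "E l = mpartial l P (\<phi> y) + Gam g l (\<phi> y) ** P (\<phi> y) - P (\<phi> y) ** Gam g l (\<phi> y)" for l
    have "(\<Sum>l\<in>UNIV. jac \<phi> y $ l $ c *\<^sub>R E l) ** jac \<phi> y = 0 ** jac \<phi> y" for c
      unfolding E_def
      by (subst frame_projector_derivative[OF y(1) chart_facts(1) _ Ps PJ]) (use chart_facts(5) P0 in auto)
    then have E0: "(\<Sum>l\<in>UNIV. jac \<phi> y $ l $ c *\<^sub>R E l) = 0" for c
      using matrix_cancel_right[OF inv[OF y(1)]] by blast
    \<comment> \<open>Back from frame directions to coordinate directions, by inverting the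
      Jacobian.\<close>
    have "E l $ i $ j = 0" for l i j
    proof -
      have "transpose (jac \<phi> y) *v (\<chi> l. E l $ i $ j) = 0"
        using arg_cong[OF E0, of "\<lambda>M. M $ i $ j"]
        by (simp only: matrix_vector_mult_def transpose_def vec_lambda_beta) (simp add: vec_eq_iff)
      then have "matrix_inv (transpose (jac \<phi> y)) *v (transpose (jac \<phi> y) *v (\<chi> l. E l $ i $ j)) = 0" by simp
      then have "(\<chi> l. E l $ i $ j) = 0"
        unfolding matrix_vector_mul_assoc
        using transpose_invertible[OF inv[OF y(1)]] by (simp add: matrix_inv_right_left)
      then show ?thesis by (simp add: vec_eq_iff)
    qed
    then show ?thesis by (simp add: y(2) E_def[symmetric] vec_eq_iff)
  qed
  then have "parallel_on V g P" by (simp add: parallel_on_def algebra_simps)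
  then show thesis by (rule that[OF Ps _ PP PJ inv])
qed

lemma product_chart_projector:
  obtains P where "smooth_matrix V P" "parallel_on V g P" "\<And>x. x \<in> V \<Longrightarrow> P x ** P x = mat 1"
    "\<And>y. y \<in> W \<Longrightarrow> P (\<phi> y) ** jac \<phi> y = jac \<phi> y ** sig" "\<And>y. y \<in> W \<Longrightarrow> invertible (jac \<phi> y)"
    "\<And>x. x \<in> V \<Longrightarrow> \<exists>c. Nmat g x = c *\<^sub>R (g x ** P x)"
proof -
  obtain P where P: "smooth_matrix V P" "parallel_on V g P" "\<And>x. x \<in> V \<Longrightarrow> P x ** P x = mat 1"
    "\<And>y. y \<in> W \<Longrightarrow> P (\<phi> y) ** jac \<phi> y = jac \<phi> y ** sig" "\<And>y. y \<in> W \<Longrightarrow> invertible (jac \<phi> y)"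
    by (rule product_chart_parallel) blast
  have "\<exists>c. Nmat g x = c *\<^sub>R (g x ** P x)" if "x \<in> V" for x
  proof -
    obtain y where y: "y \<in> W" "x = \<phi> y" using \<open>x \<in> V\<close> chart_facts(5) by blast
    show ?thesis
      using Nmat_in_frame[OF st chart_facts(1,3) P(1,2) that, of "jac \<phi> y"] P(4,5)[OF y(1)] chart_block[OF y(1)]
        lorentzian2_det[OF chart_lor[OF y(1)]] riemannian2_det(2)[OF chart_riem[OF y(1)]] y(2) by auto
  qed
  with P show thesis by (intro that)
qed

lemma product_chart_conditions:
  assumes "\<And>x. x \<in> U \<Longrightarrow> Nmat g x \<noteq> 0" "x \<in> V"
  shows "product_conditions g x"
proof -
  obtain P where "smooth_matrix V P" "parallel_on V g P" "\<And>x. x \<in> V \<Longrightarrow> P x ** P x = mat 1"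
    "\<And>x. x \<in> V \<Longrightarrow> \<exists>c. Nmat g x = c *\<^sub>R (g x ** P x)"
    by (rule product_chart_projector) blast
  then show ?thesis
    using assms chart_facts(3) by (intro product_conditions_from_parallel[OF st chart_facts(1,3)]) auto
qed

text \<open>A time-like v has g(v,v) = qa + qb < 0 with qb \<ge> 0, so (g P)(v,v) = qa - qb is
  negative as well and N(v,v) has the sign of -c. Dividing N = c g P by its size then gives Pi = - g
  P, i.e. minus the Lorentzian plus the Riemannian block.\<close>

lemma product_chart_factors:
  assumes N0: "\<And>x. x \<in> U \<Longrightarrow> Nmat g x \<noteq> 0" and y: "y \<in> W" and v: "timelike g (\<phi> y) v"
  shows "pullback_at ((1/2) *\<^sub>R (g (\<phi> y) - PiT g (\<phi> y) v)) \<phi> y = block (vh (y $ 0) (y $ 1)) 0"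
    "pullback_at ((1/2) *\<^sub>R (g (\<phi> y) + PiT g (\<phi> y) v)) \<phi> y = block 0 (hh (y $ 2) (y $ 3))"
proof -
  obtain P where "smooth_matrix V P" "parallel_on V g P" and PP: "\<And>x. x \<in> V \<Longrightarrow> P x ** P x = mat 1"
    and PJ: "\<And>y. y \<in> W \<Longrightarrow> P (\<phi> y) ** jac \<phi> y = jac \<phi> y ** sig" and inv: "\<And>y. y \<in> W \<Longrightarrow> invertible (jac \<phi> y)"
    and N: "\<And>x. x \<in> V \<Longrightarrow> \<exists>c. Nmat g x = c *\<^sub>R (g x ** P x)"
    by (rule product_chart_projector) blast
  let ?x = "\<phi> y" and ?J = "jac \<phi> y" and ?A = "vh (y $ 0) (y $ 1)" and ?B = "hh (y $ 2) (y $ 3)"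
  have xV: "?x \<in> V" using y chart_facts(5) by blast
  obtain c where c: "Nmat g ?x = c *\<^sub>R (g ?x ** P ?x)" using N[OF xV] by blast
  have c0: "c \<noteq> 0" using c N0[OF \<phi>U[OF y]] by auto
  have gP: "transpose ?J ** (g ?x ** P ?x) ** ?J = block ?A (- ?B)"
  proof -
    have "transpose ?J ** (g ?x ** P ?x) ** ?J = transpose ?J ** g ?x ** ?J ** sig"
      by (metis PJ[OF y] matrix_mul_assoc)
    then show ?thesis by (simp add: chart_block[OF y] sig_block block_mul matrix_mul_distrib)
  qed
  define u where "u = matrix_inv ?J *v v"
  have v_eq: "v = ?J *v u"
    by (simp add: u_def matrix_vector_mul_assoc matrix_inv_right_left inv[OF y])
  define qa where "qa = vlo u \<bullet> (?A *v vlo u)"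
  define qb where "qb = vhi u \<bullet> (?B *v vhi u)"
  have "qb \<ge> 0"
    using chart_riem[OF y] unfolding riemannian2_def qb_def
    by (cases "vhi u = 0") (auto intro: less_imp_le)
  moreover have "qa + qb < 0"
    using v unfolding timelike_def quad_form_entry
    by (simp add: v_eq quad_form_congruence chart_block[OF y] quad_form_block qa_def qb_def)
  ultimately have neg: "qa - qb < 0" by linarith
  have "(\<Sum>a\<in>UNIV. \<Sum>b\<in>UNIV. TFRic g a b ?x * v $ a * v $ b)
      = (\<Sum>a\<in>UNIV. \<Sum>b\<in>UNIV. Nmat g ?x $ a $ b * v $ a * v $ b)" by (simp add: Nmat_def)
  also have "\<dots> = v \<bullet> (Nmat g ?x *v v)" by (rule quad_form_entry)
  also have "\<dots> = c * (v \<bullet> ((g ?x ** P ?x) *v v))"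
    by (simp add: c scaleR_matrix_vector_assoc[symmetric])
  also have "v \<bullet> ((g ?x ** P ?x) *v v) = qa - qb"
    unfolding v_eq quad_form_congruence gP quad_form_block qa_def qb_def
    by (simp add: matrix_vector_mult_def inner_vec_def sum_negf)
  finally have q: "(\<Sum>a\<in>UNIV. \<Sum>b\<in>UNIV. TFRic g a b ?x * v $ a * v $ b) = c * (qa - qb)" .
  have e: "eps g ?x v = - sgn c"
    using neg c0 unfolding eps_def q Let_def by (simp add: abs_mult sgn_if field_simps split: if_splits)
  have "trNsq g ?x = 4 * c\<^sup>2" by (rule trNsq_projector[OF st \<phi>U[OF y] PP[OF xV] c])
  then have "sqrt (trNsq g ?x) = 2 * \<bar>c\<bar>" by (simp add: real_sqrt_mult)
  then have Pi: "PiT g ?x v = - (g ?x ** P ?x)"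
    unfolding PiT_def e c using c0 by (simp add: sgn_if)
  show "pullback_at ((1/2) *\<^sub>R (g ?x - PiT g ?x v)) \<phi> y = block ?A 0"
    "pullback_at ((1/2) *\<^sub>R (g ?x + PiT g ?x v)) \<phi> y = block 0 ?B"
    unfolding pullback_jac Pi
    by (simp_all add: matrix_mul_distrib gP chart_block[OF y] block_arith)
qed

end

section \<open>Involutions and the signature of a block metric\<close>

lemma invertible_if_columns_span:
  fixes J :: "real^'n^'n"
  assumes "span (range (\<lambda>a. column a J)) = UNIV"
  shows "invertible J"
proof -
  have "columns J = range (\<lambda>a. column a J)" by (auto simp: columns_def)
  then show ?thesis
    using assms by (simp add: invertible_right_inverse matrix_right_invertible_span_columns span_vec_eq)
qed

lemma matrix_vector_column: "A *v column a J = column a (A ** J)"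
  by (simp add: vec_eq_iff column_def matrix_vector_mult_def matrix_matrix_mult_def)

text \<open>Every vector is the sum of its parts in the two eigenspaces, so bases of these form a
  basis together. The trace is the difference of their dimensions; trace 0 in dimension 4 makes both
  equal to 2.\<close>

lemma involution_frame:
  fixes P :: "real^4^4"
  assumes PP: "P ** P = mat 1" and tr: "trace P = 0"
  obtains J where "invertible J" "P ** J = J ** sig"
proof -
  define E where "E s = {v. P *v v = s *\<^sub>R v}" for s :: real
  have sub: "subspace (E s)" for s
    by (auto simp: E_def subspace_def matrix_vector_right_distrib matrix_vector_mult_scaleR scaleR_add_right)
  have PPv: "P *v (P *v v) = v" for v by (simp add: matrix_vector_mul_assoc PP)
  have split: "v = (1/2) *\<^sub>R (v + P *v v) + (1/2) *\<^sub>R (v - P *v v)" for v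
    by (simp add: scaleR_add_right scaleR_diff_right scaleR_add_left[symmetric])
  have Ep: "(1/2) *\<^sub>R (v + P *v v) \<in> E 1" and Em: "(1/2) *\<^sub>R (v - P *v v) \<in> E (-1)" for v
    by (auto simp: E_def matrix_vector_mult_scaleR matrix_vector_right_distrib matrix_vector_mult_diff_distrib PPv
        add.commute scaleR_diff_right)
  obtain B where B: "B \<subseteq> E 1" "independent B" "E 1 \<subseteq> span B" "card B = dim (E 1)"
    using basis_exists[of "E 1"] by metis
  obtain C where C: "C \<subseteq> E (-1)" "independent C" "E (-1) \<subseteq> span C" "card C = dim (E (-1))"
    using basis_exists[of "E (-1)"] by metis
  have fin: "finite B" "finite C" using B(2) C(2) independent_imp_finite by blast+
  have zero: "v = 0" if "v \<in> E 1" "v \<in> E (-1)" for v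
  proof -
    have "v = - v" using that by (simp add: E_def)
    then show ?thesis by (simp add: eq_neg_iff_add_eq_0 flip: scaleR_2)
  qed
  have disj: "B \<inter> C = {}"
  proof -
    have "0 \<notin> B" using B(2) dependent_zero by blast
    then show ?thesis using zero B(1) C(1) by blast
  qed
  have span: "span (B \<union> C) = UNIV"
  proof -
    have "v \<in> span (B \<union> C)" for v
      by (subst split) (intro span_add, (use Ep B(3) span_mono[of B "B \<union> C"] in blast),
          (use Em C(3) span_mono[of C "B \<union> C"] in blast))
    then show ?thesis by blast
  qed
  have "dim {x + y |x y. x \<in> E 1 \<and> y \<in> E (-1)} + dim (E 1 \<inter> E (-1)) = dim (E 1) + dim (E (-1))"
    using dim_sums_Int[OF sub sub, of 1 "-1"] by simp
  moreover have "E 1 \<inter> E (-1) = {0}" using zero subspace_0[OF sub] by auto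
  moreover have "{x + y |x y. x \<in> E 1 \<and> y \<in> E (-1)} = UNIV"
    using split Ep Em by blast
  ultimately have "card B + card C = 4" using B(4) C(4) by simp
  then have c4: "card (B \<union> C) = 4" using card_Un_disjoint[OF fin disj] by simp
  define s where "s b = (if b \<in> B then 1 else (-1::real))" for b
  have Ps: "P *v b = s b *\<^sub>R b" if "b \<in> B \<union> C" for b
    using that B(1) C(1) disj by (auto simp: s_def E_def)
  \<comment> \<open>Stated for an arbitrary enumeration of the basis: a first one serves to compute
    the trace, and once the dimensions are known an ordered one gives \<open>sig\<close>.\<close>
  have frame: "invertible J \<and> P ** J = J ** (\<chi> i j. if i = j then s (e j) else 0)"
    if "range e = B \<union> C" "J = (\<chi> i a. e a $ i)" for e :: "4 \<Rightarrow> real^4" and J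
  proof
    have col: "column a J = e a" for a by (simp add: that(2) column_def vec_eq_iff)
    show "invertible J" by (rule invertible_if_columns_span) (simp add: col that(1) span)
    have "P *v e a = s (e a) *\<^sub>R e a" for a using Ps that(1) by auto
    then have "(P ** J) $ i $ a = (J ** (\<chi> i j. if i = j then s (e j) else 0)) $ i $ a" for i a
      using matrix_vector_column[of P a J] unfolding col
      by (auto simp: vec_eq_iff column_def that(2) matrix_matrix_mult_def[of _ "\<chi> i j. if i = j then s (e j) else 0"]
          if_distrib[where f="\<lambda>x. _ * x"] mult.commute cong: if_cong)
    then show "P ** J = J ** (\<chi> i j. if i = j then s (e j) else 0)" by (simp add: vec_eq_iff)
  qed
  obtain e :: "4 \<Rightarrow> real^4" where e: "bij_betw e UNIV (B \<union> C)"
    using finite_same_card_bij[of "UNIV :: 4 set" "B \<union> C"] fin c4 by auto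
  define J where "J = (\<chi> i a. e a $ i)"
  let ?D = "(\<chi> i j. if i = j then s (e j) else 0) :: real^4^4"
  have J: "invertible J" "P ** J = J ** ?D" using frame[of e J] e by (auto simp: bij_betw_def J_def)
  have "P = J ** ?D ** matrix_inv J"
    by (metis J matrix_inv_right_left(1) matrix_mul_assoc matrix_mul_rid)
  then have "trace P = trace (J ** (?D ** matrix_inv J))" by (simp add: matrix_mul_assoc)
  also have "\<dots> = trace (?D ** (matrix_inv J ** J))" by (subst trace_mul_sym) (simp add: matrix_mul_assoc)
  also have "\<dots> = (\<Sum>a\<in>UNIV. s (e a))" by (simp add: matrix_inv_right_left J trace_def)
  also have "\<dots> = (\<Sum>b\<in>B \<union> C. s b)" by (rule sum.reindex_bij_betw[OF e])
  also have "\<dots> = (\<Sum>b\<in>B. s b) + (\<Sum>b\<in>C. s b)" by (rule sum.union_disjoint[OF fin disj])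
  also have "(\<Sum>b\<in>B. s b) = card B" by (simp add: s_def)
  also have "(\<Sum>b\<in>C. s b) = (\<Sum>b\<in>C. - 1)" using disj by (intro sum.cong) (auto simp: s_def)
  finally have "real (card B) = real (card C)" using tr by simp
  then have "card B = 2" "card C = 2" using \<open>card B + card C = 4\<close> by auto
  then obtain b0 b1 b2 b3 where b: "B = {b0, b1}" "C = {b2, b3}" by (auto simp: card_2_iff)
  define e' :: "4 \<Rightarrow> real^4" where "e' a = (if a = 0 then b0 else if a = 1 then b1 else if a = 2 then b2 else b3)" for a
  have e'v: "e' 0 = b0" "e' 1 = b1" "e' 2 = b2" "e' 3 = b3" by (simp_all add: e'_def)
  have "range e' = B \<union> C" unfolding UNIV4 b using e'v by auto
  from frame[OF this refl]
  have f: "invertible (\<chi> i a. e' a $ i)" "P ** (\<chi> i a. e' a $ i) = (\<chi> i a. e' a $ i) ** (\<chi> i j. if i = j then s (e' j) else 0)"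
    by auto
  have "b0 \<in> B" "b1 \<in> B" "b2 \<notin> B" "b3 \<notin> B" using b disj by auto
  then have "(\<chi> i j. if i = j then s (e' j) else 0) = sig"
    by (simp add: vec_eq_iff all4 sig_def e'v s_def)
  with f show thesis by (intro that) auto
qed

section \<open>Signature of the blocks of a Lorentzian metric\<close>

lemma lorentzian4_congruence:
  assumes "lorentzian4 G" "invertible J"
  shows "lorentzian4 (transpose J ** G ** J)"
proof -
  obtain P where P: "transpose G = G" "invertible P" "transpose P ** G ** P = eta4"
    using assms(1) by (auto simp: lorentzian4_def)
  have "transpose (matrix_inv J ** P) ** (transpose J ** G ** J) ** (matrix_inv J ** P)
      = transpose P ** (transpose (J ** matrix_inv J)) ** G ** (J ** matrix_inv J) ** P"
    by (simp add: transpose_simps matrix_mul_assoc)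
  also have "\<dots> = eta4" by (simp add: matrix_inv_right_left assms(2) transpose_mat P)
  moreover have "invertible (matrix_inv J ** P)"
    using assms(2) P(2) invertible_mult invertible_left_inverse matrix_inv_right_left(1) invertible_def by metis
  ultimately show ?thesis
    using P(1) by (auto simp: lorentzian4_def transpose_simps matrix_mul_assoc)
qed

text \<open>A plane meets the hyperplane of vanishing time component, on which the form is positive
  definite, in a nonzero vector.\<close>

lemma lorentzian4_positive_in_plane:
  assumes "lorentzian4 G" and ind: "\<And>\<alpha> \<beta>. \<alpha> *\<^sub>R u + \<beta> *\<^sub>R v = 0 \<Longrightarrow> \<alpha> = 0 \<and> \<beta> = 0"
  obtains \<alpha> \<beta> where "0 < (\<alpha> *\<^sub>R u + \<beta> *\<^sub>R v) \<bullet> (G *v (\<alpha> *\<^sub>R u + \<beta> *\<^sub>R v))"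
proof -
  obtain P where P: "invertible P" "transpose P ** G ** P = eta4"
    using assms(1) by (auto simp: lorentzian4_def)
  define u' where "u' = matrix_inv P *v u"
  define v' where "v' = matrix_inv P *v v"
  have uv: "u = P *v u'" "v = P *v v'"
    by (simp_all add: u'_def v'_def matrix_vector_mul_assoc matrix_inv_right_left P)
  \<comment> \<open>A nontrivial combination that cancels the time components; if both are 0, the
    first vector is taken.\<close>
  define \<alpha> where "\<alpha> = (if u' $ 0 = 0 \<and> v' $ 0 = 0 then 1 else v' $ 0)"
  define \<beta> where "\<beta> = (if u' $ 0 = 0 \<and> v' $ 0 = 0 then 0 else - u' $ 0)"
  define w where "w = \<alpha> *\<^sub>R u' + \<beta> *\<^sub>R v'"
  have Pw: "\<alpha> *\<^sub>R u + \<beta> *\<^sub>R v = P *v w"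
    by (simp add: uv w_def matrix_vector_right_distrib matrix_vector_mult_scaleR)
  have w0: "w $ 0 = 0" by (simp add: w_def \<alpha>_def \<beta>_def)
  have "\<not> (\<alpha> = 0 \<and> \<beta> = 0)" by (auto simp: \<alpha>_def \<beta>_def)
  then have "P *v w \<noteq> 0" using ind Pw by metis
  then have "w \<noteq> 0" by auto
  then have "w $ 1 \<noteq> 0 \<or> w $ 2 \<noteq> 0 \<or> w $ 3 \<noteq> 0" using w0 by (auto simp: vec_eq_iff all4)
  then have "0 < (w $ 1)\<^sup>2 + (w $ 2)\<^sup>2 + (w $ 3)\<^sup>2"
    by (smt (verit) zero_less_power2 zero_le_power2)
  also have "\<dots> = w \<bullet> (eta4 *v w)"
    by (simp add: inner_vec_def matrix_vector_mult_def sum4 eta4_def w0 power2_eq_square)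
  also have "\<dots> = (P *v w) \<bullet> (G *v (P *v w))"
    by (simp add: quad_form_congruence P)
  finally show thesis by (intro that[of \<alpha> \<beta>]) (simp add: Pw)
qed

text \<open>If det A were nonnegative, \<open>A $ 0 $ 0\<close> times the form would be a square
  plus a nonnegative term. Opposite signs at \<open>t\<close> and \<open>s\<close> then force
  \<open>A $ 0 $ 0 = 0\<close>, hence \<open>A $ 0 $ 1 = 0\<close>, and the one coefficient left
  cannot give both signs.\<close>

lemma det_negative_if_indefinite:
  fixes A :: "real^2^2"
  assumes "transpose A = A" "t \<bullet> (A *v t) < 0" "0 < s \<bullet> (A *v s)"
  shows "det A < 0"
proof (rule ccontr)
  assume "\<not> det A < 0"
  have A10: "A $ 1 $ 0 = A $ 0 $ 1"
    using arg_cong[OF assms(1), of "\<lambda>M. M $ 0 $ 1"] by (simp add: transpose_def)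
  have q: "A $ 0 $ 0 * (v \<bullet> (A *v v)) = (A $ 0 $ 0 * v $ 0 + A $ 0 $ 1 * v $ 1)\<^sup>2 + det A * (v $ 1)\<^sup>2" for v
    by (simp add: sym2_quad[OF assms(1)] det2 A10 power2_eq_square algebra_simps)
  then have nn: "0 \<le> A $ 0 $ 0 * (v \<bullet> (A *v v))" for v
    using \<open>\<not> det A < 0\<close> by (simp add: q)
  have "A $ 0 $ 0 = 0"
    using nn[of t] nn[of s] assms(2,3) by (auto simp: zero_le_mult_iff)
  moreover from this have "A $ 0 $ 1 = 0"
    using \<open>\<not> det A < 0\<close> by (auto simp: det2 A10 not_less mult_le_0_iff)
  ultimately have "t \<bullet> (A *v t) = A $ 1 $ 1 * (t $ 1)\<^sup>2" "s \<bullet> (A *v s) = A $ 1 $ 1 * (s $ 1)\<^sup>2"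
    by (simp_all add: sym2_quad[OF assms(1)])
  then show False using assms(2,3) by (auto simp: mult_less_0_iff zero_less_mult_iff)
qed

lemma lorentzian2_if_indefinite:
  fixes A :: "real^2^2"
  assumes "transpose A = A" "t \<bullet> (A *v t) < 0" "0 < s \<bullet> (A *v s)"
  shows "lorentzian2 A"
proof -
  have det: "det A < 0" by (rule det_negative_if_indefinite[OF assms])
  have A10: "A $ 1 $ 0 = A $ 0 $ 1"
    using arg_cong[OF assms(1), of "\<lambda>M. M $ 0 $ 1"] by (simp add: transpose_def)
  define r where "r = t \<bullet> (A *v t)"
  \<comment> \<open>\<open>w\<close> is orthogonal to \<open>t\<close> for the form and has square
    \<open>r * det A\<close>, which is positive; the two normalised vectors are the columns of
    \<open>P\<close>.\<close>
  define w :: "real^2" where "w = (\<chi> i. if i = 0 then - (A *v t) $ 1 else (A *v t) $ 0)"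
  define P :: "real^2^2" where "P = (\<chi> i j. if j = 0 then t $ i / sqrt (- r) else w $ i / sqrt (r * det A))"
  have r: "r < 0" "0 < r * det A" using assms(2) det by (simp_all add: r_def mult_neg_neg)
  have wAw: "w \<bullet> (A *v w) = r * det A" and tAw: "t \<bullet> (A *v w) = 0" and wAt: "w \<bullet> (A *v t) = 0"
    by (simp_all add: w_def r_def det2 inner_vec_def matrix_vector_mult_def sum2 A10 algebra_simps)
  have rr: "r = t $ 0 * (A $ 0 $ 0 * t $ 0 + A $ 0 $ 1 * t $ 1) + t $ 1 * (A $ 1 $ 0 * t $ 0 + A $ 1 $ 1 * t $ 1)"
    by (simp add: r_def inner_vec_def matrix_vector_mult_def sum2)
  have entry: "(transpose P ** A ** P) $ i $ j = column i P \<bullet> (A *v column j P)" for i j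
    by (simp add: matrix_matrix_mult_def transpose_def column_def inner_vec_def matrix_vector_mult_def
        sum2 algebra_simps)
  have cols: "column 0 P = (1 / sqrt (- r)) *\<^sub>R t" "column 1 P = (1 / sqrt (r * det A)) *\<^sub>R w"
    by (simp_all add: column_def P_def vec_eq_iff)
  have "transpose P ** A ** P = eta2"
    using r less_imp_neq[OF det] by (simp add: vec_eq_iff all2 entry cols matrix_vector_mult_scaleR wAw tAw wAt r_def[symmetric] eta2_def
        field_simps real_sqrt_mult_self)
  moreover from this have "det (transpose P ** A ** P) \<noteq> 0" by (simp add: det_eta2)
  then have "invertible P" by (simp add: det_mul invertible_det_nz)
  ultimately show ?thesis using assms(1) by (auto simp: lorentzian2_def)
qed

text \<open>Each block is a plane and so contains a vector of positive square. A time-like vector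
  has a part of negative square in one block. The plane spanned by this part and any nonzero vector
  of the other block contains a positive vector, which makes the other block positive
  definite.\<close>

lemma lorentz_block:
  assumes lor: "lorentzian4 (block A B)"
  shows "lorentzian2 A \<and> riemannian2 B \<or> lorentzian2 B \<and> riemannian2 A"
proof -
  have "transpose (block A B) = block A B" using lor by (simp add: lorentzian4_def)
  then have "\<And>i j. block (transpose A) (transpose B) $ i $ j = block A B $ i $ j"
    by (simp add: block_arith)
  from this[of 0 1] this[of 2 3]
  have sym: "transpose A = A" "transpose B = B"
    by (auto simp: block_entry lo_hi transpose_def vec_eq_iff all2)
  define l :: "real^2 \<Rightarrow> real^4" where "l u = (\<chi> i. if i = 0 then u $ 0 else if i = 1 then u $ 1 else 0)" for u
  define h :: "real^2 \<Rightarrow> real^4" where "h u = (\<chi> i. if i = 2 then u $ 0 else if i = 3 then u $ 1 else 0)" for u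
  have q: "(l u + h v) \<bullet> (block A B *v (l u + h v)) = u \<bullet> (A *v u) + v \<bullet> (B *v v)" for u v
  proof -
    have "vlo (l u + h v) = u" "vhi (l u + h v) = v"
      by (simp_all add: vlo_def vhi_def l_def h_def vec_eq_iff all2)
    then show ?thesis by (simp add: quad_form_block)
  qed
  have lh0: "l u + h v = 0 \<longleftrightarrow> u = 0 \<and> v = 0" for u v
    by (simp add: l_def h_def vec_eq_iff all4 all2)
  have lin: "\<alpha> *\<^sub>R (l u + h v) + \<beta> *\<^sub>R (l u' + h v') = l (\<alpha> *\<^sub>R u + \<beta> *\<^sub>R u') + h (\<alpha> *\<^sub>R v + \<beta> *\<^sub>R v')" for u v u' v' \<alpha> \<beta>
    by (simp add: l_def h_def vec_eq_iff)
  define e0 e1 :: "real^2" where "e0 = (\<chi> i. if i = 0 then 1 else 0)" and "e1 = (\<chi> i. if i = 1 then 1 else 0)"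
  have e: "\<alpha> *\<^sub>R e0 + \<beta> *\<^sub>R e1 = 0 \<Longrightarrow> \<alpha> = 0 \<and> \<beta> = 0" for \<alpha> \<beta>
    by (simp add: e0_def e1_def vec_eq_iff all2)
  have h0: "h 0 = 0" "l 0 = 0" by (simp_all add: h_def l_def vec_eq_iff)
  obtain sA where sA: "0 < sA \<bullet> (A *v sA)"
  proof (rule lorentzian4_positive_in_plane[OF lor, of "l e0 + h 0" "l e1 + h 0"])
    show "\<alpha> = 0 \<and> \<beta> = 0" if "\<alpha> *\<^sub>R (l e0 + h 0) + \<beta> *\<^sub>R (l e1 + h 0) = 0" for \<alpha> \<beta>
      using that unfolding lin lh0 by (intro e) simp
  qed (unfold lin q, simp)
  obtain sB where sB: "0 < sB \<bullet> (B *v sB)"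
  proof (rule lorentzian4_positive_in_plane[OF lor, of "l 0 + h e0" "l 0 + h e1"])
    show "\<alpha> = 0 \<and> \<beta> = 0" if "\<alpha> *\<^sub>R (l 0 + h e0) + \<beta> *\<^sub>R (l 0 + h e1) = 0" for \<alpha> \<beta>
      using that unfolding lin lh0 by (intro e) simp
  qed (unfold lin q, simp)
  obtain P where P: "transpose P ** block A B ** P = eta4" using lor by (auto simp: lorentzian4_def)
  define t where "t = P *v (\<chi> i. if i = 0 then 1 else 0)"
  have "t \<bullet> (block A B *v t) = -1"
    unfolding t_def quad_form_congruence P
    by (simp add: inner_vec_def matrix_vector_mult_def sum4 eta4_def)
  then have tneg: "vlo t \<bullet> (A *v vlo t) < 0 \<or> vhi t \<bullet> (B *v vhi t) < 0"
    unfolding quad_form_block by linarith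
  have posB: "0 < v \<bullet> (B *v v)" if u: "u \<bullet> (A *v u) < 0" and v: "v \<noteq> 0" for u v
  proof (rule lorentzian4_positive_in_plane[OF lor, of "l u + h 0" "l 0 + h v"])
    have "u \<noteq> 0" using u by auto
    then show "\<alpha> = 0 \<and> \<beta> = 0" if "\<alpha> *\<^sub>R (l u + h 0) + \<beta> *\<^sub>R (l 0 + h v) = 0" for \<alpha> \<beta>
      using that v unfolding lin lh0 by simp
    fix \<alpha> \<beta>
    assume "0 < (\<alpha> *\<^sub>R (l u + h 0) + \<beta> *\<^sub>R (l 0 + h v)) \<bullet> (block A B *v (\<alpha> *\<^sub>R (l u + h 0) + \<beta> *\<^sub>R (l 0 + h v)))"
    then have "0 < \<alpha>\<^sup>2 * (u \<bullet> (A *v u)) + \<beta>\<^sup>2 * (v \<bullet> (B *v v))"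
      unfolding lin q by (simp add: matrix_vector_mult_scaleR power2_eq_square mult.assoc)
    then show "0 < v \<bullet> (B *v v)"
      using u by (smt (verit) mult_nonneg_nonpos zero_le_power2)
  qed
  have posA: "0 < v \<bullet> (A *v v)" if u: "u \<bullet> (B *v u) < 0" and v: "v \<noteq> 0" for u v
  proof (rule lorentzian4_positive_in_plane[OF lor, of "l 0 + h u" "l v + h 0"])
    have "u \<noteq> 0" using u by auto
    then show "\<alpha> = 0 \<and> \<beta> = 0" if "\<alpha> *\<^sub>R (l 0 + h u) + \<beta> *\<^sub>R (l v + h 0) = 0" for \<alpha> \<beta>
      using that v unfolding lin lh0 by simp
    fix \<alpha> \<beta>
    assume "0 < (\<alpha> *\<^sub>R (l 0 + h u) + \<beta> *\<^sub>R (l v + h 0)) \<bullet> (block A B *v (\<alpha> *\<^sub>R (l 0 + h u) + \<beta> *\<^sub>R (l v + h 0)))"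
    then have "0 < \<alpha>\<^sup>2 * (u \<bullet> (B *v u)) + \<beta>\<^sup>2 * (v \<bullet> (A *v v))"
      unfolding lin q by (simp add: matrix_vector_mult_scaleR power2_eq_square mult.assoc)
    then show "0 < v \<bullet> (A *v v)"
      using u by (smt (verit) mult_nonneg_nonpos zero_le_power2)
  qed
  from tneg show ?thesis
    using lorentzian2_if_indefinite[OF sym(1) _ sA] lorentzian2_if_indefinite[OF sym(2) _ sB] posA posB sym
    unfolding riemannian2_def by blast
qed

definition upper_block :: "real^4^4 \<Rightarrow> real^2^2" where
  "upper_block M = (\<chi> i j. M $ (if i = 0 then 0 else 1) $ (if j = 0 then 0 else 1))"

definition lower_block :: "real^4^4 \<Rightarrow> real^2^2" where
  "lower_block M = (\<chi> i j. M $ (if i = 0 then 2 else 3) $ (if j = 0 then 2 else 3))"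

lemma block_decomposition:
  assumes "M ** sig = sig ** M"
  shows "M = block (upper_block M) (lower_block M)"
proof -
  have "M $ d $ c = 0" if "d \<in> {0,1} \<longleftrightarrow> c \<notin> {0,1}" for c d
    using arg_cong[OF assms, of "\<lambda>M. M $ d $ c"] that unfolding mul_sig_entry by (auto split: if_splits)
  then show ?thesis
    by (simp add: vec_eq_iff all4 block_entry lo_hi upper_block_def lower_block_def)
qed

section \<open>Leaves of the eigendistributions\<close>

lemma ray_has_derivative:
  assumes "f differentiable (at (ray A z t))"
  shows "((\<lambda>t. f (ray A z t)) has_real_derivative (\<Sum>a\<in>A. z $ a * partial a f (ray A z t))) (at t)"
proof -
  have "((\<lambda>t. ray A z t) has_vector_derivative (\<chi> i. if i \<in> A then z $ i else 0)) (at t)"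
    unfolding has_vector_derivative_def has_derivative_componentwise_within[of "\<lambda>t. ray A z t"]
    by (auto simp: Basis_vec_def inner_axis ray_def intro!: derivative_eq_intros)
  from has_real_derivative_along[OF assms this]
  have "((\<lambda>t. f (ray A z t)) has_real_derivative (\<Sum>i\<in>UNIV. (if i \<in> A then z $ i else 0) * partial i f (ray A z t))) (at t)"
    by simp
  moreover have "(\<Sum>i\<in>UNIV. (if i \<in> A then z $ i else 0) * partial i f (ray A z t)) = (\<Sum>a\<in>A. z $ a * partial a f (ray A z t))"
    by (simp add: if_distrib[where f="\<lambda>x. x * _"] sum.If_cases cong: if_cong)
  ultimately show ?thesis by simp
qed

text \<open>An Euler identity, from integrating the derivative of t f(ray t) over [0,1]. It turns
  the integral equation of the leaf map into the statement that the radial field is a combination of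
  the \<open>Y a\<close>.\<close>

lemma ray_integral_euler:
  assumes "smooth_on (ball 0 \<delta>) f" "z \<in> ball 0 \<delta>"
  shows "(\<Sum>a\<in>A. z $ a * partial a (ray_integral A 0 f) z) = f z - ray_integral A 0 f z"
proof -
  note fd = smooth_on_differentiable[OF assms(1)]
  note fc = smooth_on_continuous[OF smooth_on_partial[OF assms(1)]]
  note rb = ray_in_ball[OF assms(2)]
  have der: "((\<lambda>t. t * f (ray A z t)) has_vector_derivative
      (t * (\<Sum>a\<in>A. z $ a * partial a f (ray A z t)) + f (ray A z t))) (at t within {0..1})"
    if "t \<in> {0..1}" for t
  proof -
    have "((\<lambda>t. t * f (ray A z t)) has_real_derivative
        (1 * f (ray A z t) + (\<Sum>a\<in>A. z $ a * partial a f (ray A z t)) * t)) (at t)"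
      by (intro DERIV_mult DERIV_ident ray_has_derivative fd rb) (use that in auto)
    then show ?thesis
      by (auto simp: has_real_derivative_iff_has_vector_derivative algebra_simps
          intro: has_vector_derivative_at_within)
  qed
  have i: "((\<lambda>t. t * (\<Sum>a\<in>A. z $ a * partial a f (ray A z t)) + f (ray A z t)) has_integral
      (1 * f (ray A z 1) - 0 * f (ray A z 0))) {0..1}"
    by (rule fundamental_theorem_of_calculus[OF _ der]) auto
  have i1: "((\<lambda>t. \<Sum>a\<in>A. z $ a * (t ^ 1 * partial a f (ray A z t))) has_integral
      (\<Sum>a\<in>A. z $ a * ray_integral A 1 (partial a f) z)) (cbox 0 1)"
    unfolding ray_integral_def
    by (intro has_integral_sum has_integral_mult_right integrable_integral
        ray_integrand_integrable[OF fc assms(2)]) auto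
  have i2: "((\<lambda>t. t ^ 0 * f (ray A z t)) has_integral ray_integral A 0 f z) (cbox 0 1)"
    unfolding ray_integral_def
    by (intro integrable_integral ray_integrand_integrable[OF smooth_on_continuous[OF assms(1)] assms(2)])
  have "((\<lambda>t. t * (\<Sum>a\<in>A. z $ a * partial a f (ray A z t)) + f (ray A z t)) has_integral
      ((\<Sum>a\<in>A. z $ a * ray_integral A 1 (partial a f) z) + ray_integral A 0 f z)) {0..1}"
    using has_integral_add[OF i1 i2] by (simp add: sum_distrib_left mult.left_commute)
  from has_integral_unique[OF this i]
  have "(\<Sum>a\<in>A. z $ a * ray_integral A 1 (partial a f) z) + ray_integral A 0 f z = f z" by simp
  moreover have "partial a (ray_integral A 0 f) z = ray_integral A 1 (partial a f) z" if "a \<in> A" for a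
    using partial_ray_integral[OF fd fc assms(2), where A=A and m=0 and j=a] that by simp
  ultimately show ?thesis by simp
qed

text \<open>An energy estimate: the sum of squares S satisfies S' \<le> 8 B S, where B bounds the
  coefficients, so exp (- 8 B t) S is nonincreasing, nonnegative and 0 at the start. The 8 comes
  from 2 x y \<le> x^2 + y^2, summed over four partners of either index.\<close>

lemma linear_ode_zero:
  fixes h :: "4 \<Rightarrow> real \<Rightarrow> real" and M :: "4 \<Rightarrow> 4 \<Rightarrow> real \<Rightarrow> real"
  assumes "\<And>k t. 0 \<le> t \<Longrightarrow> t \<le> 1 \<Longrightarrow> (h k has_real_derivative (\<Sum>m\<in>UNIV. M k m t * h m t)) (at t)"
    and "\<And>k m. continuous_on {0..1} (M k m)" and "\<And>k. h k 0 = 0"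
  shows "h k 1 = 0"
proof -
  have "\<forall>k m. \<exists>B. \<forall>t\<in>{0..1}. \<bar>M k m t\<bar> \<le> B"
    using compact_imp_bounded[OF compact_continuous_image[OF assms(2) compact_Icc]]
    unfolding bounded_iff by fastforce
  then obtain B0 where B0: "\<And>k m t. t \<in> {0..1} \<Longrightarrow> \<bar>M k m t\<bar> \<le> B0 k m" by metis
  define B where "B = (\<Sum>k\<in>UNIV. \<Sum>m\<in>UNIV. \<bar>B0 k m\<bar>)"
  have B: "\<bar>M k m t\<bar> \<le> B" if "t \<in> {0..1}" for k m t
  proof -
    have "\<bar>M k m t\<bar> \<le> \<bar>B0 k m\<bar>" using B0[OF that, of k m] by linarith
    also have "\<dots> \<le> (\<Sum>m\<in>UNIV. \<bar>B0 k m\<bar>)" by (rule member_le_sum) auto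
    also have "\<dots> \<le> B" unfolding B_def by (rule member_le_sum[of k UNIV "\<lambda>k. \<Sum>m\<in>UNIV. \<bar>B0 k m\<bar>"]) (auto intro: sum_nonneg)
    finally show ?thesis .
  qed
  have B_nonneg: "0 \<le> B" using B[of 0 0 0] by simp
  define S where "S t = (\<Sum>k\<in>UNIV. (h k t)\<^sup>2)" for t
  define E where "E t = exp (- 8 * B * t) * S t" for t
  have "E 1 \<le> E 0"
  proof (rule DERIV_nonpos_imp_nonincreasing[of 0 1 E])
    fix t :: real assume t: "0 \<le> t" "t \<le> 1"
    let ?S' = "\<Sum>k\<in>UNIV. 2 * h k t * (\<Sum>m\<in>UNIV. M k m t * h m t)"
    have dS: "(S has_real_derivative ?S') (at t)"
      unfolding S_def[abs_def]
      by (intro DERIV_sum) (use assms(1)[OF t] in \<open>auto intro!: derivative_eq_intros\<close>)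
    have dE: "(E has_real_derivative exp (- 8 * B * t) * (?S' - 8 * B * S t)) (at t)"
      unfolding E_def[abs_def]
      by (rule derivative_eq_intros refl dS)+ (simp add: algebra_simps)
    have "?S' \<le> (\<Sum>k\<in>UNIV. \<Sum>m\<in>UNIV. B * ((h k t)\<^sup>2 + (h m t)\<^sup>2))"
      unfolding sum_distrib_left
    proof (intro sum_mono)
      fix k m
      have "2 * \<bar>h k t\<bar> * \<bar>h m t\<bar> \<le> (h k t)\<^sup>2 + (h m t)\<^sup>2"
        using sum_squares_bound[of "\<bar>h k t\<bar>" "\<bar>h m t\<bar>"] by simp
      then have "\<bar>M k m t\<bar> * (2 * \<bar>h k t\<bar> * \<bar>h m t\<bar>) \<le> B * ((h k t)\<^sup>2 + (h m t)\<^sup>2)"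
        using B[of t k m] t by (intro mult_mono) auto
      moreover have "2 * h k t * (M k m t * h m t) \<le> \<bar>M k m t\<bar> * (2 * \<bar>h k t\<bar> * \<bar>h m t\<bar>)"
        by (rule order_trans[OF abs_ge_self]) (simp add: abs_mult mult_ac)
      ultimately show "2 * h k t * (M k m t * h m t) \<le> B * ((h k t)\<^sup>2 + (h m t)\<^sup>2)" by linarith
    qed
    also have "\<dots> = 8 * B * S t"
      by (simp add: S_def sum_distrib_left[symmetric] sum.distrib)
    finally have "exp (- 8 * B * t) * (?S' - 8 * B * S t) \<le> 0"
      by (intro mult_nonneg_nonpos) auto
    with dE show "\<exists>y. (E has_real_derivative y) (at t) \<and> y \<le> 0" by blast
  qed simp
  moreover have "E 0 = 0" by (simp add: E_def S_def assms(3))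
  ultimately have "S 1 \<le> 0" by (simp add: E_def mult_le_0_iff)
  then have "S 1 = 0" unfolding S_def by (intro order_antisym sum_nonneg) auto
  then show ?thesis by (simp add: S_def sum_nonneg_eq_0_iff)
qed

context
  fixes U g V P
  assumes st: "spacetime U g" and V: "open V" "V \<subseteq> U" and Ps: "smooth_matrix V P"
    and par: "parallel_on V g P" and PP: "\<And>x. x \<in> V \<Longrightarrow> P x ** P x = mat 1"
begin

text \<open>\<open>Q\<close> and \<open>R\<close> project to the eigenvalues -1 and 1, and the
  \<open>Y a\<close> are projected constant fields, equal at \<open>p\<close> to columns of
  \<open>J0\<close>. The integral equation makes only the radial combination of the coordinate
  fields tangent to the distribution; parallelism of \<open>P\<close> takes the place of the
  Frobenius condition in extending this to each coordinate field with index in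
  \<open>A\<close>.\<close>

lemma integral_leaf_map:
  assumes p: "p \<in> V" and J0: "P p ** J0 = J0 ** sig"
  obtains \<delta> \<gamma> where "0 < \<delta>" "smooth_map (ball 0 \<delta>) \<gamma>" "\<gamma> ` ball 0 \<delta> \<subseteq> V" "\<gamma> 0 = p" "jac \<gamma> 0 = J0"
    "\<And>z a k. z \<in> ball 0 \<delta> \<Longrightarrow> a \<in> {2, 3} \<Longrightarrow> (P (\<gamma> z) ** jac \<gamma> z) $ k $ a = - jac \<gamma> z $ k $ a"
proof -
  define A :: "4 set" where "A = {2, 3}"
  define R where "R x = (1/2) *\<^sub>R (mat 1 + P x)" for x
  define Q where "Q x = (1/2) *\<^sub>R (mat 1 - P x)" for x
  define Y where "Y a i x = (Q x ** J0) $ i $ a" for a i x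
  have Qs: "smooth_matrix V Q" and Rs: "smooth_matrix V R"
    unfolding Q_def[abs_def] R_def[abs_def]
    by (intro smooth_matrix_scaleR smooth_matrix_diff smooth_matrix_add smooth_matrix_const smooth_on_const V Ps)+
  have Ys: "smooth_on V (Y a i)" for a i
    unfolding Y_def[abs_def]
    by (rule smooth_matrix_entry[OF smooth_matrix_mul[OF V(1) Qs smooth_matrix_const]])
  have RQ: "R x ** Q x = 0" if "x \<in> V" for x
    by (simp add: R_def Q_def matrix_mul_distrib PP[OF that])
  obtain \<delta> \<gamma> where \<delta>: "0 < \<delta>" and \<gamma>s: "smooth_map (ball 0 \<delta>) \<gamma>" and \<gamma>V: "\<gamma> ` ball 0 \<delta> \<subseteq> V"
    and \<gamma>eq: "\<And>z i. z \<in> ball 0 \<delta> \<Longrightarrow> \<gamma> z $ i = p $ i + (\<Sum>j\<in>-A. z $ j * column j J0 $ i)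
      + (\<Sum>a\<in>A. z $ a * ray_integral A 0 (\<lambda>y. Y a i (\<gamma> y)) z)"
    by (rule ray_equation_solution[where U=V and p=p and Y=Y and A=A and b="\<lambda>j. column j J0", OF V(1) p Ys]) blast
  let ?B = "ball (0::real^4) \<delta>"
  interpret chart_map U g ?B \<gamma>
    by unfold_locales (use st \<gamma>s \<gamma>V V in auto)
  have \<gamma>in: "\<gamma> z \<in> V" if "z \<in> ?B" for z using that \<gamma>V by blast
  have YGs: "smooth_on ?B (\<lambda>y. Y a i (\<gamma> y))" for a i
    by (rule smooth_on_compose[OF V(1) open_ball \<gamma>V Ys \<gamma>s])
  have rd: "ray_integral A 0 (\<lambda>y. Y a i (\<gamma> y)) differentiable (at z)" if "z \<in> ?B" for a i z
    by (rule ray_integral_differentiable[OF smooth_on_differentiable[OF YGs]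
        smooth_on_continuous[OF smooth_on_partial[OF YGs]] that])
  have z0: "0 \<in> ?B" using \<delta> by simp
  have \<gamma>0: "\<gamma> 0 = p" by (simp add: vec_eq_iff \<gamma>eq[OF z0])
  have jac_eq: "jac \<gamma> z $ i $ j = (if j \<in> A then 0 else J0 $ i $ j)
      + (\<Sum>a\<in>A. (if j = a then ray_integral A 0 (\<lambda>y. Y a i (\<gamma> y)) z else 0)
        + z $ a * partial j (ray_integral A 0 (\<lambda>y. Y a i (\<gamma> y))) z)" if z: "z \<in> ?B" for z i j
  proof -
    have "jac \<gamma> z $ i $ j = partial j (\<lambda>z. p $ i + (\<Sum>j\<in>-A. z $ j * column j J0 $ i)
      + (\<Sum>a\<in>A. z $ a * ray_integral A 0 (\<lambda>y. Y a i (\<gamma> y)) z)) z"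
      unfolding jac_def vec_lambda_beta by (rule partial_cong[OF open_ball z \<gamma>eq])
    also have "\<dots> = (\<Sum>l\<in>-A. (if j = l then 1 else 0) * column l J0 $ i)
      + (\<Sum>a\<in>A. (if j = a then 1 else 0) * ray_integral A 0 (\<lambda>y. Y a i (\<gamma> y)) z
        + z $ a * partial j (ray_integral A 0 (\<lambda>y. Y a i (\<gamma> y))) z)"
      using rd[OF z]
      by (simp add: partial_add partial_sum partial_mult partial_proj differentiable_proj
          differentiable_mult differentiable_sum)
    finally show ?thesis
      by (simp add: if_distrib[where f="\<lambda>x. x * _"] column_def cong: if_cong)
  qed
  have jac0: "jac \<gamma> 0 = J0"
  proof -
    have QJ: "Q p ** J0 = (1/2) *\<^sub>R (J0 - J0 ** sig)"
      by (simp add: Q_def matrix_mul_distrib J0)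
    have Y0: "Y a i p = J0 $ i $ a" if "a \<in> A" for a i
      using that by (auto simp: Y_def QJ mul_sig_entry A_def)
    have "ray_integral A 0 (\<lambda>y. Y a i (\<gamma> y)) 0 = Y a i p" for a i
    proof -
      have "ray A 0 s = 0" for s by (simp add: ray_def vec_eq_iff)
      then show ?thesis by (simp add: ray_integral_def \<gamma>0)
    qed
    then have "jac \<gamma> 0 $ i $ j = J0 $ i $ j" for i j
      unfolding jac_eq[OF z0] by (simp add: Y0)
    then show ?thesis by (simp add: vec_eq_iff)
  qed
  \<comment> \<open>The radial field, a combination of the coordinate fields; \<open>euler\<close>
    identifies it with the same combination of the \<open>Y a\<close>.\<close>
  define y where "y z k = (\<Sum>a\<in>A. z $ a * jac \<gamma> z $ k $ a)" for z k
  have euler: "y z k = (\<Sum>a\<in>A. z $ a * Y a k (\<gamma> z))" if z: "z \<in> ?B" for z k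
  proof -
    have "y z k = (\<Sum>j\<in>A. z $ j * ray_integral A 0 (\<lambda>y. Y j k (\<gamma> y)) z
        + (\<Sum>a\<in>A. z $ a * (z $ j * partial j (ray_integral A 0 (\<lambda>y. Y a k (\<gamma> y))) z)))"
      unfolding y_def jac_eq[OF z]
      by (intro sum.cong refl) (simp add: sum.distrib distrib_left sum_distrib_left mult_ac)
    also have "\<dots> = (\<Sum>a\<in>A. z $ a * ray_integral A 0 (\<lambda>y. Y a k (\<gamma> y)) z)
        + (\<Sum>a\<in>A. z $ a * (\<Sum>j\<in>A. z $ j * partial j (ray_integral A 0 (\<lambda>y. Y a k (\<gamma> y))) z))"
      unfolding sum.distrib sum_distrib_left by (subst sum.swap) simp
    also have "\<dots> = (\<Sum>a\<in>A. z $ a * Y a k (\<gamma> z))"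
      by (simp add: ray_integral_euler[OF YGs z] right_diff_distrib sum_subtractf)
    finally show ?thesis .
  qed
  have Ry0: "R (\<gamma> z) *v (\<chi> k. y z k) = 0" if z: "z \<in> ?B" for z
  proof -
    have "(\<chi> k. y z k) = (\<Sum>a\<in>A. z $ a *\<^sub>R column a (Q (\<gamma> z) ** J0))"
      by (simp add: vec_eq_iff euler[OF z] Y_def column_def)
    then have "R (\<gamma> z) *v (\<chi> k. y z k) = (\<Sum>a\<in>A. z $ a *\<^sub>R (R (\<gamma> z) *v column a (Q (\<gamma> z) ** J0)))"
      by (simp add: matrix_vector_mult_scaleR A_def matrix_vector_right_distrib)
    then show ?thesis
      by (simp add: matrix_vector_column matrix_mul_assoc RQ[OF \<gamma>in[OF z]]) (simp add: column_def vec_eq_iff)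
  qed
  have par_R: "mpartial l R x = R x ** Gam g l x - Gam g l x ** R x" if "x \<in> V" for l x
  proof -
    have "mpartial l R x = (1/2) *\<^sub>R mpartial l P x"
      unfolding R_def[abs_def]
      using smooth_matrix_differentiable[OF Ps that]
      by (subst mpartial_scaleR) (auto simp: mpartial_add intro!: differentiable_add)
    then show ?thesis
      using par that
      by (simp add: parallel_on_def R_def matrix_mul_distrib scaleR_add_right scaleR_diff_right)
  qed
  have Rd: "(\<lambda>x. R x $ i $ j) differentiable (at (\<gamma> z))" if "z \<in> ?B" for z i j
    by (rule smooth_matrix_differentiable[OF Rs \<gamma>in[OF that]])
  have Rgd: "(\<lambda>z. R (\<gamma> z) $ i $ j) differentiable (at z)" if "z \<in> ?B" for z i j
    by (rule differentiable_compose_vec[OF Rd[OF that] \<phi>_d[OF that]])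
  have dR: "mpartial c (\<lambda>z. R (\<gamma> z)) z = R (\<gamma> z) ** Gam_along g \<gamma> c z - Gam_along g \<gamma> c z ** R (\<gamma> z)"
    if z: "z \<in> ?B" for z c
    unfolding mpartial_compose[OF Rd[OF z] \<phi>_d[OF z]] par_R[OF \<gamma>in[OF z]] Gam_along_def
    by (simp add: sum4 matrix_mul_distrib algebra_simps)
  \<comment> \<open>components of the coordinate fields transverse to the leaf\<close>
  define Z where "Z z = R (\<gamma> z) ** jac \<gamma> z" for z
  have Zs: "smooth_matrix ?B Z"
    unfolding Z_def[abs_def]
    by (intro smooth_matrix_mul open_ball smooth_matrix_compose[OF V(1) open_ball \<gamma>V Rs \<gamma>s] smooth_matrix_jac[OF \<gamma>s])
  have dZ: "mpartial c Z z = R (\<gamma> z) ** cov_frame g \<gamma> c z - Gam_along g \<gamma> c z ** Z z" if z: "z \<in> ?B" for z c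
    unfolding Z_def[abs_def] mpartial_mul[OF Rgd[OF z] jac_d[OF z]] dR[OF z] cov_frame_def
    by (simp add: matrix_algebra algebra_simps)
  have yd: "(\<lambda>z. y z k) differentiable (at z)" if "z \<in> ?B" for z k
    unfolding y_def using jac_d[OF that] by (auto intro!: differentiable_sum differentiable_mult differentiable_proj)
  \<comment> \<open>\<open>R\<close> kills the radial field and is parallel, so it also kills the
    covariant derivatives of that field.\<close>
  have Rdy: "R (\<gamma> z) *v ((\<chi> k. partial j (\<lambda>z. y z k) z) + Gam_along g \<gamma> j z *v (\<chi> k. y z k)) = 0"
    if z: "z \<in> ?B" for z j
  proof -
    have "(mpartial j (\<lambda>z. R (\<gamma> z)) z *v (\<chi> k. y z k) + R (\<gamma> z) *v (\<chi> k. partial j (\<lambda>z. y z k) z)) $ i = 0" for i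
    proof -
      have "partial j (\<lambda>z. (\<Sum>k\<in>UNIV. R (\<gamma> z) $ i $ k * y z k)) z = partial j (\<lambda>z. 0) z"
        using Ry0 by (intro partial_cong[OF open_ball z]) (simp add: vec_eq_iff matrix_vector_mult_def)
      then show ?thesis
        using Rgd[OF z] yd[OF z]
        by (simp add: partial_sum partial_mult differentiable_mult sum.distrib matrix_vector_mult_def mpartial_def)
    qed
    then have "mpartial j (\<lambda>z. R (\<gamma> z)) z *v (\<chi> k. y z k) + R (\<gamma> z) *v (\<chi> k. partial j (\<lambda>z. y z k) z) = 0"
      by (simp add: vec_eq_iff)
    then show ?thesis
      unfolding dR[OF z] matrix_vector_mult_diff_rdistrib matrix_vector_right_distrib
        matrix_vector_mul_assoc[symmetric] Ry0[OF z]
      by (simp add: add.commute)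
  qed
  \<comment> \<open>By \<open>cov_frame_sym\<close> the radial derivative of field \<open>j\<close>
    is the derivative of the radial field along \<open>j\<close>, minus field \<open>j\<close>
    itself, which arises from differentiating the coefficient \<open>z $ j\<close>. \<open>R\<close>
    kills the derivative of the radial field, so a homogeneous linear equation for \<open>Z\<close>
    remains.\<close>
  have ZE: "(\<Sum>c\<in>A. z $ c * mpartial c Z z $ k $ j) = - Z z $ k $ j - (\<Sum>m\<in>UNIV. (\<Sum>l\<in>UNIV. y z l * Gam g l (\<gamma> z) $ k $ m) * Z z $ m $ j)"
    if z: "z \<in> ?B" and j: "j \<in> A" for z k j
  proof -
    have py: "partial j (\<lambda>z. y z m) z = jac \<gamma> z $ m $ j + (\<Sum>c\<in>A. z $ c * mpartial j (jac \<gamma>) z $ m $ c)" for m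
      unfolding y_def using jac_d[OF z] j
      by (simp add: partial_sum partial_mult partial_proj differentiable_proj differentiable_mult sum.distrib
          mpartial_def if_distrib[where f="\<lambda>x. x * _"] cong: if_cong)
    have Gy: "(Gam_along g \<gamma> j z *v (\<chi> k. y z k)) $ m = (\<Sum>c\<in>A. z $ c * (Gam_along g \<gamma> j z ** jac \<gamma> z) $ m $ c)" for m
      by (simp add: matrix_vector_mult_def matrix_matrix_mult_def y_def A_def sum4 algebra_simps)
    have D: "(\<Sum>c\<in>A. z $ c * cov_frame g \<gamma> c z $ m $ j)
        = ((\<chi> k. partial j (\<lambda>z. y z k) z) + Gam_along g \<gamma> j z *v (\<chi> k. y z k)) $ m - jac \<gamma> z $ m $ j" for m
      unfolding cov_frame_sym[OF z, of _ _ j]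
      by (simp add: py Gy cov_frame_def[of _ _ j] distrib_left sum.distrib)
    have "(\<Sum>c\<in>A. z $ c * (R (\<gamma> z) ** cov_frame g \<gamma> c z) $ k $ j)
        = (\<Sum>m\<in>UNIV. R (\<gamma> z) $ k $ m * (\<Sum>c\<in>A. z $ c * cov_frame g \<gamma> c z $ m $ j))"
      by (simp add: matrix_matrix_mult_def sum_distrib_left A_def sum4 algebra_simps)
    also have "\<dots> = (R (\<gamma> z) *v ((\<chi> k. partial j (\<lambda>z. y z k) z) + Gam_along g \<gamma> j z *v (\<chi> k. y z k))) $ k - Z z $ k $ j"
      unfolding D by (simp add: matrix_vector_mult_def Z_def matrix_matrix_mult_def right_diff_distrib sum_subtractf)
    finally have 1: "(\<Sum>c\<in>A. z $ c * (R (\<gamma> z) ** cov_frame g \<gamma> c z) $ k $ j) = - Z z $ k $ j"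
      by (simp add: Rdy[OF z])
    have 2: "(\<Sum>c\<in>A. z $ c * (Gam_along g \<gamma> c z ** Z z) $ k $ j)
        = (\<Sum>m\<in>UNIV. (\<Sum>l\<in>UNIV. y z l * Gam g l (\<gamma> z) $ k $ m) * Z z $ m $ j)"
      by (simp add: matrix_matrix_mult_def Gam_along_def y_def A_def sum4 algebra_simps)
    have "(\<Sum>c\<in>A. z $ c * mpartial c Z z $ k $ j) = (\<Sum>c\<in>A. z $ c * (R (\<gamma> z) ** cov_frame g \<gamma> c z) $ k $ j)
        - (\<Sum>c\<in>A. z $ c * (Gam_along g \<gamma> c z ** Z z) $ k $ j)"
      unfolding dZ[OF z] by (simp add: right_diff_distrib sum_subtractf)
    then show ?thesis unfolding 1 2 .
  qed
  have Z0: "Z z $ k $ j = 0" if z: "z \<in> ?B" and j: "j \<in> A" for z k j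
  proof -
    \<comment> \<open>The factor t absorbs the term - Z of \<open>ZE\<close> and gives the initial
      value 0. The radial field along the ray also carries a factor t, so the coefficients
      \<open>M\<close> are regular at t = 0.\<close>
    define h where "h k t = t * Z (ray A z t) $ k $ j" for k t
    define M where "M k m t = - (\<Sum>l\<in>UNIV. (\<Sum>a\<in>A. z $ a * Y a l (\<gamma> (ray A z t))) * Gam g l (\<gamma> (ray A z t)) $ k $ m)" for k m t
    have "h k 1 = 0" for k
    proof (rule linear_ode_zero[of h M])
      fix k and t :: real assume t: "0 \<le> t" "t \<le> 1"
      let ?w = "ray A z t"
      have w: "?w \<in> ?B" by (rule ray_in_ball[OF z t])
      have "(h k has_real_derivative (1 * Z ?w $ k $ j + (\<Sum>a\<in>A. z $ a * partial a (\<lambda>w. Z w $ k $ j) ?w) * t)) (at t)"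
        unfolding h_def[abs_def]
        by (intro DERIV_mult DERIV_ident ray_has_derivative smooth_matrix_differentiable[OF Zs w])
      moreover have "1 * Z ?w $ k $ j + (\<Sum>a\<in>A. z $ a * partial a (\<lambda>w. Z w $ k $ j) ?w) * t = (\<Sum>m\<in>UNIV. M k m t * h m t)"
      proof -
        have wA: "?w $ c = t * z $ c" if "c \<in> A" for c using that by (simp add: ray_def)
        have "(\<Sum>a\<in>A. z $ a * partial a (\<lambda>w. Z w $ k $ j) ?w) * t = (\<Sum>c\<in>A. ?w $ c * mpartial c Z ?w $ k $ j)"
          unfolding sum_distrib_right by (intro sum.cong refl) (simp add: wA mpartial_def)
        also have "\<dots> = - Z ?w $ k $ j - (\<Sum>m\<in>UNIV. (\<Sum>l\<in>UNIV. y ?w l * Gam g l (\<gamma> ?w) $ k $ m) * Z ?w $ m $ j)"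
          by (rule ZE[OF w j])
        also have "(\<Sum>m\<in>UNIV. (\<Sum>l\<in>UNIV. y ?w l * Gam g l (\<gamma> ?w) $ k $ m) * Z ?w $ m $ j) = - (\<Sum>m\<in>UNIV. M k m t * h m t)"
        proof -
          have "y ?w l = t * (\<Sum>a\<in>A. z $ a * Y a l (\<gamma> ?w))" for l
            by (simp add: euler[OF w] wA sum_distrib_left mult.assoc)
          then show ?thesis
            by (simp add: M_def h_def sum_negf sum_distrib_left sum_distrib_right mult_ac)
        qed
        finally show ?thesis by simp
      qed
      ultimately show "(h k has_real_derivative (\<Sum>m\<in>UNIV. M k m t * h m t)) (at t)" by simp
    next
      fix k m
      have rc: "continuous_on {0..1} (\<lambda>t. ray A z t)"
        using continuous_on_compose2[OF continuous_on_ray[of UNIV A], of "{0..1}" "\<lambda>t. (z, t)"]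
        by (simp add: continuous_on_Pair)
      have c1: "continuous_on {0..1} (\<lambda>t. f (ray A z t))" if "smooth_on ?B f" for f
        by (rule continuous_on_compose2[OF smooth_on_continuous[OF that] rc]) (use ray_in_ball[OF z] in auto)
      have "smooth_on ?B (\<lambda>w. Gam g l (\<gamma> w) $ k $ m)" for l
        using smooth_matrix_compose[OF openU[OF st] open_ball \<phi>W Gam_smooth[OF st] \<gamma>s] by (rule smooth_matrix_entry)
      then show "continuous_on {0..1} (M k m)"
        unfolding M_def by (intro continuous_intros c1[OF YGs] c1)
    qed (simp add: h_def)
    then show ?thesis by (simp add: h_def)
  qed
  have "(P (\<gamma> z) ** jac \<gamma> z) $ k $ a = - jac \<gamma> z $ k $ a" if "z \<in> ?B" "a \<in> {2, 3}" for z a k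
  proof -
    have "Z z $ k $ a = (1/2) * (jac \<gamma> z $ k $ a + (P (\<gamma> z) ** jac \<gamma> z) $ k $ a)"
      by (simp add: Z_def R_def matrix_mul_distrib)
    then show ?thesis using Z0[OF that(1), of a k] that(2) by (simp add: A_def)
  qed
  then show thesis by (intro that[OF \<delta> \<gamma>s \<gamma>V \<gamma>0 jac0])
qed

text \<open>\<open>f\<close> inverts the leaf map, so a vector annihilated by the differentials of
  its components 0 and 1 is tangent to a leaf and lies in the eigenspace. For the converse the two
  leaf fields must fill the eigenspace, which \<open>M\<close> serves to show.\<close>

lemma leaf_coordinates:
  assumes p: "p \<in> V" and J0: "invertible J0" "P p ** J0 = J0 ** sig"
  obtains V' f where "open V'" "p \<in> V'" "V' \<subseteq> V" "smooth_map V' f"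
    "\<forall>x\<in>V'. \<forall>v. P x *v v = - v \<longleftrightarrow> (jac f x *v v) $ 0 = 0 \<and> (jac f x *v v) $ 1 = 0"
proof -
  obtain \<delta> \<gamma> where \<delta>: "0 < \<delta>" and \<gamma>s: "smooth_map (ball 0 \<delta>) \<gamma>" and \<gamma>V: "\<gamma> ` ball 0 \<delta> \<subseteq> V"
    and \<gamma>0: "\<gamma> 0 = p" "jac \<gamma> 0 = J0"
    and leaf: "\<And>z a k. z \<in> ball 0 \<delta> \<Longrightarrow> a \<in> {2, 3} \<Longrightarrow> (P (\<gamma> z) ** jac \<gamma> z) $ k $ a = - jac \<gamma> z $ k $ a"
    by (rule integral_leaf_map[OF p J0(2)]) blast
  let ?B = "ball (0::real^4) \<delta>"
  define R where "R x = (1/2) *\<^sub>R (mat 1 + P x)" for x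
  have RP: "R x *v v = 0 \<longleftrightarrow> P x *v v = - v" for x v
  proof -
    have "R x *v v = (1/2) *\<^sub>R (v + P x *v v)"
      by (simp add: R_def scaleR_matrix_vector_assoc[symmetric] matrix_vector_mult_add_rdistrib)
    then show ?thesis by (simp add: add_eq_0_iff)
  qed
  have RR: "R x *v (R x *v v) = R x *v v" if "x \<in> V" for x v
  proof -
    have "R x ** R x = R x"
      by (simp add: R_def matrix_mul_distrib PP[OF that]) (simp add: vec_eq_iff field_simps)
    then show ?thesis by (simp add: matrix_vector_mul_assoc)
  qed
  \<comment> \<open>Two projected vectors for the eigenvalue 1, completed by the two leaf fields.
    This frame is \<open>J0\<close> at 0 and hence invertible nearby, where it splits every vector
    into its eigenparts.\<close>
  define M where "M z = (\<chi> i a. if a \<in> {0, 1} then (R (\<gamma> z) ** J0) $ i $ a else jac \<gamma> z $ i $ a)" for z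
  have Ms: "smooth_matrix ?B M"
  proof -
    have "smooth_matrix V R"
      unfolding R_def[abs_def]
      by (intro smooth_matrix_scaleR smooth_matrix_add smooth_matrix_const smooth_on_const V Ps)
    then have 1: "smooth_matrix ?B (\<lambda>z. R (\<gamma> z) ** J0)"
      by (intro smooth_matrix_mul open_ball smooth_matrix_const smooth_matrix_compose[OF V(1) open_ball \<gamma>V _ \<gamma>s])
    show ?thesis
      unfolding smooth_matrix_def
    proof (intro allI)
      show "smooth_on ?B (\<lambda>z. M z $ i $ a)" for i a
        using smooth_matrix_entry[OF 1, of i a] smooth_matrix_entry[OF smooth_matrix_jac[OF \<gamma>s], of i a]
        by (cases "a \<in> {0, 1}") (auto simp: M_def)
    qed
  qed
  have M0: "M 0 = J0"
  proof -
    have "R p ** J0 = (1/2) *\<^sub>R (J0 + J0 ** sig)" by (simp add: R_def matrix_mul_distrib J0)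
    then have "(R p ** J0) $ i $ a = J0 $ i $ a" if "a \<in> {0, 1}" for i a
      using that by (auto simp: mul_sig_entry)
    then show ?thesis by (simp add: M_def \<gamma>0 vec_eq_iff)
  qed
  define B' where "B' = ?B \<inter> {z. det (M z) \<noteq> 0}"
  have B'o: "open B'"
  proof -
    have "open (?B \<inter> (\<lambda>z. det (M z)) -` (- {0}))"
      by (intro continuous_open_preimage smooth_on_continuous smooth_on_det open_ball Ms) auto
    moreover have "?B \<inter> (\<lambda>z. det (M z)) -` (- {0}) = B'" by (auto simp: B'_def)
    ultimately show ?thesis by simp
  qed
  have B'0: "0 \<in> B'" using \<delta> M0 J0(1) by (simp add: B'_def invertible_det_nz)
  have \<gamma>s': "smooth_map B' \<gamma>" using \<gamma>s by (auto simp: smooth_map_def B'_def intro: smooth_on_subset)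
  obtain B'' V' f where B'': "open B''" "B'' \<subseteq> B'" "0 \<in> B''" and V': "open V'" "\<gamma> ` B'' = V'"
    and f: "smooth_map V' f" "\<And>z. z \<in> B'' \<Longrightarrow> f (\<gamma> z) = z" "\<And>x. x \<in> V' \<Longrightarrow> f x \<in> B''" "\<And>x. x \<in> V' \<Longrightarrow> \<gamma> (f x) = x"
    by (rule smooth_inverse_function[OF B'o B'0 \<gamma>s']) (use \<gamma>0 J0 in auto)
  have key: "P x *v v = - v \<longleftrightarrow> (jac f x *v v) $ 0 = 0 \<and> (jac f x *v v) $ 1 = 0" if x: "x \<in> V'" for x v
  proof -
    define z where "z = f x"
    have zB'': "z \<in> B''" and xz: "\<gamma> z = x" using f(3,4)[OF x] by (simp_all add: z_def)
    have zB: "z \<in> ?B" and detM: "det (M z) \<noteq> 0" using zB'' B''(2) by (auto simp: B'_def)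
    have xV: "x \<in> V" using zB \<gamma>V xz by blast
    have "jac \<gamma> z ** jac f x = jac (\<lambda>x. \<gamma> (f x)) x"
      unfolding z_def
      by (intro jac_compose[symmetric] smooth_map_differentiable[OF \<gamma>s] smooth_map_differentiable[OF f(1) x])
        (use zB z_def in simp)
    also have "\<dots> = mat 1" using jac_cong[OF V'(1) x f(4)] by (simp add: jac_id)
    finally have \<gamma>f: "jac \<gamma> z ** jac f x = mat 1" .
    then have f\<gamma>: "jac f x ** jac \<gamma> z = mat 1" using matrix_left_right_inverse by blast
    have Rcol: "R x *v (jac \<gamma> z *v w) = 0" if "w $ 0 = 0" "w $ 1 = 0" for w
    proof -
      have "(P x *v (jac \<gamma> z *v w)) $ k = - (jac \<gamma> z *v w) $ k" for k
      proof -
        have "(P x *v (jac \<gamma> z *v w)) $ k = ((P x ** jac \<gamma> z) *v w) $ k" by (simp add: matrix_vector_mul_assoc)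
        also have "\<dots> = - (jac \<gamma> z *v w) $ k"
          using leaf[OF zB, of 2 k] leaf[OF zB, of 3 k]
          by (simp add: xz that matrix_vector_mult_def[of "P x ** jac \<gamma> z"] matrix_vector_mult_def[of "jac \<gamma> z"] sum4)
        finally show ?thesis .
      qed
      then have "P x *v (jac \<gamma> z *v w) = - (jac \<gamma> z *v w)" by (simp add: vec_eq_iff)
      then show ?thesis by (simp only: RP)
    qed
    show ?thesis
    proof
      assume "(jac f x *v v) $ 0 = 0 \<and> (jac f x *v v) $ 1 = 0"
      then have "R x *v (jac \<gamma> z *v (jac f x *v v)) = 0" by (intro Rcol) auto
      then show "P x *v v = - v" by (simp add: matrix_vector_mul_assoc \<gamma>f flip: RP)
    next
      assume "P x *v v = - v"
      then have Rv: "R x *v v = 0" by (simp add: RP)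
      have invM: "invertible (M z)" using detM by (simp add: invertible_det_nz)
      define w where "w = matrix_inv (M z) *v v"
      have vw: "v = M z *v w" by (simp add: w_def matrix_vector_mul_assoc matrix_inv_right_left invM)
      define w1 w2 :: "real^4" where "w1 = (\<chi> i. if i \<in> {0, 1} then w $ i else 0)" and "w2 = (\<chi> i. if i \<in> {0, 1} then 0 else w $ i)"
      have "w = w1 + w2" by (simp add: w1_def w2_def vec_eq_iff)
      then have vs: "v = M z *v w1 + M z *v w2" using vw by (simp add: matrix_vector_right_distrib)
      have M1: "M z *v w1 = R x *v (J0 *v w1)"
      proof -
        have "(M z *v w1) $ i = ((R x ** J0) *v w1) $ i" for i
          unfolding matrix_vector_mult_def vec_lambda_beta sum4 by (simp add: w1_def M_def xz)
        then show ?thesis by (simp add: vec_eq_iff matrix_vector_mul_assoc)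
      qed
      have M2: "M z *v w2 = jac \<gamma> z *v w2"
        by (simp add: vec_eq_iff matrix_vector_mult_def sum4 w2_def M_def)
      have R2: "R x *v (M z *v w2) = 0" unfolding M2 by (rule Rcol) (simp_all add: w2_def)
      \<comment> \<open>\<open>R\<close> removes the leaf part and fixes the other one, so a vector
        killed by \<open>R\<close> has only a leaf part.\<close>
      have "M z *v w1 = R x *v v"
        unfolding vs matrix_vector_right_distrib R2 unfolding M1 by (simp add: RR[OF xV])
      then have "M z *v w1 = 0" by (simp add: Rv)
      then have "w1 = 0" using invM
        by (metis matrix_inv_right_left(2) matrix_vector_mul_assoc matrix_vector_mul_lid matrix_vector_mult_0_right)
      then have "v = jac \<gamma> z *v w2" using vs M2 by simp
      then have "jac f x *v v = w2" by (simp add: matrix_vector_mul_assoc f\<gamma>)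
      then show "(jac f x *v v) $ 0 = 0 \<and> (jac f x *v v) $ 1 = 0" by (simp add: w2_def)
    qed
  qed
  have "p \<in> V'" using V'(2) B''(3) \<gamma>0(1) by force
  moreover have "V' \<subseteq> V" using V'(2) B''(2) \<gamma>V by (auto simp: B'_def)
  ultimately show thesis using key by (intro that[OF V'(1) _ _ f(1)]) auto
qed

end

section \<open>From the conditions to a product chart\<close>

text \<open>Along the segment from y to y' only those coordinates contribute in which the two points
  differ, and for these the partial derivative vanishes.\<close>

lemma constant_if_partials_zero:
  assumes "convex W" "y \<in> W" "y' \<in> W" "\<And>x. x \<in> W \<Longrightarrow> f differentiable (at x)"
    and "\<And>x i. x \<in> W \<Longrightarrow> y $ i = y' $ i \<or> partial i f x = 0"
  shows "f y = f y'"
proof -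
  let ?c = "\<lambda>t. y + t *\<^sub>R (y' - y)"
  have cW: "?c t \<in> W" if "0 \<le> t" "t \<le> 1" for t
  proof -
    have "?c t = (1 - t) *\<^sub>R y + t *\<^sub>R y'" by (simp add: algebra_simps)
    then show ?thesis using convexD[OF assms(1-3), of "1 - t" t] that by simp
  qed
  have d: "((\<lambda>t. f (?c t)) has_real_derivative 0) (at t)" if "0 \<le> t" "t \<le> 1" for t
  proof -
    have "(?c has_vector_derivative (y' - y)) (at t)"
      by (auto intro!: derivative_eq_intros)
    from has_real_derivative_along[OF assms(4)[OF cW[OF that]] this]
    have "((\<lambda>t. f (?c t)) has_real_derivative (\<Sum>i\<in>UNIV. (y' - y) $ i * partial i f (?c t))) (at t)" .
    moreover have "(\<Sum>i\<in>UNIV. (y' - y) $ i * partial i f (?c t)) = 0"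
    proof (intro sum.neutral ballI)
      show "(y' - y) $ i * partial i f (?c t) = 0" for i
        using assms(5)[OF cW[OF that], of i] by auto
    qed
    ultimately show ?thesis by simp
  qed
  obtain t where "f (?c 1) - f (?c 0) = (1 - 0) * 0"
    using MVT2[OF zero_less_one d] by blast
  then show ?thesis by simp
qed

context
  fixes U g
  assumes st: "spacetime U g"
begin

lemma trace_ginv_Nmat:
  assumes "x \<in> U"
  shows "trace (ginv g x ** Nmat g x) = 0"
proof -
  have "trace (ginv g x ** Ricm g x) = scal g x" by (rule scal_trace[OF st assms, symmetric])
  moreover have "trace (ginv g x ** Nmat g x) = trace (ginv g x ** Ricm g x) - trace ((scal g x / 4) *\<^sub>R mat 1 :: real^4^4)"
    by (simp add: Nmat_matrix matrix_mul_distrib g_ginv[OF st assms] trace_sub)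
  ultimately show ?thesis by (simp add: trace_def sum4 mat_def)
qed

lemma conditions_imp_parallel:
  assumes cond: "\<And>x. x \<in> U \<Longrightarrow> product_conditions g x"
  obtains P where "smooth_matrix U P" "parallel_on U g P" "\<And>x. x \<in> U \<Longrightarrow> P x ** P x = mat 1"
    "\<And>x. x \<in> U \<Longrightarrow> transpose (g x ** P x) = g x ** P x" "\<And>x. x \<in> U \<Longrightarrow> trace (P x) = 0"
proof -
  have pos: "0 < trNsq g x" if "x \<in> U" for x using cond[OF that] by (simp add: product_conditions_def)
  have Nup_s: "smooth_matrix U (\<lambda>x. ginv g x ** Nmat g x)"
    by (intro smooth_matrix_mul openU[OF st] ginv_smooth[OF st] Nmat_smooth[OF st])
  have tr_s: "smooth_on U (trNsq g)"
    unfolding trNsq_def[abs_def] Nsq_def Nup_matrix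
    by (intro smooth_on_sum smooth_on_mult openU[OF st] smooth_matrix_entry[OF Nup_s])
  define s where "s x = 2 * inverse (sqrt (trNsq g x))" for x
  have s_s: "smooth_on U s"
    unfolding s_def[abs_def]
    by (intro smooth_on_mult smooth_on_const smooth_on_inverse smooth_on_sqrt tr_s openU[OF st])
      (use pos pos[THEN less_imp_neq] in auto)
  have s2: "s x * (s x * trNsq g x) = 4" if "x \<in> U" for x
    using pos[OF that] by (simp add: s_def field_simps)
  define P where "P x = s x *\<^sub>R (ginv g x ** Nmat g x)" for x
  have Ps: "smooth_matrix U P"
    unfolding P_def[abs_def] by (rule smooth_matrix_scaleR[OF openU[OF st] s_s Nup_s])
  have PP: "P x ** P x = mat 1" if "x \<in> U" for x
  proof -
    have "ginv g x ** Nmat g x ** (ginv g x ** Nmat g x) = (trNsq g x / 4) *\<^sub>R mat 1"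
      using cond[OF that] by (simp add: vec_eq_iff product_conditions_def Nsq_matrix mat_def)
    then show ?thesis
      using s2[OF that] by (simp add: P_def matrix_mul_distrib)
  qed
  have gP: "g x ** P x = s x *\<^sub>R Nmat g x" if "x \<in> U" for x
    by (simp add: P_def matrix_mul_distrib matrix_mul_assoc g_ginv[OF st that])
  have sym: "transpose (g x ** P x) = g x ** P x" if "x \<in> U" for x
    by (simp add: gP[OF that] transpose_simps Nmat_sym[OF st that])
  have tr: "trace (P x) = 0" if "x \<in> U" for x
    using trace_ginv_Nmat[OF that] by (simp add: P_def trace_def flip: sum_distrib_left)
  have par: "mpartial l P x = P x ** Gam g l x - Gam g l x ** P x" if x: "x \<in> U" for x l
  proof -
    have tr_d: "trNsq g differentiable (at x)" by (rule smooth_on_differentiable[OF tr_s x])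
    have sq_d: "(\<lambda>x. sqrt (trNsq g x)) differentiable (at x)" by (rule differentiable_sqrt[OF tr_d pos[OF x]])
    have sq0: "sqrt (trNsq g x) \<noteq> 0" using pos[OF x] by simp
    \<comment> \<open>The logarithmic derivative of \<open>s\<close> is minus half that of tr N^2,
      so it cancels the right-hand side of the third condition.\<close>
    have ds: "partial l s x = - s x * (partial l (trNsq g) x / trNsq g x) / 2"
    proof -
      have "partial l s x = 2 * partial l (\<lambda>x. inverse (sqrt (trNsq g x))) x"
        unfolding s_def[abs_def] by (rule partial_cmult) (use sq_d sq0 in \<open>simp add: differentiable_inverse\<close>)
      also have "\<dots> = - s x * (partial l (trNsq g) x / (sqrt (trNsq g x) * sqrt (trNsq g x))) / 2"
        unfolding partial_inverse[OF sq_d sq0] partial_sqrt[OF tr_d pos[OF x]] s_def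
        using sq0 by (simp add: field_simps)
      finally show ?thesis using pos[OF x] by simp
    qed
    have Nd: "(\<lambda>y. Nmat g y $ i $ j) differentiable (at x)" for i j
      by (rule smooth_matrix_differentiable[OF Nmat_smooth[OF st] x])
    have gd: "(\<lambda>y. g y $ i $ j) differentiable (at x)" for i j
      by (rule smooth_matrix_differentiable[OF g_smooth[OF st] x])
    have Pd: "(\<lambda>y. P y $ i $ j) differentiable (at x)" for i j
      by (rule smooth_matrix_differentiable[OF Ps x])
    have "(mpartial l (Nmat g) x - transpose (Gam g l x) ** Nmat g x - Nmat g x ** Gam g l x) $ a $ b
        = ((partial l (trNsq g) x / trNsq g x / 2) *\<^sub>R Nmat g x) $ a $ b" for a b
    proof -
      have "nablaN g l a b x = (1/2) * partial l (\<lambda>y. ln (trNsq g y)) x * TFRic g a b x"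
        using cond[OF x] unfolding product_conditions_def by blast
      then show ?thesis
        unfolding nablaN_matrix[symmetric] partial_ln[OF tr_d pos[OF x]] by (simp add: Nmat_def)
    qed
    then have "mpartial l (Nmat g) x - transpose (Gam g l x) ** Nmat g x - Nmat g x ** Gam g l x
        = (partial l (trNsq g) x / trNsq g x / 2) *\<^sub>R Nmat g x"
      unfolding vec_eq_iff by blast
    then have dN: "mpartial l (Nmat g) x = (partial l (trNsq g) x / trNsq g x / 2) *\<^sub>R Nmat g x
        + transpose (Gam g l x) ** Nmat g x + Nmat g x ** Gam g l x"
      by (simp add: algebra_simps)
    have "mpartial l (\<lambda>x. g x ** P x) x = mpartial l (\<lambda>x. s x *\<^sub>R Nmat g x) x"
      by (rule mpartial_cong[OF openU[OF st] x gP])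
    then have "mpartial l g x ** P x + g x ** mpartial l P x
        = partial l s x *\<^sub>R Nmat g x + s x *\<^sub>R mpartial l (Nmat g) x"
      by (simp add: mpartial_mul[OF gd Pd] mpartial_scaleR[OF smooth_on_differentiable[OF s_s x] Nd])
    also have "\<dots> = s x *\<^sub>R (transpose (Gam g l x) ** Nmat g x) + s x *\<^sub>R (Nmat g x ** Gam g l x)"
      unfolding dN ds by (simp add: scaleR_add_right)
    also have "\<dots> = transpose (Gam g l x) ** (g x ** P x) + g x ** P x ** Gam g l x"
      by (simp add: gP[OF x] matrix_mul_distrib)
    finally have "g x ** mpartial l P x = g x ** (P x ** Gam g l x - Gam g l x ** P x)"
      unfolding metric_compatible[OF st x] by (simp add: matrix_algebra algebra_simps)
    then show ?thesis by (rule matrix_cancel_left[OF g_inv[OF st x]])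
  qed
  then have "parallel_on U g P" by (simp add: parallel_on_def)
  then show thesis by (intro that[OF Ps _ PP sym tr])
qed

text \<open>Self-adjointness of \<open>P\<close> makes the eigenspaces orthogonal; in matrix terms
  \<open>H ** sig\<close> is symmetric, so \<open>H\<close> commutes with
  \<open>sig\<close>.\<close>

lemma frame_block:
  fixes G P J :: "real^4^4"
  assumes "transpose (G ** P) = G ** P" "transpose G = G" "P ** J = J ** sig"
  defines "H \<equiv> transpose J ** G ** J"
  shows "H = block (upper_block H) (lower_block H)"
proof (rule block_decomposition)
  have "H ** sig = transpose J ** (G ** P) ** J"
    unfolding H_def by (metis assms(3) matrix_mul_assoc)
  moreover have "transpose (transpose J ** (G ** P) ** J) = sig ** H"
  proof -
    have "transpose sig = sig" by (simp add: sig_block block_arith transpose_simps transpose_mat)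
    moreover have "transpose H = H" by (simp add: H_def transpose_simps assms(2) matrix_mul_assoc)
    moreover have "transpose (transpose J ** (G ** P) ** J) = transpose (H ** sig)"
      by (simp only: \<open>H ** sig = _\<close>)
    ultimately have "transpose (transpose J ** (G ** P) ** J) = sig ** H"
      by (simp add: transpose_simps(5))
    then show ?thesis .
  qed
  moreover have "transpose (transpose J ** (G ** P) ** J) = transpose J ** (G ** P) ** J"
    unfolding transpose_simps(5)[of "transpose J ** (G ** P)" J] transpose_simps(5)[of "transpose J" "G ** P"]
      assms(1) transpose_transpose by (simp only: matrix_mul_assoc)
  ultimately show "H ** sig = sig ** H" by simp
qed

text \<open>The leaf functions of \<open>P\<close> become the coordinates 0 and 1, those of - P the
  coordinates 2 and 3. Each pair is constant along the leaves of one distribution, so the coordinate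
  fields of the other pair span that distribution.\<close>

lemma adapted_coordinates:
  assumes Ps: "smooth_matrix U P" and par: "parallel_on U g P" and PP: "\<And>x. x \<in> U \<Longrightarrow> P x ** P x = mat 1"
    and p: "p \<in> U" and tr: "trace (P p) = 0"
  obtains U' W \<psi> \<phi> where "open U'" "p \<in> U'" "U' \<subseteq> U" "open W" "\<phi> ` W = U'" "smooth_map U' \<psi>" "smooth_map W \<phi>"
    "\<forall>x\<in>U'. \<psi> x \<in> W \<and> \<phi> (\<psi> x) = x"
    "\<forall>y\<in>W. \<psi> (\<phi> y) = y \<and> invertible (jac \<phi> y) \<and> P (\<phi> y) ** jac \<phi> y = jac \<phi> y ** sig"
proof -
  note oU = openU[OF st]
  obtain J0 where J0: "invertible J0" "P p ** J0 = J0 ** sig"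
    by (rule involution_frame[OF PP[OF p] tr])
  have "- P p ** - P p = mat 1" "trace (- P p) = 0"
    using PP[OF p] tr by (simp_all add: matrix_mul_distrib trace_def sum_negf)
  then obtain J1 where J1: "invertible J1" "- P p ** J1 = J1 ** sig"
    by (rule involution_frame)
  obtain V1 f1 where V1: "open V1" "p \<in> V1" "V1 \<subseteq> U" and f1: "smooth_map V1 f1"
    and k1: "\<forall>x\<in>V1. \<forall>v. P x *v v = - v \<longleftrightarrow> (jac f1 x *v v) $ 0 = 0 \<and> (jac f1 x *v v) $ 1 = 0"
    by (rule leaf_coordinates[OF st oU subset_refl Ps par PP p J0]) blast
  have mPs: "smooth_matrix U (\<lambda>x. - P x)"
    using Ps by (simp add: smooth_matrix_def smooth_on_minus[OF oU])
  have mpar: "parallel_on U g (\<lambda>x. - P x)"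
  proof -
    have "mpartial l (\<lambda>x. - P x) x = - mpartial l P x" if "x \<in> U" for l x
      using smooth_matrix_differentiable[OF Ps that] by (simp add: vec_eq_iff mpartial_def partial_minus)
    then show ?thesis using par by (simp add: parallel_on_def matrix_mul_distrib)
  qed
  obtain V2 f2 where V2: "open V2" "p \<in> V2" "V2 \<subseteq> U" and f2: "smooth_map V2 f2"
    and k2: "\<forall>x\<in>V2. \<forall>v. - P x *v v = - v \<longleftrightarrow> (jac f2 x *v v) $ 0 = 0 \<and> (jac f2 x *v v) $ 1 = 0"
    by (rule leaf_coordinates[OF st oU subset_refl mPs mpar _ p J1]) (use PP in \<open>auto simp: matrix_mul_distrib\<close>)
  define \<psi> :: "real^4 \<Rightarrow> real^4" where "\<psi> x = (\<chi> i. if i = 0 then f1 x $ 0 else if i = 1 then f1 x $ 1 else if i = 2 then f2 x $ 0 else f2 x $ 1)" for x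
  define V where "V = V1 \<inter> V2"
  have V: "open V" "p \<in> V" "V \<subseteq> U" using V1 V2 by (auto simp: V_def)
  have \<psi>s: "smooth_map V \<psi>"
  proof -
    have "smooth_on V (\<lambda>x. f1 x $ i)" "smooth_on V (\<lambda>x. f2 x $ i)" for i
      using f1 f2 smooth_on_subset[of _ _ V] by (auto simp: V_def smooth_map_def)
    then have "smooth_on V (\<lambda>x. \<psi> x $ i)" for i
      unfolding \<psi>_def by (cases "i = 0"; cases "i = 1"; cases "i = 2") auto
    then show ?thesis by (simp add: smooth_map_def)
  qed
  have jac\<psi>: "(jac \<psi> x *v v) $ 0 = (jac f1 x *v v) $ 0" "(jac \<psi> x *v v) $ 1 = (jac f1 x *v v) $ 1"
    "(jac \<psi> x *v v) $ 2 = (jac f2 x *v v) $ 0" "(jac \<psi> x *v v) $ 3 = (jac f2 x *v v) $ 1" for x v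
    by (simp_all add: jac_def \<psi>_def matrix_vector_mult_def)
  have minus: "P x *v v = - v \<longleftrightarrow> (jac \<psi> x *v v) $ 0 = 0 \<and> (jac \<psi> x *v v) $ 1 = 0" if "x \<in> V" for x v
    using k1 that by (simp add: V_def jac\<psi>)
  have plus: "P x *v v = v \<longleftrightarrow> (jac \<psi> x *v v) $ 2 = 0 \<and> (jac \<psi> x *v v) $ 3 = 0" if "x \<in> V" for x v
  proof -
    have "- P x *v v = - (P x *v v)" by (simp add: vec_eq_iff matrix_vector_mult_def sum_negf)
    then show ?thesis using k2[rule_format, of x v] that by (simp add: V_def jac\<psi>)
  qed
  \<comment> \<open>A vector in the kernel lies in both eigenspaces, so it equals its own
    negative.\<close>
  have inv: "invertible (jac \<psi> x)" if x: "x \<in> V" for x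
  proof -
    have "v = 0" if "jac \<psi> x *v v = 0" for v
    proof -
      have "P x *v v = - v" "P x *v v = v" using minus[OF x, of v] plus[OF x, of v] that by auto
      then have "v = - v" by simp
      then show ?thesis by (simp add: eq_neg_iff_add_eq_0 flip: scaleR_2)
    qed
    then have "\<exists>B. B ** jac \<psi> x = mat 1" using matrix_left_invertible_ker by blast
    then show ?thesis by (simp add: invertible_left_inverse)
  qed
  obtain U' W \<phi> where U': "open U'" "U' \<subseteq> V" "p \<in> U'" and W: "open W" "\<psi> ` U' = W" and \<phi>s: "smooth_map W \<phi>"
    and \<phi>\<psi>: "\<And>x. x \<in> U' \<Longrightarrow> \<phi> (\<psi> x) = x" and \<phi>U': "\<And>y. y \<in> W \<Longrightarrow> \<phi> y \<in> U'" and \<psi>\<phi>: "\<And>y. y \<in> W \<Longrightarrow> \<psi> (\<phi> y) = y"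
    by (rule smooth_inverse_function[OF V(1,2) \<psi>s inv[OF V(2)]]) blast
  have frame: "invertible (jac \<phi> y) \<and> P (\<phi> y) ** jac \<phi> y = jac \<phi> y ** sig" if y: "y \<in> W" for y
  proof -
    have xV: "\<phi> y \<in> V" using \<phi>U'[OF y] U'(2) by blast
    have "jac \<psi> (\<phi> y) ** jac \<phi> y = jac (\<lambda>y. \<psi> (\<phi> y)) y"
      by (intro jac_compose[symmetric] smooth_map_differentiable[OF \<psi>s xV] smooth_map_differentiable[OF \<phi>s y])
    also have "\<dots> = mat 1" using jac_cong[OF W(1) y \<psi>\<phi>] by (simp add: jac_id)
    finally have J: "jac \<psi> (\<phi> y) ** jac \<phi> y = mat 1" .
    \<comment> \<open>Column \<open>a\<close> is annihilated by the differentials of all other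
      coordinates, so \<open>plus\<close> and \<open>minus\<close> place it in its
      eigenspace.\<close>
    have col: "jac \<psi> (\<phi> y) *v column a (jac \<phi> y) = axis a 1" for a
      unfolding matrix_vector_column J by (simp add: column_def mat_def axis_def vec_eq_iff)
    have "P (\<phi> y) *v column a (jac \<phi> y) = column a (jac \<phi> y)" if "a \<in> {0, 1}" for a
      using that by (subst plus[OF xV]) (auto simp: col axis_def)
    moreover have "P (\<phi> y) *v column a (jac \<phi> y) = - column a (jac \<phi> y)" if "a \<notin> {0, 1}" for a
      using that by (subst minus[OF xV]) (auto simp: col axis_def)
    ultimately have "(P (\<phi> y) ** jac \<phi> y) $ i $ a = (jac \<phi> y ** sig) $ i $ a" for i a
      unfolding mul_sig_entry matrix_vector_column
      by (cases "a \<in> {0, 1}") (auto simp: column_def vec_eq_iff)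
    moreover have "invertible (jac \<phi> y)" using J invertible_right_inverse matrix_left_right_inverse by blast
    ultimately show ?thesis by (simp add: vec_eq_iff)
  qed
  show thesis
  proof (rule that[OF U'(1,3) _ W(1) _ _ \<phi>s])
    show "U' \<subseteq> U" using U'(2) V(3) by blast
    show "\<phi> ` W = U'" using W(2) \<phi>\<psi> \<phi>U' by force
    show "smooth_map U' \<psi>" using \<psi>s U'(2) by (auto simp: smooth_map_def intro: smooth_on_subset)
  qed (use W(2) \<phi>\<psi> \<psi>\<phi> frame in auto)
qed

text \<open>The time-like eigenvector \<open>v\<close> decides that the block with indices 0 and 1
  is the Lorentzian one.\<close>

lemma chart_from_projector:
  assumes Ps: "smooth_matrix U P" and par: "parallel_on U g P" and PP: "\<And>x. x \<in> U \<Longrightarrow> P x ** P x = mat 1"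
    and sym: "\<And>x. x \<in> U \<Longrightarrow> transpose (g x ** P x) = g x ** P x"
    and p: "p \<in> U" and tr: "trace (P p) = 0" and v: "P p *v v = v" "v \<bullet> (g p *v v) < 0"
  shows "\<exists>V \<phi> W vh hh. product_chart U g p V \<phi> W vh hh"
proof -
  obtain U' W1 \<psi> \<phi> where U': "open U'" "p \<in> U'" "U' \<subseteq> U" and W1: "open W1" "\<phi> ` W1 = U'"
    and \<psi>s: "smooth_map U' \<psi>" and \<phi>s: "smooth_map W1 \<phi>"
    and b1: "\<forall>x\<in>U'. \<psi> x \<in> W1 \<and> \<phi> (\<psi> x) = x"
    and b2: "\<forall>y\<in>W1. \<psi> (\<phi> y) = y \<and> invertible (jac \<phi> y) \<and> P (\<phi> y) ** jac \<phi> y = jac \<phi> y ** sig"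
    by (rule adapted_coordinates[OF Ps par PP p tr]) blast
  have \<psi>W: "\<psi> x \<in> W1" and \<phi>\<psi>: "\<phi> (\<psi> x) = x" if "x \<in> U'" for x using b1 that by auto
  have \<psi>\<phi>: "\<psi> (\<phi> y) = y" and inv: "invertible (jac \<phi> y)" and PJ: "P (\<phi> y) ** jac \<phi> y = jac \<phi> y ** sig"
    if "y \<in> W1" for y using b2 that by auto
  interpret chart_map U g W1 \<phi>
    by unfold_locales (use st W1 U' \<phi>s in auto)
  define H where "H y = transpose (jac \<phi> y) ** g (\<phi> y) ** jac \<phi> y" for y
  have Hs: "smooth_matrix W1 H"
    unfolding H_def[abs_def]
    by (intro smooth_matrix_mul W1(1) smooth_matrix_transpose smooth_matrix_jac[OF \<phi>s]
        smooth_matrix_compose[OF openU[OF st] W1(1) \<phi>W g_smooth[OF st] \<phi>s])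
  have Hb: "H y = block (upper_block (H y)) (lower_block (H y))" if "y \<in> W1" for y
    unfolding H_def by (rule frame_block[OF sym[OF \<phi>U[OF that]] g_sym[OF st \<phi>U[OF that]] PJ[OF that]])
  have Hlor: "lorentzian4 (H y)" if "y \<in> W1" for y
    unfolding H_def
    by (rule lorentzian4_congruence[OF _ inv[OF that]]) (use st \<phi>U[OF that] in \<open>simp add: spacetime_def\<close>)
  have alt: "lorentzian2 (upper_block (H y)) \<and> riemannian2 (lower_block (H y))
      \<or> lorentzian2 (lower_block (H y)) \<and> riemannian2 (upper_block (H y))" if "y \<in> W1" for y
    using lorentz_block[of "upper_block (H y)" "lower_block (H y)"] Hlor[OF that] Hb[OF that] by simp
  define q where "q = \<psi> p"
  have q: "q \<in> W1" "\<phi> q = p" using \<psi>W \<phi>\<psi> U'(2) by (auto simp: q_def)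
  have detq: "det (upper_block (H q)) < 0"
  proof -
    define u where "u = matrix_inv (jac \<phi> q) *v v"
    have vu: "v = jac \<phi> q *v u" by (simp add: u_def matrix_vector_mul_assoc matrix_inv_right_left inv[OF q(1)])
    have "jac \<phi> q *v (sig *v u) = jac \<phi> q *v u"
      using v(1) unfolding vu by (simp add: matrix_vector_mul_assoc PJ[OF q(1)] flip: q(2))
    then have "matrix_inv (jac \<phi> q) *v (jac \<phi> q *v (sig *v u)) = matrix_inv (jac \<phi> q) *v (jac \<phi> q *v u)" by simp
    then have su: "sig *v u = u"
      by (simp add: matrix_vector_mul_assoc matrix_mul_assoc matrix_inv_right_left inv[OF q(1)])
    have "(sig *v u) $ 2 = - u $ 2" "(sig *v u) $ 3 = - u $ 3"
      by (simp_all add: matrix_vector_mult_def sum4 sig_def)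
    then have "u $ 2 = 0" "u $ 3 = 0" using su by auto
    then have "vhi u = 0" by (simp add: vhi_def vec_eq_iff)
    moreover have "u \<bullet> (H q *v u) < 0"
      using v(2) unfolding vu by (simp add: H_def q(2) quad_form_congruence)
    ultimately have "vlo u \<bullet> (upper_block (H q) *v vlo u) < 0"
      by (subst (asm) Hb[OF q(1)]) (simp add: quad_form_block)
    then have "\<not> riemannian2 (upper_block (H q))"
      unfolding riemannian2_def by (metis inner_zero_left less_asym less_irrefl)
    then show ?thesis using alt[OF q(1)] lorentzian2_det by blast
  qed
  \<comment> \<open>The alternatives in \<open>alt\<close> differ in the sign of the determinant of
    the upper block. A negative determinant is an open condition, so the choice made at
    \<open>q\<close> persists on a ball.\<close>
  have "open (W1 \<inter> (\<lambda>y. det (upper_block (H y))) -` {..<0})"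
  proof (rule continuous_open_preimage[OF smooth_on_continuous W1(1) open_lessThan])
    show "smooth_on W1 (\<lambda>y. det (upper_block (H y)))"
      unfolding det2 upper_block_def
      by (simp add: smooth_on_diff smooth_on_mult W1(1) smooth_matrix_entry[OF Hs])
  qed
  moreover have "q \<in> W1 \<inter> (\<lambda>y. det (upper_block (H y))) -` {..<0}" using q detq by simp
  ultimately obtain r where r: "0 < r" and rW: "ball q r \<subseteq> W1 \<inter> (\<lambda>y. det (upper_block (H y))) -` {..<0}"
    using open_contains_ball by blast
  \<comment> \<open>A ball is convex, as \<open>constant_if_partials_zero\<close> requires, and
    stable under resetting coordinates to those of its centre \<open>q\<close>.\<close>
  define W where "W = ball q r"
  have W: "open W" "convex W" "W \<subseteq> W1" "q \<in> W" using rW r by (auto simp: W_def)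
  have lr: "lorentzian2 (upper_block (H y))" "riemannian2 (lower_block (H y))" if "y \<in> W" for y
  proof -
    have "y \<in> W1" "det (upper_block (H y)) < 0" using that rW by (auto simp: W_def)
    then show "lorentzian2 (upper_block (H y))" "riemannian2 (lower_block (H y))"
      using alt[of y] riemannian2_det(2)[of "upper_block (H y)"] by auto
  qed
  have dH: "partial c (\<lambda>y. H y $ a $ b) y = 0"
    if y: "y \<in> W1" and abc: "a \<in> {0,1} \<longleftrightarrow> c \<notin> {0,1}" "b \<in> {0,1} \<longleftrightarrow> c \<notin> {0,1}" for y a b c
  proof -
    define L where "L c = transpose (jac \<phi> y) ** g (\<phi> y) ** cov_frame g \<phi> c y" for c
    have P0: "cov_frame g \<phi> c y ** sig = P (\<phi> y) ** cov_frame g \<phi> c y" for c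
    proof -
      have "mpartial l P (\<phi> y) + Gam g l (\<phi> y) ** P (\<phi> y) - P (\<phi> y) ** Gam g l (\<phi> y) = 0" for l
        using par \<phi>U[OF y] by (simp add: parallel_on_def)
      then show ?thesis
        using frame_projector_derivative[OF y openU[OF st] \<phi>W Ps PJ, of c] by simp
    qed
    have "L c ** sig = sig ** L c" for c
    proof -
      have "L c ** sig = transpose (jac \<phi> y) ** g (\<phi> y) ** (cov_frame g \<phi> c y ** sig)"
        by (simp only: L_def matrix_mul_assoc)
      also have "\<dots> = transpose (jac \<phi> y) ** g (\<phi> y) ** P (\<phi> y) ** cov_frame g \<phi> c y"
        by (simp only: P0 matrix_mul_assoc)
      also have "\<dots> = sig ** L c"
        by (simp only: frame_sig[OF inv[OF y] PJ[OF y] Hb[OF y, unfolded H_def]] L_def matrix_mul_assoc)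
      finally show ?thesis .
    qed
    then have L0: "L c $ b $ a = 0" if "b \<in> {0,1} \<longleftrightarrow> a \<notin> {0,1}" for a b c
      using arg_cong[of "L c ** sig" "sig ** L c" "\<lambda>M. M $ b $ a"] that
      unfolding mul_sig_entry by (auto split: if_splits)
    have "partial c (\<lambda>y. H y $ a $ b) y = mpartial c (\<lambda>y. transpose (jac \<phi> y) ** g (\<phi> y) ** jac \<phi> y) y $ a $ b"
      by (simp add: mpartial_def H_def)
    also have "\<dots> = L c $ b $ a + L c $ a $ b"
      unfolding L_def by (rule koszul(1)[OF y])
    \<comment> \<open>The absence of torsion exchanges the direction \<open>c\<close> with the field
      index, after which both entries join different blocks and vanish.\<close>
    also have "\<dots> = L a $ b $ c + L b $ a $ c"
      using koszul(2)[OF y, of c b a] koszul(2)[OF y, of c a b] by (simp add: L_def)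
    finally show ?thesis using L0[of b c a] L0[of a c b] abc by auto
  qed
  have Hd: "(\<lambda>y. H y $ a $ b) differentiable (at y)" if "y \<in> W" for y a b
    using smooth_matrix_differentiable[OF Hs] that W(3) by blast
  have Hup: "H y $ a $ b = H y' $ a $ b" if "y \<in> W" "y' \<in> W" "y $ 0 = y' $ 0" "y $ 1 = y' $ 1" "a \<in> {0,1}" "b \<in> {0,1}" for y y' a b
  proof (rule constant_if_partials_zero[OF W(2) that(1,2) Hd])
    show "y $ i = y' $ i \<or> partial i (\<lambda>y. H y $ a $ b) x = 0" if "x \<in> W" for x i
      using dH[of x a i b] that W(3) \<open>y $ 0 = _\<close> \<open>y $ 1 = _\<close> \<open>a \<in> _\<close> \<open>b \<in> _\<close> by blast
  qed
  have Hlow: "H y $ a $ b = H y' $ a $ b" if "y \<in> W" "y' \<in> W" "y $ 2 = y' $ 2" "y $ 3 = y' $ 3" "a \<in> {2,3}" "b \<in> {2,3}" for y y' a b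
  proof (rule constant_if_partials_zero[OF W(2) that(1,2) Hd])
    show "y $ i = y' $ i \<or> partial i (\<lambda>y. H y $ a $ b) x = 0" if "x \<in> W" for x i
      using dH[of x a i b] that W(3) \<open>y $ 2 = _\<close> \<open>y $ 3 = _\<close> \<open>a \<in> _\<close> \<open>b \<in> _\<close>
        UNIV4 by (cases "i \<in> {0,1}") auto
  qed
  \<comment> \<open>Each block is read off with the coordinates of the other factor frozen at
    \<open>q\<close>.\<close>
  define vh where "vh s t = upper_block (H (\<chi> i. if i = 0 then s else if i = 1 then t else q $ i))" for s t
  define hh where "hh s t = lower_block (H (\<chi> i. if i = 2 then s else if i = 3 then t else q $ i))" for s t
  have inW: "(\<chi> i. if i \<in> I then y $ i else q $ i) \<in> W" if "y \<in> W" for y I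
  proof -
    have "norm ((\<chi> i. if i \<in> I then y $ i else q $ i) - q) \<le> norm (y - q)"
      by (rule norm_le_componentwise_cart) auto
    then show ?thesis using that by (simp add: W_def dist_norm norm_minus_commute)
  qed
  have vh: "vh (y $ 0) (y $ 1) = upper_block (H y)" if "y \<in> W" for y
  proof -
    have "(\<chi> i. if i = 0 then y $ 0 else if i = 1 then y $ 1 else q $ i) = (\<chi> i. if i \<in> {0,1} then y $ i else q $ i)"
      by (simp add: vec_eq_iff all4)
    then show ?thesis
      using Hup[OF inW[OF that, of "{0,1}"] that]
      by (simp add: vh_def upper_block_def vec_eq_iff)
  qed
  have hh: "hh (y $ 2) (y $ 3) = lower_block (H y)" if "y \<in> W" for y
  proof -
    have "(\<chi> i. if i = 2 then y $ 2 else if i = 3 then y $ 3 else q $ i) = (\<chi> i. if i \<in> {2,3} then y $ i else q $ i)"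
      by (simp add: vec_eq_iff all4)
    then show ?thesis
      using Hlow[OF inW[OF that, of "{2,3}"] that]
      by (simp add: hh_def lower_block_def vec_eq_iff)
  qed
  have "product_chart U g p (\<phi> ` W) \<phi> W vh hh"
    unfolding product_chart_def
  proof (intro conjI exI[of _ \<psi>] ballI)
    have eq: "\<phi> ` W = U' \<inter> \<psi> -` W"
      using W(3) W1(2) \<phi>\<psi> \<psi>\<phi> by (auto simp: image_iff subset_iff)
    show "open (\<phi> ` W)"
      unfolding eq by (rule continuous_open_preimage[OF smooth_map_continuous[OF \<psi>s] U'(1) W(1)])
    show "p \<in> \<phi> ` W" using W(4) q(2) by blast
    show "\<phi> ` W \<subseteq> U" using eq U'(3) by blast
    show "smooth_map W \<phi>" using \<phi>s W(3) by (auto simp: smooth_map_def intro: smooth_on_subset)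
    show "smooth_map (\<phi> ` W) \<psi>" using \<psi>s eq by (auto simp: smooth_map_def intro: smooth_on_subset)
    show "\<psi> (\<phi> y) = y" if "y \<in> W" for y using \<psi>\<phi> W(3) that by blast
    show "\<phi> (\<psi> x) = x" if "x \<in> \<phi> ` W" for x using \<phi>\<psi> eq that by blast
    show "pullback_at (g (\<phi> y)) \<phi> y = block (vh (y $ 0) (y $ 1)) (hh (y $ 2) (y $ 3))" if "y \<in> W" for y
      unfolding pullback_jac vh[OF that] hh[OF that] H_def[symmetric] using Hb W(3) that by blast
    show "lorentzian2 (vh (y $ 0) (y $ 1))" "riemannian2 (hh (y $ 2) (y $ 3))" if "y \<in> W" for y
      unfolding vh[OF that] hh[OF that] by (rule lr[OF that])+
  qed (use W in auto)
  then show ?thesis by blast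
qed

text \<open>The conditions determine P only up to sign. A time-like vector is the sum of orthogonal
  eigenparts, so one of these has negative square; if it is the part for -1, then - P is
  used.\<close>

lemma conditions_imp_chart:
  assumes "\<And>x. x \<in> U \<Longrightarrow> product_conditions g x" and p: "p \<in> U"
  shows "\<exists>V \<phi> W vh hh. product_chart U g p V \<phi> W vh hh"
proof -
  obtain P where P: "smooth_matrix U P" "parallel_on U g P" "\<And>x. x \<in> U \<Longrightarrow> P x ** P x = mat 1"
    "\<And>x. x \<in> U \<Longrightarrow> transpose (g x ** P x) = g x ** P x" "\<And>x. x \<in> U \<Longrightarrow> trace (P x) = 0"
    by (rule conditions_imp_parallel[OF assms(1)]) blast+
  obtain E where E: "transpose E ** g p ** E = eta4"
    using st p unfolding spacetime_def lorentzian4_def by blast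
  define t where "t = E *v (\<chi> i. if i = 0 then 1 else 0)"
  have tt: "t \<bullet> (g p *v t) = -1"
    unfolding t_def quad_form_congruence E
    by (simp add: inner_vec_def matrix_vector_mult_def sum4 eta4_def)
  define tp where "tp = (1/2) *\<^sub>R (t + P p *v t)"
  define tm where "tm = (1/2) *\<^sub>R (t - P p *v t)"
  have t: "t = tp + tm" by (simp add: tp_def tm_def algebra_simps flip: scaleR_2)
  have PPt: "P p *v (P p *v t) = t" by (simp add: matrix_vector_mul_assoc P(3)[OF p])
  have Pt: "P p *v tp = tp" "P p *v tm = - tm"
    by (simp_all add: tp_def tm_def matrix_vector_mult_scaleR matrix_vector_right_distrib
        matrix_vector_mult_diff_distrib PPt add.commute flip: scaleR_minus_right)
  have s: "(A *v x) \<bullet> y = x \<bullet> (A *v y)" if "transpose A = A" for A :: "real^4^4" and x y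
    by (metis dot_lmul_matrix that vector_transpose_matrix)
  have "tp \<bullet> (g p *v tm) = - (tp \<bullet> (g p *v tm))"
  proof -
    have "tp \<bullet> ((g p ** P p) *v tm) = ((g p ** P p) *v tp) \<bullet> tm"
      by (rule s[OF P(4)[OF p], symmetric])
    then have "- (tp \<bullet> (g p *v tm)) = (g p *v tp) \<bullet> tm"
      by (simp add: Pt flip: matrix_vector_mul_assoc) (simp add: vec_eq_iff matrix_vector_mult_def inner_vec_def sum_negf)
    also have "\<dots> = tp \<bullet> (g p *v tm)" by (rule s[OF g_sym[OF st p]])
    finally show ?thesis by simp
  qed
  then have o: "tp \<bullet> (g p *v tm) = 0" by simp
  then have "tm \<bullet> (g p *v tp) = 0"
    using s[OF g_sym[OF st p], of tp tm] by (simp add: inner_commute)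
  then have "tp \<bullet> (g p *v tp) + tm \<bullet> (g p *v tm) = -1"
    using tt o unfolding t by (simp add: matrix_vector_right_distrib inner_add_left inner_add_right)
  then consider "tp \<bullet> (g p *v tp) < 0" | "tm \<bullet> (g p *v tm) < 0" by linarith
  then show ?thesis
  proof cases
    case 1
    show ?thesis
      by (rule chart_from_projector[OF P(1-4) p P(5)[OF p] Pt(1) 1])
  next
    case 2
    have "mpartial l (\<lambda>x. - P x) x = - mpartial l P x" if "x \<in> U" for l x
      using smooth_matrix_differentiable[OF P(1) that] by (simp add: vec_eq_iff mpartial_def partial_minus)
    then have "parallel_on U g (\<lambda>x. - P x)" using P(2) by (simp add: parallel_on_def matrix_mul_distrib)
    moreover have "smooth_matrix U (\<lambda>x. - P x)"
      using P(1) by (simp add: smooth_matrix_def smooth_on_minus[OF openU[OF st]])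
    moreover have "- P p *v tm = tm"
      using Pt(2) by (simp add: vec_eq_iff matrix_vector_mult_def sum_negf)
    ultimately show ?thesis
      using P(3-5) p 2
      by (intro chart_from_projector[of "\<lambda>x. - P x" p tm])
        (auto simp: matrix_mul_distrib transpose_simps(3) trace_def sum_negf)
  qed
qed

end

text \<open>For a time-like v one has Pi(v,v) > 0 while g(v,v) < 0, so the Lorentzian block comes
  from g - Pi and the Riemannian one from g + Pi; these two signs are interchanged with respect to
  the English formula. The claim about the factors covers every product chart and every time-like
  vector.\<close>

theorem theorem1:
  assumes "spacetime U g"
    and "\<forall>x\<in>U. Nmat g x \<noteq> 0"
  shows "(is_2plus2_product U g \<longleftrightarrow> (\<forall>x\<in>U. product_conditions g x))
     \<and> (is_2plus2_product U g \<longrightarrow>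
         (\<forall>p V \<phi> W vh hh. product_chart U g p V \<phi> W vh hh \<longrightarrow>
           (\<forall>y\<in>W. \<forall>v. timelike g (\<phi> y) v \<longrightarrow>
              pullback_at ((1/2) *\<^sub>R (g (\<phi> y) - PiT g (\<phi> y) v)) \<phi> y
                = block (vh (y $ 0) (y $ 1)) 0
            \<and> pullback_at ((1/2) *\<^sub>R (g (\<phi> y) + PiT g (\<phi> y) v)) \<phi> y
                = block 0 (hh (y $ 2) (y $ 3)))))"
proof -
  have N: "Nmat g x \<noteq> 0" if "x \<in> U" for x using assms(2) that by blast
  have "product_conditions g p" if "is_2plus2_product U g" "p \<in> U" for p
  proof -
    obtain V \<phi> W vh hh where c: "product_chart U g p V \<phi> W vh hh"
      using \<open>is_2plus2_product U g\<close> \<open>p \<in> U\<close> unfolding is_2plus2_product_def by blast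
    show ?thesis
      by (rule product_chart_conditions[OF assms(1) c N chart_facts(2)[OF assms(1) c]])
  qed
  moreover have "is_2plus2_product U g" if "\<forall>x\<in>U. product_conditions g x"
    unfolding is_2plus2_product_def using conditions_imp_chart[OF assms(1)] that by blast
  ultimately show ?thesis
    using product_chart_factors[OF assms(1) _ N] by blast
qed

end
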